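(* Let $M$ be a Kähler manifold of complex dimension $n\ge 1$ (not assumed compact or complete), let $0\le p,q\le n$, and let $\omega\in\Gamma(\Lambda^{p,q}T^*M)$ be a smooth complex-valued form of type $(p,q)$ such that $(d+d^* )\omega=0$. Let $\alpha\ge 0$ be defined by \[ \alpha^2:=\begin{cases} \dfrac12 & \text{if } p\in\{0,n\}\text{ or } q\in\{0,n\},\\[2mm] \min\left\{\max\left\{\dfrac{2p+1}{2p+2},\dfrac{2n-2p+1}{2n-2p+2}\right\},\ \max\left\{\dfrac{2q+1}{2q+2},\dfrac{2n-2q+1}{2n-2q+2}\right\}\right\} & \text{otherwise.} \end{cases} \] Then at every point where $\omega\neq 0$, \[ \bigl|d|\omega|\bigr|\le \alpha\,|\nabla\omega| . \]
   Context: $\Lambda^{p,q}T^*M$ is the bundle of complex-valued forms of type $(p,q)$ with the Hermitian metric induced by the Kähler metric; $|\cdot|$ denotes the pointwise norms on $\Lambda^{p,q}T^*M$, on (real) 1-forms, and on $T^*_{\mathbb C}M\otimes\Lambda^{p,q}T^*M$ induced by this metric. $\nabla$ is the Levi-Civita connection extended complex-linearly to forms, and $\nabla\omega\in\Gamma(T^*_{\mathbb C}M\otimes\Lambda^{p,q}T^*M)$. $d^*$ is the formal adjoint of the exterior derivative $d$. *)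

theory Defs
  imports "HOL-Analysis.Analysis" "HOL-Combinatorics.Permutations"
begin

text \<open>
  A complex manifold of dimension \<open>n = CARD('n)\<close> is a topological space with a holomorphic atlas of
  charts into \<open>complex^'n\<close>.  Tensor fields are given by their representatives in the charts, subject
  to the usual transformation law.  The real tangent space at a point of a chart is \<open>complex^'n\<close>
  regarded as a real vector space of dimension \<open>2 n\<close>, with complex structure \<open>v \<mapsto> \<i> *s v\<close>.
\<close>

type_synonym ('a, 'n) cchart = "'a set \<times> ('a \<Rightarrow> complex^'n)"

text \<open>
  A complex-valued \<open>k\<close>-form at a point takes \<open>k\<close> tangent vectors; these are passed as a sequence
  of which only the entries with index below \<open>k\<close> matter (see \<open>alt_form\<close>).
\<close>

type_synonym 'n cform = "(nat \<Rightarrow> complex^'n) \<Rightarrow> complex"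


subsection \<open>Smooth functions\<close>

text \<open>Intended for open \<open>S\<close>.\<close>

primrec Ck_on :: "nat \<Rightarrow> 'v::euclidean_space set \<Rightarrow> ('v \<Rightarrow> 'w::real_normed_vector) \<Rightarrow> bool" where
  "Ck_on 0 S f \<longleftrightarrow> continuous_on S f"
| "Ck_on (Suc k) S f \<longleftrightarrow>
     (\<forall>z\<in>S. f differentiable (at z)) \<and> (\<forall>v. Ck_on k S (\<lambda>z. frechet_derivative f (at z) v))"

definition smooth_on :: "'v::euclidean_space set \<Rightarrow> ('v \<Rightarrow> 'w::real_normed_vector) \<Rightarrow> bool" where
  "smooth_on S f \<longleftrightarrow> (\<forall>k. Ck_on k S f)"

definition holomorphic_map_on :: "(complex^'n) set \<Rightarrow> (complex^'n \<Rightarrow> complex^'n) \<Rightarrow> bool" where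
  "holomorphic_map_on S f \<longleftrightarrow>
     (\<forall>z\<in>S. \<exists>L. Vector_Spaces.linear (*s) (*s) L \<and> (f has_derivative L) (at z))"


subsection \<open>Complex manifolds\<close>

definition second_countable_top :: "'a topology \<Rightarrow> bool" where
  "second_countable_top X \<longleftrightarrow>
     (\<exists>\<B>. countable \<B> \<and> (\<forall>B\<in>\<B>. openin X B) \<and>
          (\<forall>U x. openin X U \<and> x \<in> U \<longrightarrow> (\<exists>B\<in>\<B>. x \<in> B \<and> B \<subseteq> U)))"

definition chart_image :: "('a, 'n) cchart \<Rightarrow> (complex^'n) set" where
  "chart_image c = snd c ` fst c"

definition transition :: "('a, 'n) cchart \<Rightarrow> ('a, 'n) cchart \<Rightarrow> complex^'n \<Rightarrow> complex^'n" where
  "transition c c' = snd c' \<circ> inv_into (fst c) (snd c)"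

definition complex_manifold :: "'a topology \<Rightarrow> ('a, 'n::finite) cchart set \<Rightarrow> bool" where
  "complex_manifold X A \<longleftrightarrow>
     Hausdorff_space X \<and> second_countable_top X \<and>
     (\<Union>c\<in>A. fst c) = topspace X \<and>
     (\<forall>c\<in>A. openin X (fst c) \<and> open (chart_image c) \<and>
        homeomorphic_map (subtopology X (fst c)) (top_of_set (chart_image c)) (snd c)) \<and>
     (\<forall>c\<in>A. \<forall>c'\<in>A. holomorphic_map_on (snd c ` (fst c \<inter> fst c')) (transition c c'))"

definition transition_deriv ::
    "('a, 'n::finite) cchart \<Rightarrow> ('a, 'n) cchart \<Rightarrow> 'a \<Rightarrow> complex^'n \<Rightarrow> complex^'n" where
  "transition_deriv c c' x = frechet_derivative (transition c c') (at (snd c x))"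


subsection \<open>Forms and the exterior derivative\<close>

definition alt_form :: "nat \<Rightarrow> 'n::finite cform \<Rightarrow> bool" where
  "alt_form k \<alpha> \<longleftrightarrow>
     (\<forall>v w. (\<forall>i<k. v i = w i) \<longrightarrow> \<alpha> v = \<alpha> w) \<and>
     (\<forall>i<k. \<forall>v. linear (\<lambda>x. \<alpha> (v(i := x)))) \<and>
     (\<forall>\<sigma> v. \<sigma> permutes {..<k} \<longrightarrow> \<alpha> (v \<circ> \<sigma>) = of_int (sign \<sigma>) * \<alpha> v)"

definition wedge :: "nat \<Rightarrow> (nat \<Rightarrow> complex^'n \<Rightarrow> complex) \<Rightarrow> 'n cform" where
  "wedge k l v = (\<Sum>\<sigma> | \<sigma> permutes {..<k}. of_int (sign \<sigma>) * (\<Prod>i<k. l i (v (\<sigma> i))))"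

text \<open>
  \<open>\<Lambda>\<^sup>p\<^sup>,\<^sup>q\<close> is the complex span of the products of \<open>p\<close> complex-linear and
  \<open>q\<close> conjugate-linear functionals.
\<close>

definition pq_form :: "nat \<Rightarrow> nat \<Rightarrow> 'n::finite cform \<Rightarrow> bool" where
  "pq_form p q \<alpha> \<longleftrightarrow>
     (\<exists>N c l. (\<forall>j<N. (\<forall>i<p. Vector_Spaces.linear (*s) (*) (l j i)) \<and>
                  (\<forall>i\<in>{p..<p+q}. Vector_Spaces.linear (*s) (*) (cnj \<circ> l j i))) \<and>
             \<alpha> = (\<lambda>v. \<Sum>j<(N::nat). c j * wedge (p + q) (l j) v))"

definition smooth_form_on :: "(complex^'n::finite) set \<Rightarrow> (complex^'n \<Rightarrow> 'n cform) \<Rightarrow> bool" where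
  "smooth_form_on S \<eta> \<longleftrightarrow> (\<forall>v. smooth_on S (\<lambda>z. \<eta> z v))"

text \<open>
  \<open>ext_deriv k \<eta>\<close> is the exterior derivative of a \<open>k\<close>-form on an open set, evaluated on constant
  vector fields (whose brackets vanish); the \<open>i\<close>-th vector is omitted from the sequence.
\<close>

definition ext_deriv ::
    "nat \<Rightarrow> (complex^'n::finite \<Rightarrow> 'n cform) \<Rightarrow> complex^'n \<Rightarrow> 'n cform" where
  "ext_deriv k \<eta> z v =
     (\<Sum>i\<le>k. (-1)^i * frechet_derivative (\<lambda>y. \<eta> y (\<lambda>j. v (if j < i then j else Suc j))) (at z) (v i))"

definition smooth_pq_form ::
    "('a, 'n::finite) cchart set \<Rightarrow> nat \<Rightarrow> nat \<Rightarrow>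
     (('a, 'n) cchart \<Rightarrow> complex^'n \<Rightarrow> 'n cform) \<Rightarrow> bool" where
  "smooth_pq_form A p q \<omega> \<longleftrightarrow>
     (\<forall>c\<in>A. smooth_form_on (chart_image c) (\<omega> c) \<and> (\<forall>z\<in>chart_image c. pq_form p q (\<omega> c z))) \<and>
     (\<forall>c\<in>A. \<forall>c'\<in>A. \<forall>x\<in>fst c \<inter> fst c'. \<forall>v.
        \<omega> c (snd c x) v = \<omega> c' (snd c' x) (\<lambda>i. transition_deriv c c' x (v i)))"


subsection \<open>Kaehler metrics\<close>

type_synonym 'n rmetric = "complex^'n \<Rightarrow> complex^'n \<Rightarrow> complex^'n \<Rightarrow> real"

definition hermitian_metric_on :: "(complex^'n::finite) set \<Rightarrow> 'n rmetric \<Rightarrow> bool" where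
  "hermitian_metric_on S G \<longleftrightarrow>
     (\<forall>u v. smooth_on S (\<lambda>z. G z u v)) \<and>
     (\<forall>z\<in>S. bilinear (G z) \<and> (\<forall>u v. G z u v = G z v u) \<and> (\<forall>v. v \<noteq> 0 \<longrightarrow> G z v v > 0) \<and>
             (\<forall>u v. G z (\<i> *s u) (\<i> *s v) = G z u v))"

definition kaehler_form :: "'n::finite rmetric \<Rightarrow> complex^'n \<Rightarrow> 'n cform" where
  "kaehler_form G z v = complex_of_real (G z (\<i> *s v 0) (v 1))"

definition kaehler_manifold ::
    "'a topology \<Rightarrow> ('a, 'n::finite) cchart set \<Rightarrow> (('a, 'n) cchart \<Rightarrow> 'n rmetric) \<Rightarrow> bool" where
  "kaehler_manifold X A g \<longleftrightarrow>
     complex_manifold X A \<and>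
     (\<forall>c\<in>A. hermitian_metric_on (chart_image c) (g c) \<and>
        (\<forall>z\<in>chart_image c. \<forall>v. ext_deriv 2 (kaehler_form (g c)) z v = 0)) \<and>
     (\<forall>c\<in>A. \<forall>c'\<in>A. \<forall>x\<in>fst c \<inter> fst c'. \<forall>u v.
        g c (snd c x) u v =
        g c' (snd c' x) (transition_deriv c c' x u) (transition_deriv c c' x v))"


subsection \<open>Induced inner products and norms\<close>

text \<open>
  In this subsection \<open>B\<close> is a real inner product on the tangent space at one point.  The inner
  products below do not depend on the choice of the orthonormal frame.
\<close>

definition on_frame ::
    "(complex^'n::finite \<Rightarrow> complex^'n \<Rightarrow> real) \<Rightarrow> (nat \<Rightarrow> complex^'n) \<Rightarrow> bool" where
  "on_frame B e \<longleftrightarrow>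
     (\<forall>i<2 * CARD('n). \<forall>j<2 * CARD('n). B (e i) (e j) = (if i = j then 1 else 0))"

definition frame_of :: "(complex^'n::finite \<Rightarrow> complex^'n \<Rightarrow> real) \<Rightarrow> nat \<Rightarrow> complex^'n" where
  "frame_of B = (SOME e. on_frame B e)"

text \<open>
  Summing over all index maps and dividing by \<open>k!\<close> amounts, for alternating forms, to summing over
  the increasing multi-indices; so the products of \<open>k\<close> distinct elements of an orthonormal
  coframe have norm 1.
\<close>

definition form_inner ::
    "(complex^'n::finite \<Rightarrow> complex^'n \<Rightarrow> real) \<Rightarrow> nat \<Rightarrow> 'n cform \<Rightarrow> 'n cform \<Rightarrow> complex" where
  "form_inner B k \<alpha> \<beta> =
     (\<Sum>I \<in> {..<k} \<rightarrow>\<^sub>E {..<2 * CARD('n)}.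
        \<alpha> (frame_of B \<circ> I) * cnj (\<beta> (frame_of B \<circ> I))) / fact k"

definition form_norm ::
    "(complex^'n::finite \<Rightarrow> complex^'n \<Rightarrow> real) \<Rightarrow> nat \<Rightarrow> 'n cform \<Rightarrow> real" where
  "form_norm B k \<alpha> = sqrt (Re (form_inner B k \<alpha> \<alpha>))"

definition covector_norm ::
    "(complex^'n::finite \<Rightarrow> complex^'n \<Rightarrow> real) \<Rightarrow> (complex^'n \<Rightarrow> real) \<Rightarrow> real" where
  "covector_norm B l = sqrt (\<Sum>i<2 * CARD('n). (l (frame_of B i))\<^sup>2)"

text \<open>
  An element of the tensor product of the complexified cotangent space with the \<open>k\<close>-forms is a
  real-linear map from the tangent space to the \<open>k\<close>-forms; a real orthonormal coframe is a
  unitary basis of the complexified cotangent space.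
\<close>

definition cotensor_norm ::
    "(complex^'n::finite \<Rightarrow> complex^'n \<Rightarrow> real) \<Rightarrow> nat \<Rightarrow> (complex^'n \<Rightarrow> 'n cform) \<Rightarrow> real" where
  "cotensor_norm B k T = sqrt (\<Sum>i<2 * CARD('n). (form_norm B k (T (frame_of B i)))\<^sup>2)"


subsection \<open>Levi-Civita connection\<close>

text \<open>
  In a chart, the Levi-Civita connection is \<open>D + christoffel G\<close>, where \<open>D\<close> is the derivative in
  \<open>complex^'n\<close>: the unique torsion-free and metric connection.
\<close>

definition christoffel ::
    "'n::finite rmetric \<Rightarrow> complex^'n \<Rightarrow> complex^'n \<Rightarrow> complex^'n \<Rightarrow> complex^'n" where
  "christoffel G z =
     (THE \<Gamma>. bilinear \<Gamma> \<and> (\<forall>u v. \<Gamma> u v = \<Gamma> v u) \<and>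
        (\<forall>u v w. frechet_derivative (\<lambda>y. G y v w) (at z) u = G z (\<Gamma> u v) w + G z v (\<Gamma> u w)))"

definition nabla_form ::
    "'n::finite rmetric \<Rightarrow> nat \<Rightarrow> (complex^'n \<Rightarrow> 'n cform) \<Rightarrow> complex^'n \<Rightarrow> complex^'n \<Rightarrow> 'n cform" where
  "nabla_form G k \<eta> z u v =
     frechet_derivative (\<lambda>y. \<eta> y v) (at z) u - (\<Sum>i<k. \<eta> z (v(i := christoffel G z u (v i))))"


subsection \<open>Formal adjoint of the exterior derivative\<close>

definition real_coord_vec :: "'n + 'n \<Rightarrow> complex^'n::finite" where
  "real_coord_vec s = (case s of Inl i \<Rightarrow> axis i 1 | Inr i \<Rightarrow> axis i \<i>)"

text \<open>Density of the Riemannian volume with respect to Lebesgue measure on \<open>complex^'n\<close>.\<close>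

definition vol_density :: "(complex^'n::finite \<Rightarrow> complex^'n \<Rightarrow> real) \<Rightarrow> real" where
  "vol_density B =
     sqrt (det (\<chi> s t. B (real_coord_vec s) (real_coord_vec t) :: real^('n + 'n)^('n + 'n)))"

definition l2_inner_on ::
    "(complex^'n::finite) set \<Rightarrow> 'n rmetric \<Rightarrow> nat \<Rightarrow>
     (complex^'n \<Rightarrow> 'n cform) \<Rightarrow> (complex^'n \<Rightarrow> 'n cform) \<Rightarrow> complex" where
  "l2_inner_on S G k \<alpha> \<beta> =
     set_lebesgue_integral lborel S
       (\<lambda>z. vol_density (G z) *\<^sub>R form_inner (G z) k (\<alpha> z) (\<beta> z))"

definition test_form_on ::
    "(complex^'n::finite) set \<Rightarrow> nat \<Rightarrow> (complex^'n \<Rightarrow> 'n cform) \<Rightarrow> bool" where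
  "test_form_on S k \<eta> \<longleftrightarrow>
     smooth_form_on S \<eta> \<and> (\<forall>z\<in>S. alt_form k (\<eta> z)) \<and>
     (\<exists>K. compact K \<and> K \<subseteq> S \<and> (\<forall>z. z \<notin> K \<longrightarrow> \<eta> z = (\<lambda>v. 0)))"

text \<open>
  \<open>is_dstar A g k \<omega> \<theta>\<close> says that \<open>d\<^sup>* \<omega> = \<theta>\<close> for the \<open>k\<close>-form \<open>\<omega>\<close> and the \<open>(k-1)\<close>-form \<open>\<theta>\<close>:
  integration against compactly supported smooth forms \<open>\<eta>\<close> moves \<open>d\<close> from \<open>\<eta>\<close> to \<open>d\<^sup>*\<close> on \<open>\<omega>\<close>.
  It suffices to test with forms supported in one chart, by a partition of unity.  The test forms
  determine \<open>\<theta>\<close>, so its transformation law between charts need not be required.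
  There are no forms of degree -1, so \<open>\<theta>\<close> is 0 if \<open>k = 0\<close>.
\<close>

definition is_dstar ::
    "('a, 'n::finite) cchart set \<Rightarrow> (('a, 'n) cchart \<Rightarrow> 'n rmetric) \<Rightarrow> nat \<Rightarrow>
     (('a, 'n) cchart \<Rightarrow> complex^'n \<Rightarrow> 'n cform) \<Rightarrow>
     (('a, 'n) cchart \<Rightarrow> complex^'n \<Rightarrow> 'n cform) \<Rightarrow> bool" where
  "is_dstar A g k \<omega> \<theta> \<longleftrightarrow>
     (case k of
        0 \<Rightarrow> \<forall>c\<in>A. \<forall>z\<in>chart_image c. \<forall>v. \<theta> c z v = 0
      | Suc m \<Rightarrow> \<forall>c\<in>A.
          smooth_form_on (chart_image c) (\<theta> c) \<and> (\<forall>z\<in>chart_image c. alt_form m (\<theta> c z)) \<and>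
          (\<forall>\<eta>. test_form_on (chart_image c) m \<eta> \<longrightarrow>
             l2_inner_on (chart_image c) (g c) (Suc m) (ext_deriv m \<eta>) (\<omega> c) =
             l2_inner_on (chart_image c) (g c) m \<eta> (\<theta> c)))"

end

theory Submission
  imports Defs
begin

text \<open>
  Fix a point and a unit tangent vector \<open>u\<close>, and complete \<open>u\<close> to a unitary frame, with associated
  vectors \<open>Z\<^sub>0, \<dots>, Z\<^sub>n\<^sub>-\<^sub>1\<close> of type (1,0), where \<open>u\<close> is \<open>(Z\<^sub>0 + cnj Z\<^sub>0) / sqrt 2\<close>.  Write \<open>T\<^sub>m\<close> for the covariant
  derivatives of \<open>\<omega>\<close> along the \<open>Z\<^sub>m\<close> and their conjugates; they are again of type \<open>(p, q)\<close> because the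
  metric is Kaehler.  Split the components of \<open>\<omega>\<close> and of \<open>T\<^sub>m\<close> according to whether the index 0 occurs
  among the holomorphic indices.  Closedness expresses each component of \<open>T\<^sub>0\<close> without the index 0 as
  a sum of \<open>p\<close> components of other \<open>T\<^sub>m\<close>; coclosedness expresses each component of \<open>T\<close> along \<open>cnj Z\<^sub>0\<close>
  with the index 0 as a sum of \<open>n - p\<close> components of other derivatives.  So these components carry at
  most the fractions \<open>p / (p + 1)\<close> and \<open>(n - p) / (n - p + 1)\<close> of the norm squared of the respective
  half of \<open>\<nabla>\<omega>\<close>, and Cauchy-Schwarz gives the bound in terms of \<open>p\<close>.  The bound in terms of \<open>q\<close> is the
  same argument for the conjugate indices.

  The weak equation \<open>d\<^sup>* \<omega> = 0\<close> becomes the pointwise trace condition by testing with a bump function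
  times a constant form, in an orthonormal frame that is parallel at the given point.
\<close>

section \<open>The algebraic inequality for arrays\<close>

text \<open>The constants arise as follows. The derivative along \<open>u\<close> is the sum of
  those along \<open>Z_0\<close> and its conjugate, divided by sqrt 2, so its pairing with \<omega>
  splits into four sums: two directions times two halves of \<omega>. Discounting two of them by r =
  p/(p+1) and s = (n-p)/(n-p+1) attaches the weight 1 + r to the half of \<omega> without the index
  0 and 1 + s to the other; halved, these are the two entries of the maximum. If p is 0 or n, one
  half of \<omega> is empty and the remaining weight is 1. The equations for d and its adjoint are
  not split by type beforehand: counting holomorphic indices shows which of their terms can be
  nonzero. Two obstacles shape the analytic part. \<open>form_norm\<close> uses a frame picked by
  \<open>SOME\<close> at every point, so it is not visibly differentiable until frame independence
  allows a frame of fields. Such a frame is known to be differentiable only at the given point, so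
  the weak equation is not integrated by parts directly but compared with an affine field on small
  balls.\<close>

text \<open>The map sending (I, i) to (I(j := i), I j) is an involution: it exchanges a slot of a
  multi-index with a free index. When the summand ignores the free index, a dummy summation turns
  into a contraction.\<close>

lemma sum_slot_swap:
  fixes f :: "(nat \<Rightarrow> 'i) \<Rightarrow> 'i \<Rightarrow> 'b::comm_monoid_add"
  assumes "j < k"
  shows "(\<Sum>I\<in>{..<k} \<rightarrow>\<^sub>E D. \<Sum>i\<in>D. f (I(j := i)) (I j)) = (\<Sum>I\<in>{..<k} \<rightarrow>\<^sub>E D. \<Sum>i\<in>D. f I i)"
proof -
  have upd: "I(j := i) \<in> {..<k} \<rightarrow>\<^sub>E D" if "I \<in> {..<k} \<rightarrow>\<^sub>E D" "i \<in> D" for I i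
    using that assms by (auto simp: PiE_iff extensional_def)
  show ?thesis
    unfolding sum.cartesian_product
    by (rule sum.reindex_bij_witness[where i="\<lambda>(I, i). (I(j := i), I j)" and j="\<lambda>(I, i). (I(j := i), I j)"])
       (use upd assms in \<open>auto simp: PiE_iff\<close>)
qed

lemma sum_PiE_permutes:
  fixes f :: "(nat \<Rightarrow> 'i) \<Rightarrow> 'b::comm_monoid_add"
  assumes "\<sigma> permutes {..<k}"
  shows "(\<Sum>I\<in>{..<k} \<rightarrow>\<^sub>E D. f (I \<circ> \<sigma>)) = (\<Sum>I\<in>{..<k} \<rightarrow>\<^sub>E D. f I)"
proof -
  have mem: "I \<circ> \<tau> \<in> {..<k} \<rightarrow>\<^sub>E D" if "I \<in> {..<k} \<rightarrow>\<^sub>E D" "\<tau> permutes {..<k}" for I \<tau>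
    using that permutes_in_image[OF that(2)] permutes_not_in[OF that(2)]
    by (auto simp: PiE_iff extensional_def)
  show ?thesis
    by (rule sum.reindex_bij_witness[where i="\<lambda>I. I \<circ> inv \<sigma>" and j="\<lambda>I. I \<circ> \<sigma>"])
       (use mem assms permutes_inv[OF assms] permutes_inv_o[OF assms] in \<open>auto simp: o_assoc[symmetric]\<close>)
qed

lemma sum_cnj_Cauchy_Schwarz:
  fixes f g :: "'i \<Rightarrow> complex"
  shows "norm (\<Sum>i\<in>A. f i * cnj (g i)) \<le> sqrt (\<Sum>i\<in>A. (norm (f i))\<^sup>2) * sqrt (\<Sum>i\<in>A. (norm (g i))\<^sup>2)"
proof -
  have "norm (\<Sum>i\<in>A. f i * cnj (g i)) \<le> (\<Sum>i\<in>A. \<bar>norm (f i)\<bar> * \<bar>norm (g i)\<bar>)"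
    by (rule sum_norm_le) (simp add: norm_mult)
  also have "\<dots> \<le> L2_set (\<lambda>i. norm (f i)) A * L2_set (\<lambda>i. norm (g i)) A"
    by (rule L2_set_mult_ineq)
  finally show ?thesis by (simp add: L2_set_def)
qed

lemma norm_sum_square_le:
  fixes f :: "'i \<Rightarrow> complex"
  assumes "finite A"
  shows "(norm (\<Sum>i\<in>A. f i))\<^sup>2 \<le> real (card A) * (\<Sum>i\<in>A. (norm (f i))\<^sup>2)"
proof -
  have "norm (\<Sum>i\<in>A. f i * cnj 1) \<le> sqrt (\<Sum>i\<in>A. (norm (f i))\<^sup>2) * sqrt (\<Sum>i\<in>A. (norm (1::complex))\<^sup>2)"
    by (rule sum_cnj_Cauchy_Schwarz)
  then have "(norm (\<Sum>i\<in>A. f i))\<^sup>2 \<le> (sqrt (\<Sum>i\<in>A. (norm (f i))\<^sup>2) * sqrt (real (card A)))\<^sup>2"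
    by (intro power_mono) auto
  then show ?thesis by (simp add: power_mult_distrib sum_nonneg mult.commute)
qed

lemma four_term_Cauchy_Schwarz:
  fixes a b c d a' b' c' d' :: real
  assumes "a \<ge> 0" "b \<ge> 0" "c \<ge> 0" "d \<ge> 0" "a' \<ge> 0" "b' \<ge> 0" "c' \<ge> 0" "d' \<ge> 0"
  shows "(sqrt a * sqrt a' + sqrt b * sqrt b' + sqrt c * sqrt c' + sqrt d * sqrt d')\<^sup>2
    \<le> (a + b + c + d) * (a' + b' + c' + d')"
proof -
  define f where "f i = sqrt ([a, b, c, d] ! i)" for i
  define g where "g i = sqrt ([a', b', c', d'] ! i)" for i
  have "(\<Sum>i<4. f i * g i)\<^sup>2 \<le> (\<Sum>i<4. (f i)\<^sup>2) * (\<Sum>i<4. (g i)\<^sup>2)"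
    by (rule Cauchy_Schwarz_ineq_sum)
  then show ?thesis using assms
    by (simp add: f_def g_def eval_nat_numeral)
qed

definition kato_const :: "nat \<Rightarrow> nat \<Rightarrow> real" where
  "kato_const n p = (if p \<in> {0, n} then 1 / 2
     else max ((2 * real p + 1) / (2 * real p + 2))
              ((2 * real n - 2 * real p + 1) / (2 * real n - 2 * real p + 2)))"

text \<open>
  \<open>H\<close> is the set of holomorphic indices and \<open>bar\<close> is conjugation of indices; \<open>W\<close> and \<open>T m\<close> are the component
  arrays of \<open>\<omega>\<close> and of its derivatives.
\<close>

locale kato_array =
  fixes D H :: "'i set" and bar :: "'i \<Rightarrow> 'i" and k p :: nat
    and W :: "(nat \<Rightarrow> 'i) \<Rightarrow> complex" and T :: "'i \<Rightarrow> (nat \<Rightarrow> 'i) \<Rightarrow> complex" and z :: 'i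
  assumes finite_D: "finite D" and H_sub: "H \<subseteq> D" and bar: "bij_betw bar H (D - H)"
    and z: "z \<in> H" and p_le: "p \<le> card H"
    and W_inj: "\<And>I. I \<in> {..<k} \<rightarrow>\<^sub>E D \<Longrightarrow> W I \<noteq> 0 \<Longrightarrow> inj_on I {..<k}"
    and W_type: "\<And>I. I \<in> {..<k} \<rightarrow>\<^sub>E D \<Longrightarrow> W I \<noteq> 0 \<Longrightarrow> card {j. j < k \<and> I j \<in> H} = p"
    and T_inj: "\<And>I m. I \<in> {..<k} \<rightarrow>\<^sub>E D \<Longrightarrow> m \<in> D \<Longrightarrow> T m I \<noteq> 0 \<Longrightarrow> inj_on I {..<k}"
    and T_type: "\<And>I m. I \<in> {..<k} \<rightarrow>\<^sub>E D \<Longrightarrow> m \<in> D \<Longrightarrow> T m I \<noteq> 0 \<Longrightarrow> card {j. j < k \<and> I j \<in> H} = p"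
    and closed: "\<And>I m. I \<in> {..<k} \<rightarrow>\<^sub>E D \<Longrightarrow> m \<in> D \<Longrightarrow> T m I = (\<Sum>j<k. T (I j) (I(j := m)))"
    and coclosed: "\<And>I j. I \<in> {..<k} \<rightarrow>\<^sub>E D \<Longrightarrow> j < k \<Longrightarrow> (\<Sum>m\<in>H. T (bar m) (I(j := m))) = 0"
begin

abbreviation "idx \<equiv> {..<k} \<rightarrow>\<^sub>E D"

lemma finite_idx: "finite idx"
  using finite_D by (simp add: finite_PiE)

lemma finite_H: "finite H"
  using finite_D H_sub finite_subset by blast

lemma upd_idx: "I \<in> idx \<Longrightarrow> j < k \<Longrightarrow> m \<in> D \<Longrightarrow> I(j := m) \<in> idx"
  by (auto simp: PiE_iff extensional_def)

text \<open>Closedness at an \<open>I\<close> without \<open>z\<close> keeps only the p slots with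
  holomorphic entries, which gives the factor p by Cauchy-Schwarz. No component is used twice on the
  right, because \<open>z\<close> occurs exactly once in \<open>I(j := z)\<close> and so marks
  \<open>j\<close>; and every direction \<open>I j\<close> differs from \<open>z\<close>.\<close>

lemma closed_bound:
  "(\<Sum>I | I \<in> idx \<and> z \<notin> I ` {..<k}. (norm (T z I))\<^sup>2)
     \<le> real p * (\<Sum>m\<in>H - {z}. \<Sum>I\<in>idx. (norm (T m I))\<^sup>2)"
proof -
  let ?N = "{I \<in> idx. z \<notin> I ` {..<k}}"
  let ?J = "\<lambda>I. {j. j < k \<and> I j \<in> H}"
  have finN: "finite ?N" using finite_idx by simp
  have finJ: "finite (?J I)" for I by simp
  have pt: "(norm (T z I))\<^sup>2 \<le> real p * (\<Sum>j\<in>?J I. (norm (T (I j) (I(j := z))))\<^sup>2)" if I: "I \<in> ?N" for I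
  proof (cases "T z I = 0")
    case True then show ?thesis by (simp add: sum_nonneg)
  next
    case False
    have zD: "z \<in> D" using z H_sub by auto
    have cJ: "card (?J I) = p" using T_type[of I z] I False zD by auto
    have "T z I = (\<Sum>j<k. T (I j) (I(j := z)))" using closed I zD by auto
    also have "\<dots> = (\<Sum>j\<in>?J I. T (I j) (I(j := z)))"
    proof (rule sum.mono_neutral_right)
      \<comment> \<open>Inserting \<open>z\<close> into a slot with a non-holomorphic entry would
        create p + 1 holomorphic indices.\<close>
      show "\<forall>j\<in>{..<k} - ?J I. T (I j) (I(j := z)) = 0"
      proof
        fix j assume j: "j \<in> {..<k} - ?J I"
        then have "?J (I(j := z)) = insert j (?J I)" "j \<notin> ?J I" using z by auto
        then have "card (?J (I(j := z))) = Suc p" using cJ by simp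
        moreover have "I j \<in> D" "I(j := z) \<in> idx" using I j zD upd_idx by auto
        ultimately show "T (I j) (I(j := z)) = 0" using T_type[of "I(j := z)" "I j"] by auto
      qed
    qed auto
    finally show ?thesis using norm_sum_square_le[OF finJ[of I], of "\<lambda>j. T (I j) (I(j := z))"] cJ by simp
  qed
  let ?S = "Sigma ?N ?J" and ?g = "\<lambda>(I, j). (I j, I(j := z))"
  have inj: "inj_on ?g ?S"
  proof (rule inj_onI, clarify)
    fix I j I' j' assume a: "I \<in> idx" "z \<notin> I ` {..<k}" "j < k" "I' \<in> idx" "z \<notin> I' ` {..<k}" "j' < k"
      and e1: "I j = I' j'" and e2: "I(j := z) = I'(j' := z)"
    have "j = j'"
    proof (rule ccontr)
      assume "j \<noteq> j'"
      then have "I' j = z" using fun_cong[OF e2, of j] by auto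
      then show False using a by auto
    qed
    moreover have "I = I'"
    proof
      fix x show "I x = I' x" using fun_cong[OF e2, of x] e1 \<open>j = j'\<close> by (cases "x = j") auto
    qed
    ultimately show "I = I' \<and> j = j'" by simp
  qed
  have "(\<Sum>I\<in>?N. (norm (T z I))\<^sup>2) \<le> (\<Sum>I\<in>?N. real p * (\<Sum>j\<in>?J I. (norm (T (I j) (I(j := z))))\<^sup>2))"
    by (rule sum_mono) (rule pt)
  also have "\<dots> = real p * (\<Sum>x\<in>?S. (\<lambda>(m, I). (norm (T m I))\<^sup>2) (?g x))"
    unfolding sum_distrib_left[symmetric] by (subst sum.Sigma) (use finN in \<open>auto simp: case_prod_unfold\<close>)
  also have "\<dots> = real p * (\<Sum>x\<in>?g ` ?S. (\<lambda>(m, I). (norm (T m I))\<^sup>2) x)"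
    by (simp only: sum.reindex[OF inj] o_def)
  also have "\<dots> \<le> real p * (\<Sum>x\<in>(H - {z}) \<times> idx. (\<lambda>(m, I). (norm (T m I))\<^sup>2) x)"
  proof (rule mult_left_mono[OF sum_mono2])
    show "?g ` ?S \<subseteq> (H - {z}) \<times> idx"
    proof (clarify, intro conjI)
      fix I j assume a: "I \<in> idx" "z \<notin> I ` {..<k}" "j < k" "I j \<in> H"
      show "I j \<in> H - {z}" using a by auto
      show "I(j := z) \<in> idx" using a upd_idx z H_sub by auto
    qed
  qed (simp_all add: finite_H finite_idx case_prod_unfold)
  also have "\<dots> = real p * (\<Sum>m\<in>H - {z}. \<Sum>I\<in>idx. (norm (T m I))\<^sup>2)"
    by (simp add: sum.cartesian_product)
  finally show ?thesis .
qed

text \<open>The contraction runs over the slot holding \<open>z\<close>. An entry \<open>m\<close>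
  that already occurs in \<open>I\<close> gives a repeated index and hence zero, so besides
  \<open>z\<close> only the \<open>card H - p\<close> holomorphic indices missing from
  \<open>I\<close> remain. On the right, \<open>m\<close> occurs once in the new multi-index and
  marks the slot where \<open>z\<close> has to be put back.\<close>

lemma coclosed_bound:
  "(\<Sum>I | I \<in> idx \<and> z \<in> I ` {..<k}. (norm (T (bar z) I))\<^sup>2)
     \<le> real (card H - p) * (\<Sum>m\<in>H - {z}. \<Sum>I\<in>idx. (norm (T (bar m) I))\<^sup>2)"
proof -
  let ?Z = "{I \<in> idx. z \<in> I ` {..<k}}"
  let ?N = "{I \<in> ?Z. inj_on I {..<k}}"
  define pos where "pos I = (SOME j. j < k \<and> I j = z)" for I
  let ?J = "\<lambda>I. H - I ` {..<k}"
  have barD: "bar m \<in> D" if "m \<in> H" for m using bar that by (auto simp: bij_betw_def)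
  have pos: "pos I < k" "I (pos I) = z" if "I \<in> ?Z" for I
  proof -
    have "\<exists>j. j < k \<and> I j = z" using that by auto
    then show "pos I < k" "I (pos I) = z" unfolding pos_def by (metis (mono_tags, lifting) someI_ex)+
  qed
  have finZ: "finite ?Z" and finN: "finite ?N" using finite_idx by auto
  have finJ: "finite (?J I)" for I using finite_H by simp
  have pt: "(norm (T (bar z) I))\<^sup>2 \<le> real (card H - p) * (\<Sum>m\<in>?J I. (norm (T (bar m) (I(pos I := m))))\<^sup>2)"
    if I: "I \<in> ?N" for I
  proof (cases "T (bar z) I = 0")
    case True then show ?thesis by (simp add: sum_nonneg)
  next
    case False
    let ?j = "pos I"
    have IZ: "I \<in> ?Z" using I by auto
    have j: "?j < k" "I ?j = z" using pos[OF IZ] by auto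
    have Ii: "I \<in> idx" and inj: "inj_on I {..<k}" using I by auto
    have "card {j. j < k \<and> I j \<in> H} = p" using T_type[of I "bar z"] Ii False barD z by auto
    moreover have "I ` {j. j < k \<and> I j \<in> H} = H \<inter> I ` {..<k}" by auto
    moreover have "inj_on I {j. j < k \<and> I j \<in> H}" by (rule inj_on_subset[OF inj]) auto
    ultimately have "card (H \<inter> I ` {..<k}) = p" using card_image by metis
    then have cJ: "card (?J I) = card H - p"
      using card_Diff_subset_Int[of H "I ` {..<k}"] finite_H by simp
    have "(\<Sum>m\<in>H. T (bar m) (I(?j := m))) = 0" using coclosed[OF Ii j(1)] .
    then have "T (bar z) (I(?j := z)) + (\<Sum>m\<in>H - {z}. T (bar m) (I(?j := m))) = 0"
      using z finite_H by (subst (asm) sum.remove) auto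
    moreover have "I(?j := z) = I" using j by auto
    moreover have "(\<Sum>m\<in>H - {z}. T (bar m) (I(?j := m))) = (\<Sum>m\<in>?J I. T (bar m) (I(?j := m)))"
    proof (rule sum.mono_neutral_right)
      show "\<forall>m\<in>(H - {z}) - ?J I. T (bar m) (I(?j := m)) = 0"
      proof
        fix m assume m: "m \<in> (H - {z}) - ?J I"
        then obtain l where l: "l < k" "I l = m" by auto
        have "l \<noteq> ?j" using l m j by auto
        then have "\<not> inj_on (I(?j := m)) {..<k}"
          using l j(1) inj_onD[of "I(?j := m)" "{..<k}" l ?j] by fastforce
        then show "T (bar m) (I(?j := m)) = 0"
          using T_inj[of "I(?j := m)" "bar m"] m barD upd_idx[OF Ii j(1)] H_sub by blast
      qed
    qed (use finite_H I in auto)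
    ultimately have "T (bar z) I = - (\<Sum>m\<in>?J I. T (bar m) (I(?j := m)))"
      by (simp add: add_eq_0_iff2)
    then show ?thesis using norm_sum_square_le[OF finJ[of I], of "\<lambda>m. T (bar m) (I(?j := m))"] cJ by simp
  qed
  let ?S = "Sigma ?N ?J" and ?g = "\<lambda>(I, m). (m, I(pos I := m))"
  have inj: "inj_on ?g ?S"
  proof (rule inj_onI)
    fix x y assume xy: "x \<in> ?S" "y \<in> ?S" "?g x = ?g y"
    obtain I m I' m' where e0: "x = (I, m)" "y = (I', m')" by (cases x, cases y)
    then have a: "I \<in> idx" "z \<in> I ` {..<k}" "I' \<in> idx" "z \<in> I' ` {..<k}" and mm: "m' = m"
      and m: "m \<notin> I ` {..<k}" "m \<notin> I' ` {..<k}" and e: "I(pos I := m) = I'(pos I' := m)"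
      using xy by auto
    have P: "pos I < k" "I (pos I) = z" "pos I' < k" "I' (pos I') = z" using a pos[of I] pos[of I'] by auto
    have "pos I = pos I'"
    proof (rule ccontr)
      assume "pos I \<noteq> pos I'"
      then have "I' (pos I) = m" using fun_cong[OF e, of "pos I"] by auto
      then show False using m P by auto
    qed
    then show "x = y" unfolding e0 mm using e P by (metis fun_upd_triv fun_upd_upd)
  qed
  \<comment> \<open>Restricting to injective \<open>I\<close> loses nothing and makes the count of
    missing holomorphic indices exact.\<close>
  have "(\<Sum>I\<in>?Z. (norm (T (bar z) I))\<^sup>2) = (\<Sum>I\<in>?N. (norm (T (bar z) I))\<^sup>2)"
    by (rule sum.mono_neutral_right) (use finZ T_inj barD z in auto)
  also have "\<dots> \<le> (\<Sum>I\<in>?N. real (card H - p) * (\<Sum>m\<in>?J I. (norm (T (bar m) (I(pos I := m))))\<^sup>2))"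
    by (rule sum_mono) (rule pt)
  also have "\<dots> = real (card H - p) * (\<Sum>x\<in>?S. (\<lambda>(m, I). (norm (T (bar m) I))\<^sup>2) (?g x))"
    unfolding sum_distrib_left[symmetric] by (subst sum.Sigma) (use finN finJ in \<open>auto simp: case_prod_unfold\<close>)
  also have "\<dots> = real (card H - p) * (\<Sum>x\<in>?g ` ?S. (\<lambda>(m, I). (norm (T (bar m) I))\<^sup>2) x)"
    by (simp only: sum.reindex[OF inj] o_def)
  also have "\<dots> \<le> real (card H - p) * (\<Sum>x\<in>(H - {z}) \<times> idx. (\<lambda>(m, I). (norm (T (bar m) I))\<^sup>2) x)"
  proof (rule mult_left_mono[OF sum_mono2])
    show "?g ` ?S \<subseteq> (H - {z}) \<times> idx"
    proof
      fix x assume "x \<in> ?g ` ?S"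
      then obtain y where y: "y \<in> ?S" "x = ?g y" by blast
      obtain I m where Im: "y = (I, m)" by (cases y)
      have x: "x = (m, I(pos I := m))" and a: "I \<in> idx" "z \<in> I ` {..<k}" "m \<in> H" "m \<notin> I ` {..<k}"
        using y unfolding Im by simp_all
      have "pos I < k" using a pos(1)[of I] by simp
      then have "I(pos I := m) \<in> idx" by (rule upd_idx[OF a(1)]) (use a H_sub in auto)
      then show "x \<in> (H - {z}) \<times> idx" using a x by auto
    qed
  qed (simp_all add: finite_H finite_idx case_prod_unfold)
  also have "\<dots> = real (card H - p) * (\<Sum>m\<in>H - {z}. \<Sum>I\<in>idx. (norm (T (bar m) I))\<^sup>2)"
    by (simp add: sum.cartesian_product)
  finally show ?thesis .
qed

text \<open>The factor 2 on the right compensates for the two directions, whose vectors add up to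
  sqrt 2 times a real unit vector.\<close>

lemma kato_array_inequality:
  "(norm ((\<Sum>I\<in>idx. T z I * cnj (W I)) + (\<Sum>I\<in>idx. T (bar z) I * cnj (W I))))\<^sup>2
     \<le> 2 * kato_const (card H) p * (\<Sum>m\<in>D. \<Sum>I\<in>idx. (norm (T m I))\<^sup>2) * (\<Sum>I\<in>idx. (norm (W I))\<^sup>2)"
proof -
  let ?A = "{I \<in> idx. z \<notin> I ` {..<k}}" and ?B = "{I \<in> idx. z \<in> I ` {..<k}}"
  let ?s = "\<lambda>f (S :: (nat \<Rightarrow> 'i) set). \<Sum>I\<in>S. (norm (f I :: complex))\<^sup>2"
  define n where "n = card H"
  have fin: "finite ?A" "finite ?B" using finite_idx by auto
  have split: "sum f idx = sum f ?A + sum f ?B" for f :: "(nat \<Rightarrow> 'i) \<Rightarrow> 'c::comm_monoid_add"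
    using fin by (subst sum.union_disjoint[symmetric]) (auto intro: sum.cong)
  define a0 a1 b0 b1 w0 w1 where d: "a0 = ?s (T z) ?A" "a1 = ?s (T z) ?B"
    "b0 = ?s (T (bar z)) ?A" "b1 = ?s (T (bar z)) ?B" "w0 = ?s W ?A" "w1 = ?s W ?B"
  define Y Y' where Y: "Y = (\<Sum>m\<in>H - {z}. ?s (T m) idx)" "Y' = (\<Sum>m\<in>H - {z}. ?s (T (bar m)) idx)"
  have nn: "a0 \<ge> 0" "a1 \<ge> 0" "b0 \<ge> 0" "b1 \<ge> 0" "w0 \<ge> 0" "w1 \<ge> 0" "Y \<ge> 0" "Y' \<ge> 0"
    by (simp_all add: d Y sum_nonneg)
  define r s where rs: "r = real p / (real p + 1)" "s = (real n - real p) / (real n - real p + 1)"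
  have pn: "real p \<le> real n" using p_le by (simp add: n_def)
  \<comment> \<open>Rewriting a0 <= p Y as a0 <= r (a0 + Y) measures a0 against a block of the total
    norm that contains a0 itself; the four blocks then add up to the total without overlap.\<close>
  have "a0 \<le> real p * Y" using closed_bound by (simp add: d Y)
  then have a0: "a0 \<le> r * (a0 + Y)" by (simp add: rs field_simps)
  have "b1 \<le> (real n - real p) * Y'" using coclosed_bound p_le by (simp add: d Y n_def of_nat_diff)
  then have b1: "b1 \<le> s * (b1 + Y')" using pn by (simp add: rs field_simps)
  have rs0: "r \<ge> 0" "s \<ge> 0" using pn by (auto simp: rs)
  have tot: "(\<Sum>m\<in>D. ?s (T m) idx) = (a0 + Y) + a1 + b0 + (b1 + Y')"
  proof -
    have "(\<Sum>m\<in>D. ?s (T m) idx) = (\<Sum>m\<in>H. ?s (T m) idx) + (\<Sum>m\<in>D - H. ?s (T m) idx)"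
      using sum.subset_diff[OF H_sub finite_D] by (simp add: add.commute)
    also have "(\<Sum>m\<in>D - H. ?s (T m) idx) = (\<Sum>m\<in>H. ?s (T (bar m)) idx)"
      by (rule sum.reindex_bij_betw[OF bar, symmetric])
    also have "(\<Sum>m\<in>H. ?s (T m) idx) = a0 + a1 + Y"
      using sum.remove[OF finite_H z, of "\<lambda>m. ?s (T m) idx"] split[of "\<lambda>I. (norm (T z I))\<^sup>2"] by (simp add: d Y)
    also have "(\<Sum>m\<in>H. ?s (T (bar m)) idx) = b0 + b1 + Y'"
      using sum.remove[OF finite_H z, of "\<lambda>m. ?s (T (bar m)) idx"] split[of "\<lambda>I. (norm (T (bar z) I))\<^sup>2"]
      by (simp add: d Y)
    finally show ?thesis by simp
  qed
  have CS: "norm (\<Sum>I\<in>S. T m I * cnj (W I)) \<le> sqrt (?s (T m) S) * sqrt (?s W S)" for m S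
    by (rule sum_cnj_Cauchy_Schwarz)
  have tri: "norm ((x + y) + (v + w)) \<le> norm x + norm y + norm v + norm w" for x y v w :: complex
    using norm_triangle_ineq[of "x + y" "v + w"] norm_triangle_ineq[of x y] norm_triangle_ineq[of v w] by linarith
  have "norm ((\<Sum>I\<in>idx. T z I * cnj (W I)) + (\<Sum>I\<in>idx. T (bar z) I * cnj (W I)))
      \<le> norm (\<Sum>I\<in>?A. T z I * cnj (W I)) + norm (\<Sum>I\<in>?B. T z I * cnj (W I))
        + norm (\<Sum>I\<in>?A. T (bar z) I * cnj (W I)) + norm (\<Sum>I\<in>?B. T (bar z) I * cnj (W I))"
    unfolding split by (rule tri)
  also have "\<dots> \<le> sqrt a0 * sqrt w0 + sqrt a1 * sqrt w1 + sqrt b0 * sqrt w0 + sqrt b1 * sqrt w1"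
    unfolding d by (intro add_mono CS)
  \<comment> \<open>The discounts are moved from the derivatives to \<omega>, so that the last
    Cauchy-Schwarz has the full norm of the derivatives as one factor and a weighted norm of
    \<omega> as the other.\<close>
  also have "\<dots> \<le> sqrt (a0 + Y) * sqrt (r * w0) + sqrt a1 * sqrt w1 + sqrt b0 * sqrt w0
      + sqrt (b1 + Y') * sqrt (s * w1)"
  proof -
    have "sqrt a0 * sqrt w0 \<le> sqrt (a0 + Y) * sqrt (r * w0)"
      using mult_right_mono[OF a0, of w0] nn by (simp add: real_sqrt_mult[symmetric] mult_ac)
    moreover have "sqrt b1 * sqrt w1 \<le> sqrt (b1 + Y') * sqrt (s * w1)"
      using mult_right_mono[OF b1, of w1] nn by (simp add: real_sqrt_mult[symmetric] mult_ac)
    ultimately show ?thesis by simp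
  qed
  finally have "(norm ((\<Sum>I\<in>idx. T z I * cnj (W I)) + (\<Sum>I\<in>idx. T (bar z) I * cnj (W I))))\<^sup>2
     \<le> (sqrt (a0 + Y) * sqrt (r * w0) + sqrt a1 * sqrt w1 + sqrt b0 * sqrt w0 + sqrt (b1 + Y') * sqrt (s * w1))\<^sup>2"
    by (intro power_mono) auto
  also have "\<dots> \<le> ((a0 + Y) + a1 + b0 + (b1 + Y')) * (r * w0 + w1 + w0 + s * w1)"
    by (rule four_term_Cauchy_Schwarz) (use nn rs0 in auto)
  also have "r * w0 + w1 + w0 + s * w1 \<le> 2 * kato_const n p * (w0 + w1)"
  proof -
    \<comment> \<open>Boundary degrees: for p = 0 no nonzero component of \<omega> contains
      \<open>z\<close>, and for p = n every one contains all of \<open>H\<close>. Only the half with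
      weight 1 survives.\<close>
    have w1_0: "w1 = 0" if "p = 0"
    proof -
      have "W I = 0" if I: "I \<in> ?B" for I
      proof (rule ccontr)
        assume "W I \<noteq> 0"
        then have "card {j. j < k \<and> I j \<in> H} = 0" using W_type I \<open>p = 0\<close> by auto
        then show False using I z by auto
      qed
      then show ?thesis by (simp add: d)
    qed
    have w0_0: "w0 = 0" if "p = n"
    proof -
      have "W I = 0" if I: "I \<in> ?A" for I
      proof (rule ccontr)
        assume W: "W I \<noteq> 0"
        let ?J = "{j. j < k \<and> I j \<in> H}"
        have "inj_on I ?J" by (rule inj_on_subset[OF W_inj[of I]]) (use W I in auto)
        then have "card (I ` ?J) = card H" using W_type[of I] W I that \<open>p = n\<close> by (auto simp: card_image n_def)
        then have "I ` ?J = H" using finite_H by (intro card_subset_eq) auto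
        then show False using I z by auto
      qed
      then show ?thesis by (simp add: d)
    qed
    show ?thesis
    proof (cases "p \<in> {0, n}")
      case True
      then show ?thesis using w1_0 w0_0 by (auto simp: kato_const_def rs)
    next
      case False
      then have k: "kato_const n p \<ge> (2 * real p + 1) / (2 * real p + 2)"
        "kato_const n p \<ge> (2 * real n - 2 * real p + 1) / (2 * real n - 2 * real p + 2)"
        by (auto simp: kato_const_def)
      have "1 + r = 2 * ((2 * real p + 1) / (2 * real p + 2))" by (simp add: rs field_simps)
      then have k1: "1 + r \<le> 2 * kato_const n p" using k by linarith
      have "1 + s = 2 * ((2 * real n - 2 * real p + 1) / (2 * real n - 2 * real p + 2))"
        using pn by (simp add: rs field_simps)
      then have k2: "1 + s \<le> 2 * kato_const n p" using k by linarith
      have "r * w0 + w1 + w0 + s * w1 = (1 + r) * w0 + (1 + s) * w1" by (simp add: algebra_simps)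
      also have "\<dots> \<le> 2 * kato_const n p * w0 + 2 * kato_const n p * w1"
        by (intro add_mono mult_right_mono k1 k2 nn)
      finally show ?thesis by (simp add: algebra_simps)
    qed
  qed
  finally have "(norm ((\<Sum>I\<in>idx. T z I * cnj (W I)) + (\<Sum>I\<in>idx. T (bar z) I * cnj (W I))))\<^sup>2
    \<le> (a0 + Y + a1 + b0 + (b1 + Y')) * (2 * kato_const n p * (w0 + w1))"
    using nn by (simp add: mult_left_mono)
  moreover have "(\<Sum>I\<in>idx. (norm (W I))\<^sup>2) = w0 + w1"
    using split[of "\<lambda>I. (norm (W I))\<^sup>2"] by (simp add: d)
  ultimately show ?thesis unfolding tot n_def by (simp only: mult_ac)
qed

end

section \<open>Unitary frames\<close>

lemma sum_mult_delta:
  fixes f :: "nat \<Rightarrow> 'a::semiring_1"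
  shows "j < m \<Longrightarrow> (\<Sum>a<m. f a * (if a = j then 1 else 0)) = f j"
  by (simp add: if_distrib[of "(*) _"] cong: if_cong)

section \<open>Orthonormal families for a real inner product\<close>

locale inner_form =
  fixes B :: "'v::euclidean_space \<Rightarrow> 'v \<Rightarrow> real"
  assumes bil: "bilinear B" and sym: "B u v = B v u" and pos: "v \<noteq> 0 \<Longrightarrow> B v v > 0"
begin

lemma lin_right: "linear (B x)" and lin_left: "linear (\<lambda>x. B x y)"
  using bil by (auto simp: bilinear_def)

lemmas B_simps =
  linear_add[OF lin_right] linear_diff[OF lin_right] linear_cmul[OF lin_right]
  linear_sum[OF lin_right] linear_0[OF lin_right] linear_neg[OF lin_right]
  linear_add[OF lin_left] linear_diff[OF lin_left] linear_cmul[OF lin_left]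
  linear_sum[OF lin_left] linear_0[OF lin_left] linear_neg[OF lin_left]

text \<open>The length is a parameter, unlike in \<open>on_frame\<close>, because frames are built
  one vector at a time.\<close>

definition onfam :: "nat \<Rightarrow> (nat \<Rightarrow> 'v) \<Rightarrow> bool" where
  "onfam m e \<longleftrightarrow> (\<forall>i<m. \<forall>j<m. B (e i) (e j) = (if i = j then 1 else 0))"

lemma onfamD: "onfam m e \<Longrightarrow> i < m \<Longrightarrow> j < m \<Longrightarrow> B (e i) (e j) = (if i = j then 1 else 0)"
  by (auto simp: onfam_def)

lemma onfam_inj: assumes "onfam m e" shows "inj_on e {..<m}"
proof (rule inj_onI)
  fix i j assume ij: "i \<in> {..<m}" "j \<in> {..<m}" "e i = e j"
  have "B (e i) (e j) = 1" using onfamD[OF assms, of i i] ij by auto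
  then show "i = j" using onfamD[OF assms, of i j] ij by (auto split: if_splits)
qed

lemma onfam_independent: assumes "onfam m e" shows "independent (e ` {..<m})"
proof (rule ccontr)
  assume "\<not> independent (e ` {..<m})"
  then obtain u v where uv: "v \<in> e ` {..<m}" "u v \<noteq> 0" and s0: "(\<Sum>v\<in>e ` {..<m}. u v *\<^sub>R v) = 0"
    by (auto simp: dependent_finite)
  then obtain i where i: "i < m" "v = e i" by auto
  have "0 = B (\<Sum>j<m. u (e j) *\<^sub>R e j) (e i)"
    using s0 by (simp add: sum.reindex[OF onfam_inj[OF assms]] B_simps)
  also have "\<dots> = (\<Sum>j<m. u (e j) * (if j = i then 1 else 0))"
    using i by (auto simp: B_simps onfamD[OF assms] intro!: sum.cong)
  also have "\<dots> = u v" using i by (simp only: sum_mult_delta)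
  finally show False using uv by simp
qed

lemma onfam_span_orth:
  assumes "onfam m e" "m < DIM('v)"
  shows "\<exists>v. B v v = 1 \<and> (\<forall>i<m. B v (e i) = 0)"
proof -
  have "span (e ` {..<m}) \<noteq> UNIV"
  proof
    assume "span (e ` {..<m}) = UNIV"
    then have "DIM('v) \<le> card (e ` {..<m})"
      by (metis dim_UNIV dim_le_card finite_imageI finite_lessThan subset_refl)
    also have "\<dots> \<le> m" using card_image_le[of "{..<m}" e] by simp
    finally show False using assms by simp
  qed
  then obtain x where x: "x \<notin> span (e ` {..<m})" by blast
  define w where "w = x - (\<Sum>i<m. B x (e i) *\<^sub>R e i)"
  have "(\<Sum>i<m. B x (e i) *\<^sub>R e i) \<in> span (e ` {..<m})"
    by (intro span_sum span_scale span_base) auto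
  then have "w \<noteq> 0" using x by (auto simp: w_def)
  then have p: "B w w > 0" by (rule pos)
  have o: "B w (e j) = 0" if "j < m" for j
  proof -
    have "B w (e j) = B x (e j) - (\<Sum>i<m. B x (e i) * (if i = j then 1 else 0))"
      using that by (simp add: w_def B_simps onfamD[OF assms(1)])
    then show ?thesis using that by (simp only: sum_mult_delta)
  qed
  let ?v = "(1 / sqrt (B w w)) *\<^sub>R w"
  have "B ?v ?v = 1" using p by (simp add: B_simps real_sqrt_mult[symmetric] field_simps)
  moreover have "\<forall>i<m. B ?v (e i) = 0" using o by (simp add: B_simps)
  ultimately show ?thesis by blast
qed

lemma onfam_le_DIM: assumes "onfam m e" shows "m \<le> DIM('v)"
  using independent_bound[OF onfam_independent[OF assms]] card_image[OF onfam_inj[OF assms]] by simp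

text \<open>A nonzero remainder would be orthogonal to the family; normalised, it would extend it to
  one more independent vector than the dimension allows.\<close>

lemma onfam_expand:
  assumes e: "onfam DIM('v) e"
  shows "x = (\<Sum>i<DIM('v). B x (e i) *\<^sub>R e i)"
proof (rule ccontr)
  define w where "w = x - (\<Sum>i<DIM('v). B x (e i) *\<^sub>R e i)"
  assume "x \<noteq> (\<Sum>i<DIM('v). B x (e i) *\<^sub>R e i)"
  then have "w \<noteq> 0" by (simp add: w_def)
  then have p: "B w w > 0" by (rule pos)
  have o: "B w (e j) = 0" if "j < DIM('v)" for j
  proof -
    have "B w (e j) = B x (e j) - (\<Sum>i<DIM('v). B x (e i) * (if i = j then 1 else 0))"
      using that by (simp add: w_def B_simps onfamD[OF e])
    then show ?thesis using that by (simp only: sum_mult_delta)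
  qed
  define f where "f = e(DIM('v) := (1 / sqrt (B w w)) *\<^sub>R w)"
  have "onfam (Suc DIM('v)) f"
  proof -
    have o': "B (e j) w = 0" if "j < DIM('v)" for j using o[OF that] sym[of "e j" w] by simp
    have "1 / sqrt (B w w) * (1 / sqrt (B w w) * B w w) = 1" using p by (simp add: field_simps)
    then show ?thesis
      unfolding onfam_def f_def using o o' onfamD[OF e]
      by (auto simp: less_Suc_eq B_simps)
  qed
  then show False using onfam_le_DIM by fastforce
qed

lemma onfam_parseval:
  assumes e: "onfam DIM('v) e"
  shows "(\<Sum>i<DIM('v). B x (e i) * B y (e i)) = B x y"
proof -
  have "B x y = B (\<Sum>i<DIM('v). B x (e i) *\<^sub>R e i) y" using onfam_expand[OF e, of x] by simp
  then show ?thesis by (simp add: B_simps sym[of _ y])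
qed

lemma onfam_eqI:
  assumes e: "onfam DIM('v) e" and "\<And>i. i < DIM('v) \<Longrightarrow> B x (e i) = B y (e i)"
  shows "x = y"
  using onfam_expand[OF e, of x] onfam_expand[OF e, of y] assms(2) by simp

lemma onfam_expand_linear:
  assumes e: "onfam DIM('v) e" and f: "linear (f :: 'v \<Rightarrow> 'w::real_vector)"
  shows "f x = (\<Sum>i<DIM('v). B x (e i) *\<^sub>R f (e i))"
proof -
  have "f x = f (\<Sum>i<DIM('v). B x (e i) *\<^sub>R e i)" using onfam_expand[OF e, of x] by simp
  then show ?thesis by (simp add: linear_sum[OF f] linear_cmul[OF f])
qed

end

lemma linear_smult_complex: "linear (\<lambda>v::complex^'n. c *s v)"
  by (rule linearI) (simp_all add: vec_eq_iff algebra_simps)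

section \<open>Inner products invariant under the complex structure\<close>

locale hermitian_form = inner_form B for B :: "complex^'n::finite \<Rightarrow> complex^'n \<Rightarrow> real" +
  assumes J_inv: "B (\<i> *s u) (\<i> *s v) = B u v"
begin

lemma J_skew: "B u (\<i> *s v) = - B (\<i> *s u) v"
proof -
  have "B u (\<i> *s v) = B (\<i> *s u) (\<i> *s (\<i> *s v))" by (rule J_inv[symmetric])
  also have "\<i> *s (\<i> *s v) = - v" by (simp add: vec_eq_iff)
  finally show ?thesis by (simp add: B_simps)
qed

lemma J_self: "B v (\<i> *s v) = 0" "B (\<i> *s v) v = 0"
  using J_skew[of v v] sym[of v "\<i> *s v"] by auto

lemma onframe_onfam: "on_frame B e \<longleftrightarrow> onfam DIM(complex^'n) e"
  by (simp add: on_frame_def onfam_def mult.commute)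

text \<open>Orthonormality for the Hermitian product with real part \<open>B\<close>; its imaginary
  part is, up to sign, \<open>B u (\<i> *s v)\<close>.\<close>

definition unitary_frame :: "nat \<Rightarrow> (nat \<Rightarrow> complex^'n) \<Rightarrow> bool" where
  "unitary_frame m \<epsilon> \<longleftrightarrow> (\<forall>a<m. \<forall>b<m. B (\<epsilon> a) (\<epsilon> b) = (if a = b then 1 else 0) \<and> B (\<epsilon> a) (\<i> *s \<epsilon> b) = 0)"

lemma unitary_frameD:
  assumes "unitary_frame m \<epsilon>" "a < m" "b < m"
  shows "B (\<epsilon> a) (\<epsilon> b) = (if a = b then 1 else 0)" "B (\<epsilon> a) (\<i> *s \<epsilon> b) = 0" "B (\<i> *s \<epsilon> a) (\<epsilon> b) = 0"
  using assms J_skew[of "\<epsilon> a" "\<epsilon> b"] by (auto simp: unitary_frame_def)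

definition real_frame :: "nat \<Rightarrow> (nat \<Rightarrow> complex^'n) \<Rightarrow> nat \<Rightarrow> complex^'n" where
  "real_frame m \<epsilon> i = (if i < m then \<epsilon> i else \<i> *s \<epsilon> (i - m))"

lemma onfam_real_frame: "unitary_frame m \<epsilon> \<Longrightarrow> onfam (2 * m) (real_frame m \<epsilon>)"
  unfolding onfam_def real_frame_def
  by (auto simp: unitary_frameD J_inv)

text \<open>A new vector orthogonal to the 2m real vectors already present, not only to the m
  vectors of the unitary frame, keeps its multiple by \<open>\<i>\<close> orthogonal as well, since
  multiplication by \<open>\<i>\<close> is skew. Starting from \<open>u\<close> puts the prescribed
  direction at index 0.\<close>

lemma unitary_frame_exists:
  assumes "B u u = 1"
  shows "\<exists>\<epsilon>. \<epsilon> 0 = u \<and> unitary_frame CARD('n) \<epsilon>"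
proof -
  have "\<exists>\<epsilon>. \<epsilon> 0 = u \<and> unitary_frame m \<epsilon>" if "1 \<le> m" "m \<le> CARD('n)" for m
    using that
  proof (induction m rule: dec_induct)
    case base
    have "unitary_frame 1 (\<lambda>_. u)" using assms J_self by (simp add: unitary_frame_def)
    then show ?case by auto
  next
    case (step m)
    then obtain \<epsilon> where \<epsilon>: "\<epsilon> 0 = u" "unitary_frame m \<epsilon>" by auto
    have "2 * m < DIM(complex^'n)" using step by simp
    from onfam_span_orth[OF onfam_real_frame[OF \<epsilon>(2)] this]
    obtain v where v: "B v v = 1" "\<And>i. i < 2 * m \<Longrightarrow> B v (real_frame m \<epsilon> i) = 0" by blast
    have v1: "B v (\<epsilon> a) = 0" "B v (\<i> *s \<epsilon> a) = 0" if "a < m" for a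
      using v(2)[of a] v(2)[of "a + m"] that by (auto simp: real_frame_def)
    have v2: "B (\<epsilon> a) v = 0" "B (\<epsilon> a) (\<i> *s v) = 0" if "a < m" for a
      using v1[OF that] sym[of "\<epsilon> a" v] J_skew[of "\<epsilon> a" v] sym[of "\<i> *s \<epsilon> a" v] by auto
    have "unitary_frame (Suc m) (\<epsilon>(m := v))"
      unfolding unitary_frame_def
      using v(1) v1 v2 J_self[of v] unitary_frameD[OF \<epsilon>(2)]
      by (auto simp: less_Suc_eq)
    moreover have "(\<epsilon>(m := v)) 0 = u" using \<epsilon> step by auto
    ultimately show ?case by blast
  qed
  then show ?thesis by (metis One_nat_def Suc_leI order_refl zero_less_card_finite)
qed

lemma on_frame_exists: "\<exists>e. on_frame B e"
proof -
  obtain v :: "complex^'n" where "v \<noteq> 0" using zero_neq_one by blast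
  then have p: "B v v > 0" by (rule pos)
  let ?v = "(1 / sqrt (B v v)) *\<^sub>R v"
  have "B ?v ?v = 1" using p by (simp add: B_simps field_simps)
  from unitary_frame_exists[OF this] obtain \<epsilon> where "unitary_frame CARD('n) \<epsilon>" by blast
  then have "onfam DIM(complex^'n) (real_frame CARD('n) \<epsilon>)"
    using onfam_real_frame[of "CARD('n)"] by (simp add: mult.commute)
  then show ?thesis unfolding onframe_onfam by blast
qed

lemma on_frame_of: "on_frame B (frame_of B)"
  unfolding frame_of_def using on_frame_exists by (rule someI_ex)

text \<open>
  Row \<open>m\<close> holds the components in the frame \<open>e\<close> of the vector \<open>(\<epsilon> m - \<i> J (\<epsilon> m)) / sqrt 2\<close> of type (1,0) if
  \<open>m < n\<close>, and of the conjugate of the vector with index \<open>m - n\<close> otherwise.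
\<close>

definition umat :: "(nat \<Rightarrow> complex^'n) \<Rightarrow> (nat \<Rightarrow> complex^'n) \<Rightarrow> nat \<Rightarrow> nat \<Rightarrow> complex" where
  "umat \<epsilon> e m i = (if m < CARD('n)
     then (of_real (B (\<epsilon> m) (e i)) - \<i> * of_real (B (\<i> *s \<epsilon> m) (e i))) / of_real (sqrt 2)
     else (of_real (B (\<epsilon> (m - CARD('n))) (e i)) + \<i> * of_real (B (\<i> *s \<epsilon> (m - CARD('n))) (e i))) / of_real (sqrt 2))"

definition cbar :: "nat \<Rightarrow> nat" where
  "cbar m = (if m < CARD('n) then m + CARD('n) else m - CARD('n))"

lemma umat_cbar: "m < 2 * CARD('n) \<Longrightarrow> umat \<epsilon> e (cbar m) i = cnj (umat \<epsilon> e m i)"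
  by (auto simp: umat_def cbar_def)

text \<open>Rows m and m + n are conjugate, so the mixed terms cancel in their joint contribution
  and the two factors 1/2 add up to 1. What is left is Parseval for the real frame formed by the
  vectors \<open>\<epsilon> m\<close> and \<open>\<i> *s \<epsilon> m\<close>.\<close>

lemma umat_unitary:
  assumes \<epsilon>: "unitary_frame CARD('n) \<epsilon>" and e: "on_frame B e" and "i < 2 * CARD('n)" "i' < 2 * CARD('n)"
  shows "(\<Sum>m<2 * CARD('n). umat \<epsilon> e m i * cnj (umat \<epsilon> e m i')) = (if i = i' then 1 else 0)"
proof -
  let ?n = "CARD('n)"
  have split: "(\<Sum>m<2 * ?n. f m) = (\<Sum>m<?n. f m + f (m + ?n))" for f :: "nat \<Rightarrow> 'b::comm_monoid_add"
  proof -
    have "(\<Sum>m<2 * ?n. f m) = sum f {0..<?n} + sum f {?n..<2 * ?n}"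
      by (simp add: lessThan_atLeast0 sum.atLeastLessThan_concat)
    also have "sum f {?n..<2 * ?n} = (\<Sum>m<?n. f (m + ?n))"
      using sum.shift_bounds_nat_ivl[of f 0 ?n ?n] by (simp add: lessThan_atLeast0 mult_2)
    finally show ?thesis by (simp add: sum.distrib lessThan_atLeast0)
  qed
  have sq: "of_real (sqrt 2) * of_real (sqrt 2) = (2::complex)"
    by (simp flip: of_real_mult)
  have "(\<Sum>m<2 * ?n. umat \<epsilon> e m i * cnj (umat \<epsilon> e m i'))
      = (\<Sum>m<?n. of_real (B (\<epsilon> m) (e i) * B (\<epsilon> m) (e i') + B (\<i> *s \<epsilon> m) (e i) * B (\<i> *s \<epsilon> m) (e i')))"
    unfolding split
  proof (rule sum.cong[OF refl])
    fix m assume "m \<in> {..<?n}"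
    then show "umat \<epsilon> e m i * cnj (umat \<epsilon> e m i') + umat \<epsilon> e (m + ?n) i * cnj (umat \<epsilon> e (m + ?n) i')
      = of_real (B (\<epsilon> m) (e i) * B (\<epsilon> m) (e i') + B (\<i> *s \<epsilon> m) (e i) * B (\<i> *s \<epsilon> m) (e i'))"
      by (simp add: umat_def sq field_simps complex_eq_iff)
  qed
  also have "\<dots> = of_real (\<Sum>m<2 * ?n. B (real_frame ?n \<epsilon> m) (e i) * B (real_frame ?n \<epsilon> m) (e i'))"
    unfolding split by (auto simp: real_frame_def intro!: sum.cong)
  also have "(\<Sum>m<2 * ?n. B (real_frame ?n \<epsilon> m) (e i) * B (real_frame ?n \<epsilon> m) (e i')) = B (e i) (e i')"
  proof -
    have "B (real_frame ?n \<epsilon> m) x = B x (real_frame ?n \<epsilon> m)" for m x by (rule sym)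
    then show ?thesis
      using onfam_parseval[of "real_frame ?n \<epsilon>" "e i" "e i'"] onfam_real_frame[OF \<epsilon>]
      by (simp add: mult.commute[of 2])
  qed
  also have "\<dots> = (if i = i' then 1 else 0)" using e assms by (simp add: on_frame_def)
  finally show ?thesis by simp
qed

text \<open>The rows are eigenvectors of the complex structure: a scalar c acting on the real
  tangent space multiplies a vector of type (1,0) by c and its conjugate by \<open>cnj c\<close>.
  This makes the type of a form visible in its components.\<close>

lemma umat_rotate:
  assumes e: "on_frame B e" and "l < 2 * CARD('n)" "m < 2 * CARD('n)"
  shows "(\<Sum>i<2 * CARD('n). umat \<epsilon> e m i * of_real (B (c *s e i) (e l)))
     = (if m < CARD('n) then c else cnj c) * umat \<epsilon> e m l"
proof -
  let ?N = "2 * CARD('n)"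
  have e': "onfam DIM(complex^'n) e" using e by (simp only: onframe_onfam)
  have rot: "(\<Sum>i<?N. B x (e i) * B (c *s e i) y) = Re c * B x y + Im c * B (\<i> *s x) y" for x y
  proof -
    have "B (c *s x) y = (\<Sum>i<?N. B x (e i) * B (c *s e i) y)"
      using onfam_expand_linear[OF e' linear_compose[OF linear_smult_complex[of c] lin_left[of y]], of x]
      by (simp add: o_def mult.commute)
    moreover have "c *s x = Re c *\<^sub>R x + Im c *\<^sub>R (\<i> *s x)"
      by (simp add: vec_eq_iff complex_eq_iff)
    ultimately show ?thesis by (simp add: B_simps)
  qed
  have JJ: "\<i> *s (\<i> *s x) = - x" for x :: "complex^'n" by (simp add: vec_eq_iff)
  have lin: "(\<Sum>i<?N. (of_real (f i) + s * of_real (g i)) / r * of_real (h i))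
     = (of_real (\<Sum>i<?N. f i * h i) + s * of_real (\<Sum>i<?N. g i * h i)) / r" for f g h and s r :: complex
    by (simp add: sum_divide_distrib sum_distrib_left sum.distrib[symmetric] add_divide_distrib algebra_simps)
  have lin': "(\<Sum>i<?N. (of_real (f i) - s * of_real (g i)) / r * of_real (h i))
     = (of_real (\<Sum>i<?N. f i * h i) - s * of_real (\<Sum>i<?N. g i * h i)) / r" for f g h and s r :: complex
    using lin[of f "- s" g r h] by simp
  show ?thesis
  proof (cases "m < CARD('n)")
    case True
    then show ?thesis unfolding umat_def
      by (simp only: if_True lin' rot JJ B_simps) (simp add: field_simps complex_eq_iff)
  next
    case False
    then show ?thesis unfolding umat_def
      by (simp only: if_False lin rot JJ B_simps) (simp add: field_simps complex_eq_iff)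
  qed
qed

lemma umat_real_part:
  "umat \<epsilon> e 0 i + umat \<epsilon> e (cbar 0) i = of_real (sqrt 2 * B (\<epsilon> 0) (e i))"
  by (simp add: umat_def cbar_def complex_eq_iff field_simps)

end

section \<open>Alternating forms in a frame\<close>

lemma sum_PiE_Suc:
  fixes f :: "(nat \<Rightarrow> 'i) \<Rightarrow> 'b::comm_monoid_add"
  shows "(\<Sum>I\<in>{..<Suc s} \<rightarrow>\<^sub>E D. f I) = (\<Sum>I\<in>{..<s} \<rightarrow>\<^sub>E D. \<Sum>i\<in>D. f (I(s := i)))"
proof -
  have "(\<Sum>x\<in>({..<s} \<rightarrow>\<^sub>E D) \<times> D. f ((fst x)(s := snd x))) = (\<Sum>I\<in>{..<Suc s} \<rightarrow>\<^sub>E D. f I)"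
  proof (rule sum.reindex_bij_witness[where j="\<lambda>x. (fst x)(s := snd x)" and i="\<lambda>I. (I(s := undefined), I s)"])
    fix x assume "x \<in> ({..<s} \<rightarrow>\<^sub>E D) \<times> D"
    then have x0: "fst x \<in> {..<s} \<rightarrow>\<^sub>E D" "snd x \<in> D" by (simp_all add: mem_Times_iff)
    have x: "\<And>i. i < s \<Longrightarrow> fst x i \<in> D" "\<And>i. i \<ge> s \<Longrightarrow> fst x i = undefined" "snd x \<in> D"
      using PiE_mem[OF x0(1)] PiE_arb[OF x0(1)] x0(2) by simp_all
    have "fst x s = undefined" using x(2) by simp
    then have "(fst x)(s := undefined) = fst x" by (simp add: fun_upd_idem)
    then show "(((fst x)(s := snd x))(s := undefined), ((fst x)(s := snd x)) s) = x" by simp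
    show "(fst x)(s := snd x) \<in> {..<Suc s} \<rightarrow>\<^sub>E D" using x by (intro PiE_I) (auto simp: less_Suc_eq)
  next
    fix I assume I: "I \<in> {..<Suc s} \<rightarrow>\<^sub>E D"
    have x: "\<And>i. i < Suc s \<Longrightarrow> I i \<in> D" "\<And>i. i \<ge> Suc s \<Longrightarrow> I i = undefined"
      using PiE_mem[OF I] PiE_arb[OF I] by simp_all
    have "I(s := undefined) \<in> {..<s} \<rightarrow>\<^sub>E D" using x by (intro PiE_I) simp_all
    then show "(I(s := undefined), I s) \<in> ({..<s} \<rightarrow>\<^sub>E D) \<times> D" using x(1)[of s] by simp
  qed simp_all
  then show ?thesis by (simp add: sum.cartesian_product case_prod_unfold)
qed

lemma alt_form_cong: "alt_form k \<alpha> \<Longrightarrow> (\<And>i. i < k \<Longrightarrow> v i = w i) \<Longrightarrow> \<alpha> v = \<alpha> w"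
  unfolding alt_form_def by blast

lemma alt_form_linear: "alt_form k \<alpha> \<Longrightarrow> i < k \<Longrightarrow> linear (\<lambda>x. \<alpha> (v(i := x)))"
  unfolding alt_form_def by blast

text \<open>Antisymmetry is left out because frame independence must also apply to the product of a
  covector and a form, which is not alternating.\<close>

definition multi_form :: "nat \<Rightarrow> 'n::finite cform \<Rightarrow> bool" where
  "multi_form k \<alpha> \<longleftrightarrow> (\<forall>v w. (\<forall>i<k. v i = w i) \<longrightarrow> \<alpha> v = \<alpha> w) \<and> (\<forall>i<k. \<forall>v. linear (\<lambda>x. \<alpha> (v(i := x))))"

lemma alt_form_multi: "alt_form k \<alpha> \<Longrightarrow> multi_form k \<alpha>"
  unfolding alt_form_def multi_form_def by blast

lemma alt_form_permutes: "alt_form k \<alpha> \<Longrightarrow> \<sigma> permutes {..<k} \<Longrightarrow> \<alpha> (v \<circ> \<sigma>) = of_int (sign \<sigma>) * \<alpha> v"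
  unfolding alt_form_def by blast

lemma alt_form_transpose:
  assumes "alt_form k \<alpha>" "i < k" "j < k" "i \<noteq> j"
  shows "\<alpha> (v \<circ> Transposition.transpose i j) = - \<alpha> v"
  using alt_form_permutes[OF assms(1) permutes_swap_id[of i "{..<k}" j], of v] assms
  by (simp add: sign_swap_id)

lemma alt_form_scale: "alt_form k \<alpha> \<Longrightarrow> alt_form k (\<lambda>v. c * \<alpha> v)"
  unfolding alt_form_def
  by (auto intro!: linear_compose[unfolded o_def, where g="\<lambda>x. c * x"] bounded_linear.linear[OF bounded_linear_mult_right])

lemma alt_form_sum: "(\<And>i. i \<in> A \<Longrightarrow> alt_form k (\<alpha> i)) \<Longrightarrow> alt_form k (\<lambda>v. \<Sum>i\<in>A. \<alpha> i v)"
  unfolding alt_form_def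
  by (auto intro!: linear_compose_sum sum.cong simp: sum_distrib_left)

text \<open>The vectors are expanded one slot after another, with an arbitrary tail. The index set
  may be of any type, so the same expansion serves orthonormal frames and the standard
  \<open>Basis\<close>.\<close>

lemma multilinear_expand:
  fixes \<alpha> :: "'n::finite cform"
  assumes \<alpha>: "multi_form k \<alpha>" and w: "\<And>j. j < k \<Longrightarrow> w j = (\<Sum>i\<in>D. r j i *\<^sub>R e i)"
  shows "\<alpha> w = (\<Sum>I\<in>{..<k} \<rightarrow>\<^sub>E D. (\<Prod>j<k. of_real (r j (I j))) * \<alpha> (e \<circ> I))"
proof -
  have "\<alpha> (\<lambda>j. if j < s then w j else v j)
      = (\<Sum>I\<in>{..<s} \<rightarrow>\<^sub>E D. (\<Prod>j<s. of_real (r j (I j))) * \<alpha> (\<lambda>j. if j < s then e (I j) else v j))"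
    if "s \<le> k" for s v
    using that
  proof (induction s arbitrary: v)
    case 0 then show ?case by simp
  next
    case (Suc s)
    have "\<alpha> (\<lambda>j. if j < Suc s then w j else v j) = \<alpha> (\<lambda>j. if j < s then w j else (v(s := w s)) j)"
      by (rule arg_cong[of _ _ \<alpha>]) (auto simp: less_Suc_eq)
    also have "\<dots> = (\<Sum>I\<in>{..<s} \<rightarrow>\<^sub>E D. (\<Prod>j<s. of_real (r j (I j))) *
        \<alpha> (\<lambda>j. if j < s then e (I j) else (v(s := w s)) j))"
      using Suc by simp
    also have "\<dots> = (\<Sum>I\<in>{..<s} \<rightarrow>\<^sub>E D. \<Sum>i\<in>D. (\<Prod>j<Suc s. of_real (r j ((I(s := i)) j))) *
        \<alpha> (\<lambda>j. if j < Suc s then e ((I(s := i)) j) else v j))"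
    proof (rule sum.cong[OF refl])
      fix I
      define u where "u = (\<lambda>j. if j < s then e (I j) else v j)"
      have "\<alpha> (\<lambda>j. if j < s then e (I j) else (v(s := w s)) j) = \<alpha> (u(s := w s))"
        by (rule arg_cong[of _ _ \<alpha>]) (auto simp: u_def)
      also have "\<dots> = (\<Sum>i\<in>D. r s i *\<^sub>R \<alpha> (u(s := e i)))"
      proof -
        have l: "linear (\<lambda>x. \<alpha> (u(s := x)))" using \<alpha> Suc by (simp add: multi_form_def)
        show ?thesis using Suc w[of s] linear_sum[OF l, of "\<lambda>i. r s i *\<^sub>R e i" D] linear_cmul[OF l] by simp
      qed
      also have "\<dots> = (\<Sum>i\<in>D. of_real (r s i) * \<alpha> (\<lambda>j. if j < Suc s then e ((I(s := i)) j) else v j))"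
      proof (rule sum.cong[OF refl])
        fix i
        have "u(s := e i) = (\<lambda>j. if j < Suc s then e ((I(s := i)) j) else v j)" by (auto simp: u_def fun_eq_iff)
        then show "r s i *\<^sub>R \<alpha> (u(s := e i)) = of_real (r s i) * \<alpha> (\<lambda>j. if j < Suc s then e ((I(s := i)) j) else v j)"
          by (simp add: scaleR_conv_of_real)
      qed
      finally show "(\<Prod>j<s. of_real (r j (I j))) * \<alpha> (\<lambda>j. if j < s then e (I j) else (v(s := w s)) j)
        = (\<Sum>i\<in>D. (\<Prod>j<Suc s. of_real (r j ((I(s := i)) j))) *
            \<alpha> (\<lambda>j. if j < Suc s then e ((I(s := i)) j) else v j))"
        by (simp add: sum_distrib_left mult.assoc)
    qed
    also have "\<dots> = (\<Sum>I\<in>{..<Suc s} \<rightarrow>\<^sub>E D. (\<Prod>j<Suc s. of_real (r j (I j))) *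
        \<alpha> (\<lambda>j. if j < Suc s then e (I j) else v j))"
      by (rule sum_PiE_Suc[symmetric])
    finally show ?case .
  qed
  from this[of k w] have 1: "\<alpha> w = (\<Sum>I\<in>{..<k} \<rightarrow>\<^sub>E D. (\<Prod>j<k. of_real (r j (I j))) *
      \<alpha> (\<lambda>j. if j < k then e (I j) else w j))"
    by simp
  have "\<alpha> (\<lambda>j. if j < k then e (I j) else w j) = \<alpha> (e \<circ> I)" for I
    using \<alpha> by (simp add: multi_form_def)
  then show ?thesis by (simp add: 1)
qed

section \<open>Types and components with respect to complex frames\<close>

text \<open>
  Unlike \<open>pq_form\<close>, this form of the type condition visibly passes to derivatives.
\<close>

definition pq_rot :: "nat \<Rightarrow> nat \<Rightarrow> 'n::finite cform \<Rightarrow> bool" where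
  "pq_rot p q \<alpha> \<longleftrightarrow> (\<forall>c v. norm c = 1 \<longrightarrow> \<alpha> (\<lambda>j. c *s v j) = c ^ p * cnj c ^ q * \<alpha> v)"

text \<open>A \<open>cform\<close> accepts only real tangent vectors. Its complex-multilinear
  extension, evaluated on the vectors whose frame components are the rows of \<open>U\<close>, is
  therefore encoded on arrays: \<open>F\<close> holds the components in a real frame and
  \<open>M j\<close> selects the row for slot j.\<close>

definition arr :: "(nat \<Rightarrow> nat \<Rightarrow> complex) \<Rightarrow> nat \<Rightarrow> nat \<Rightarrow> ((nat \<Rightarrow> nat) \<Rightarrow> complex) \<Rightarrow> (nat \<Rightarrow> nat) \<Rightarrow> complex" where
  "arr U k N F M = (\<Sum>I\<in>{..<k} \<rightarrow>\<^sub>E {..<N}. (\<Prod>j<k. U (M j) (I j)) * F I)"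

lemma arr_sum: "arr U k N (\<lambda>I. \<Sum>i\<in>A. c i * F i I) M = (\<Sum>i\<in>A. c i * arr U k N (F i) M)"
  unfolding arr_def sum_distrib_left by (subst sum.swap) (simp add: mult_ac)

lemma sum_prod_PiE:
  fixes f :: "nat \<Rightarrow> nat \<Rightarrow> complex"
  shows "(\<Sum>M\<in>{..<k} \<rightarrow>\<^sub>E {..<N::nat}. \<Prod>j<k. f j (M j)) = (\<Prod>j<k. \<Sum>m<N. f j m)"
  by (rule prod_sum_PiE[symmetric]) auto

lemma prod_if_eq:
  assumes "I \<in> {..<k::nat} \<rightarrow>\<^sub>E D" "I' \<in> {..<k} \<rightarrow>\<^sub>E D"
  shows "(\<Prod>j<k. if I j = I' j then 1 else 0 :: complex) = (if I = I' then 1 else 0)"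
proof (cases "I = I'")
  case False
  then obtain j where "j < k" "I j \<noteq> I' j" using PiE_ext[OF assms] by auto
  then have "\<exists>j\<in>{..<k}. (if I j = I' j then 1 else 0 :: complex) = 0" by auto
  then show ?thesis using False prod_zero[of "{..<k}"] by simp
qed simp

context
  fixes U :: "nat \<Rightarrow> nat \<Rightarrow> complex" and N :: nat
  assumes U: "\<And>i i'. i < N \<Longrightarrow> i' < N \<Longrightarrow> (\<Sum>m<N. U m i * cnj (U m i')) = (if i = i' then 1 else 0)"
begin

lemma unitary_sum:
  "(\<Sum>m<N. (\<Sum>i<N. U m i * x i) * cnj (\<Sum>i<N. U m i * y i)) = (\<Sum>i<N. x i * cnj (y i))"
proof -
  have "(\<Sum>m<N. (\<Sum>i<N. U m i * x i) * cnj (\<Sum>i<N. U m i * y i))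
      = (\<Sum>m<N. \<Sum>i<N. \<Sum>i'<N. (U m i * cnj (U m i')) * (x i * cnj (y i')))"
    by (simp add: sum_product mult_ac)
  also have "\<dots> = (\<Sum>i<N. \<Sum>i'<N. (\<Sum>m<N. U m i * cnj (U m i')) * (x i * cnj (y i')))"
    by (subst sum.swap, rule sum.cong[OF refl], subst sum.swap) (simp add: sum_distrib_right)
  also have "\<dots> = (\<Sum>i<N. \<Sum>i'<N. if i = i' then x i * cnj (y i') else 0)"
    by (intro sum.cong refl) (simp add: U)
  finally show ?thesis by simp
qed

text \<open>Summation over \<open>M\<close> factorises over the slots, and each slot gives a
  Kronecker delta: a tensor power of a unitary matrix is unitary.\<close>

lemma arr_inner:
  "(\<Sum>M\<in>{..<k} \<rightarrow>\<^sub>E {..<N}. arr U k N F M * cnj (arr U k N G M)) = (\<Sum>I\<in>{..<k} \<rightarrow>\<^sub>E {..<N}. F I * cnj (G I))"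
proof -
  let ?X = "{..<k} \<rightarrow>\<^sub>E {..<N}"
  have fin: "finite ?X" by (simp add: finite_PiE)
  have "(\<Sum>M\<in>?X. arr U k N F M * cnj (arr U k N G M))
      = (\<Sum>M\<in>?X. \<Sum>I\<in>?X. \<Sum>I'\<in>?X. (\<Prod>j<k. U (M j) (I j) * cnj (U (M j) (I' j))) * (F I * cnj (G I')))"
    by (simp add: arr_def sum_product prod.distrib mult_ac)
  also have "\<dots> = (\<Sum>I\<in>?X. \<Sum>I'\<in>?X. (\<Sum>M\<in>?X. \<Prod>j<k. U (M j) (I j) * cnj (U (M j) (I' j))) * (F I * cnj (G I')))"
    by (subst sum.swap, rule sum.cong[OF refl], subst sum.swap) (simp add: sum_distrib_right)
  also have "\<dots> = (\<Sum>I\<in>?X. \<Sum>I'\<in>?X. if I = I' then F I * cnj (G I') else 0)"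
  proof (intro sum.cong refl)
    fix I I' assume I: "I \<in> ?X" "I' \<in> ?X"
    have "(\<Sum>M\<in>?X. \<Prod>j<k. U (M j) (I j) * cnj (U (M j) (I' j))) = (\<Prod>j<k. \<Sum>m<N. U m (I j) * cnj (U m (I' j)))"
      by (rule sum_prod_PiE[of "\<lambda>j m. U m (I j) * cnj (U m (I' j))"])
    also have "\<dots> = (\<Prod>j<k. if I j = I' j then 1 else 0)"
      by (intro prod.cong refl U) (use I in \<open>auto simp: PiE_iff\<close>)
    also have "\<dots> = (if I = I' then 1 else 0)" by (rule prod_if_eq[OF I])
    finally show "(\<Sum>M\<in>?X. \<Prod>j<k. U (M j) (I j) * cnj (U (M j) (I' j))) * (F I * cnj (G I'))
      = (if I = I' then F I * cnj (G I') else 0)" by simp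
  qed
  finally show ?thesis using fin by simp
qed

lemma arr_norm: "(\<Sum>M\<in>{..<k} \<rightarrow>\<^sub>E {..<N}. (norm (arr U k N F M))\<^sup>2) = (\<Sum>I\<in>{..<k} \<rightarrow>\<^sub>E {..<N}. (norm (F I))\<^sup>2)"
proof -
  have "of_real (\<Sum>M\<in>{..<k} \<rightarrow>\<^sub>E {..<N}. (norm (arr U k N F M))\<^sup>2) = (of_real (\<Sum>I\<in>{..<k} \<rightarrow>\<^sub>E {..<N}. (norm (F I))\<^sup>2) :: complex)"
    using arr_inner[of k F F] by (simp only: of_real_sum complex_norm_square)
  then show ?thesis by (simp only: of_real_eq_iff)
qed

text \<open>The direction of differentiation counts as one more slot transformed by the same unitary
  matrix.\<close>

lemma arr_T_norm:
  "(\<Sum>m<N. \<Sum>M\<in>{..<k} \<rightarrow>\<^sub>E {..<N}. (norm (\<Sum>i<N. U m i * arr U k N (T i) M))\<^sup>2)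
     = (\<Sum>i<N. \<Sum>I\<in>{..<k} \<rightarrow>\<^sub>E {..<N}. (norm (T i I))\<^sup>2)"
proof -
  have u: "(\<Sum>m<N. (norm (\<Sum>i<N. U m i * x i))\<^sup>2) = (\<Sum>i<N. (norm (x i))\<^sup>2)" for x
  proof -
    have "of_real (\<Sum>m<N. (norm (\<Sum>i<N. U m i * x i))\<^sup>2) = (of_real (\<Sum>i<N. (norm (x i))\<^sup>2) :: complex)"
      using unitary_sum[of x x] by (simp only: of_real_sum complex_norm_square)
    then show ?thesis by (simp only: of_real_eq_iff)
  qed
  have "(\<Sum>m<N. \<Sum>M\<in>{..<k} \<rightarrow>\<^sub>E {..<N}. (norm (\<Sum>i<N. U m i * arr U k N (T i) M))\<^sup>2)
      = (\<Sum>m<N. \<Sum>I\<in>{..<k} \<rightarrow>\<^sub>E {..<N}. (norm (\<Sum>i<N. U m i * T i I))\<^sup>2)"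
    by (simp only: arr_sum[symmetric] arr_norm)
  also have "\<dots> = (\<Sum>I\<in>{..<k} \<rightarrow>\<^sub>E {..<N}. \<Sum>i<N. (norm (T i I))\<^sup>2)"
    by (subst sum.swap) (simp only: u)
  finally show ?thesis by (simp only: sum.swap[of _ "{..<N}"])
qed

text \<open>The conjugate row in the derivative slot meets the row in slot j, and their sum over m
  is a Kronecker delta. So the trace in the complex frame, which pairs each vector with its
  conjugate, reduces to the trace in the real frame.\<close>

lemma arr_coclosed:
  assumes cocl: "\<And>I. I \<in> {..<k} \<rightarrow>\<^sub>E {..<N} \<Longrightarrow> (\<Sum>i<N. T i (I(j := i))) = 0"
    and j: "j < k"
  shows "(\<Sum>m<N. \<Sum>i<N. cnj (U m i) * arr U k N (T i) (M(j := m))) = 0"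
proof -
  let ?X = "{..<k} \<rightarrow>\<^sub>E {..<N}"
  define g where "g I = (\<Prod>l\<in>{..<k} - {j}. U (M l) (I l))" for I :: "nat \<Rightarrow> nat"
  have pr: "(\<Prod>l<k. U ((M(j := m)) l) (I l)) = U m (I j) * g I" for m I
    using j by (subst prod.remove[of _ j]) (auto simp: g_def intro!: prod.cong)
  have "(\<Sum>m<N. \<Sum>i<N. cnj (U m i) * arr U k N (T i) (M(j := m)))
     = (\<Sum>m<N. \<Sum>i<N. \<Sum>I\<in>?X. (U m (I j) * cnj (U m i)) * (g I * T i I))"
    unfolding arr_def pr by (simp add: sum_distrib_left mult_ac)
  also have "\<dots> = (\<Sum>i<N. \<Sum>I\<in>?X. (\<Sum>m<N. U m (I j) * cnj (U m i)) * (g I * T i I))"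
    by (subst sum.swap, rule sum.cong[OF refl], subst sum.swap) (simp add: sum_distrib_right)
  also have "\<dots> = (\<Sum>I\<in>?X. \<Sum>i<N. if i = I j then g I * T i I else 0)"
    using j by (subst sum.swap) (intro sum.cong refl, auto simp: U PiE_iff)
  also have "\<dots> = (\<Sum>I\<in>?X. g I * T (I j) I)"
    by (intro sum.cong refl) (use j in \<open>auto simp: PiE_iff\<close>)
  finally have 1: "(\<Sum>m<N. \<Sum>i<N. cnj (U m i) * arr U k N (T i) (M(j := m))) = (\<Sum>I\<in>?X. g I * T (I j) I)" .
  have gu: "g (I(j := i)) = g I" for I i by (auto simp: g_def intro!: prod.cong)
  \<comment> \<open>The entry \<open>I j\<close> is both direction and slot entry. Summing over an
    extra index multiplies by N, and the slot exchange makes that index the contracted one, where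
    \<open>cocl\<close> applies.\<close>
  have "of_nat N * (\<Sum>I\<in>?X. g I * T (I j) I) = (\<Sum>I\<in>?X. \<Sum>i<N. g I * T (I j) I)"
    by (simp add: sum_distrib_left)
  also have "\<dots> = (\<Sum>I\<in>?X. \<Sum>i<N. g (I(j := i)) * T ((I(j := i)) j) (I(j := i)))"
    by (rule sum_slot_swap[OF j, symmetric, of "\<lambda>I i. g I * T (I j) I"])
  also have "\<dots> = (\<Sum>I\<in>?X. g I * (\<Sum>i<N. T i (I(j := i))))"
    by (simp add: gu sum_distrib_left)
  also have "\<dots> = 0" by (simp add: cocl)
  finally have "N = 0 \<or> (\<Sum>I\<in>?X. g I * T (I j) I) = 0" by simp
  then show ?thesis using 1 by auto
qed

end

text \<open>The identity exchanges the derivative slot with slot j. Since the same matrix acts on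
  both, it is inherited once the indices \<open>I j\<close> and i are renamed into each
  other.\<close>

lemma arr_closed:
  assumes cl: "\<And>I i. I \<in> {..<k} \<rightarrow>\<^sub>E {..<N} \<Longrightarrow> i < N \<Longrightarrow> T i I = (\<Sum>j<k. T (I j) (I(j := i)))"
  shows "(\<Sum>i<N. U m i * arr U k N (T i) M) = (\<Sum>j<k. \<Sum>i<N. U (M j) i * arr U k N (T i) (M(j := m)))"
proof -
  let ?X = "{..<k} \<rightarrow>\<^sub>E {..<N}"
  have pr: "(\<Prod>l<k. U (M l) ((I(j := i)) l)) = U (M j) i * (\<Prod>l\<in>{..<k} - {j}. U (M l) (I l))" if "j < k" for j I i
    using that by (subst prod.remove[of _ j]) (auto intro!: prod.cong)
  have pr': "(\<Prod>l<k. U ((M(j := m)) l) (I l)) = U m (I j) * (\<Prod>l\<in>{..<k} - {j}. U (M l) (I l))" if "j < k" for j I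
    using that by (subst prod.remove[of _ j]) (auto intro!: prod.cong)
  have "(\<Sum>i<N. U m i * arr U k N (T i) M) = (\<Sum>I\<in>?X. \<Sum>i<N. \<Sum>j<k. U m i * (\<Prod>l<k. U (M l) (I l)) * T (I j) (I(j := i)))"
    unfolding arr_def sum_distrib_left
    by (subst sum.swap) (intro sum.cong refl, auto simp: cl sum_distrib_left mult.assoc)
  also have "\<dots> = (\<Sum>j<k. \<Sum>I\<in>?X. \<Sum>i<N. U m i * (\<Prod>l<k. U (M l) (I l)) * T (I j) (I(j := i)))"
    by (subst (2) sum.swap, subst sum.swap) rule
  also have "\<dots> = (\<Sum>j<k. \<Sum>I\<in>?X. \<Sum>i<N. U m (I j) * (\<Prod>l<k. U (M l) ((I(j := i)) l)) * T i I)"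
  proof (rule sum.cong[OF refl])
    fix j assume "j \<in> {..<k}"
    then have j: "j < k" by simp
    show "(\<Sum>I\<in>?X. \<Sum>i<N. U m i * (\<Prod>l<k. U (M l) (I l)) * T (I j) (I(j := i)))
      = (\<Sum>I\<in>?X. \<Sum>i<N. U m (I j) * (\<Prod>l<k. U (M l) ((I(j := i)) l)) * T i I)"
      using sum_slot_swap[OF j, of "\<lambda>I i. U m (I j) * (\<Prod>l<k. U (M l) ((I(j := i)) l)) * T i I" "{..<N}"]
      by (simp del: fun_upd_apply add: fun_upd_same)
  qed
  also have "\<dots> = (\<Sum>j<k. \<Sum>i<N. U (M j) i * arr U k N (T i) (M(j := m)))"
    unfolding arr_def sum_distrib_left
    by (rule sum.cong[OF refl], subst sum.swap, intro sum.cong refl) (simp add: pr pr' mult_ac del: fun_upd_apply)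
  finally show ?thesis .
qed

text \<open>Renaming the summation index by the transposition fixes the weights, because
  \<open>M a = M b\<close>, and changes the sign of \<open>F\<close>.\<close>

lemma arr_alternating:
  assumes F: "\<And>I. F (I \<circ> Transposition.transpose a b) = - F I" and "a < k" "b < k" "M a = M b"
  shows "arr U k N F M = 0"
proof -
  let ?\<tau> = "Transposition.transpose a b"
  have p: "?\<tau> permutes {..<k}" using assms by (intro permutes_swap_id) auto
  have "arr U k N F M = (\<Sum>I\<in>{..<k} \<rightarrow>\<^sub>E {..<N}. (\<Prod>j<k. U (M j) ((I \<circ> ?\<tau>) j)) * F (I \<circ> ?\<tau>))"
    unfolding arr_def by (rule sum_PiE_permutes[OF p, symmetric])
  also have "\<dots> = (\<Sum>I\<in>{..<k} \<rightarrow>\<^sub>E {..<N}. - ((\<Prod>j<k. U (M j) (I j)) * F I))"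
  proof (rule sum.cong[OF refl])
    fix I
    have M\<tau>: "M (?\<tau> j) = M j" for j using assms by (auto simp: Transposition.transpose_def)
    have "(\<Prod>j<k. U (M j) ((I \<circ> ?\<tau>) j)) = (\<Prod>j<k. U (M (?\<tau> j)) (I (?\<tau> j)))"
      by (simp add: M\<tau>)
    also have "\<dots> = (\<Prod>j<k. U (M j) (I j))"
      using prod.permute[OF p, of "\<lambda>j. U (M j) (I j)"] by (simp add: o_def)
    finally show "(\<Prod>j<k. U (M j) ((I \<circ> ?\<tau>) j)) * F (I \<circ> ?\<tau>) = - ((\<Prod>j<k. U (M j) (I j)) * F I)"
      by (simp add: F)
  qed
  also have "\<dots> = - arr U k N F M" by (simp add: arr_def sum_negf)
  finally show ?thesis by simp
qed

text \<open>The number of holomorphic indices is read off from the behaviour under phases; a single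
  small phase already decides.\<close>

lemma unit_phase_power_eq:
  fixes a p q :: nat
  assumes "a \<le> p + q" and "\<And>c::complex. norm c = 1 \<Longrightarrow> c ^ a * cnj c ^ (p + q - a) = c ^ p * cnj c ^ q"
  shows "a = p"
proof -
  \<comment> \<open>All exponents that can occur then give angles in (-1, 1), where the sine is
    injective.\<close>
  define t where "t = 1 / (real (p + q) + 1)"
  have t: "t > 0" by (simp add: t_def)
  have cp: "cis t ^ a * cnj (cis t) ^ b = cis (t * (real a - real b))" for a b
    by (simp add: cis_cnj Complex.DeMoivre cis_mult algebra_simps)
  have e: "cis (t * (real a - real (p + q - a))) = cis (t * (real p - real q))"
    using assms(2)[of "cis t"] by (simp add: cp)
  have r: "\<bar>t * x\<bar> < 1" if "\<bar>x\<bar> \<le> real (p + q)" for x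
    using that by (simp add: t_def abs_mult field_simps)
  have r1: "\<bar>t * (real a - real (p + q - a))\<bar> < 1" and r2: "\<bar>t * (real p - real q)\<bar> < 1"
    using assms(1) by (auto intro!: r)
  have "sin (t * (real a - real (p + q - a))) = sin (t * (real p - real q))"
    using e by (metis cis.sel(2))
  then have "t * (real a - real (p + q - a)) = t * (real p - real q)"
    by (rule sin_inj_pi[rotated 4]) (use r1 r2 pi_gt3 in linarith)+
  then have "real a - real (p + q - a) = real p - real q" using t by (metis mult_left_cancel less_irrefl)
  then show ?thesis using assms(1) by (simp add: of_nat_diff)
qed

section \<open>Components of forms over a Hermitian inner product\<close>

context hermitian_form
begin

abbreviation "fr \<equiv> frame_of B"

lemma fr_onfam: "onfam DIM(complex^'n) fr"
  using on_frame_of by (simp only: onframe_onfam)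

lemma multi_form_expand:
  assumes "multi_form k \<alpha>" "on_frame B e"
  shows "\<alpha> w = (\<Sum>I\<in>{..<k} \<rightarrow>\<^sub>E {..<2 * CARD('n)}. (\<Prod>j<k. of_real (B (w j) (e (I j)))) * \<alpha> (e \<circ> I))"
proof (rule multilinear_expand[OF assms(1)])
  fix j
  show "w j = (\<Sum>i<2 * CARD('n). B (w j) (e i) *\<^sub>R e i)"
    using onfam_expand[of e "w j"] assms(2) by (simp add: onframe_onfam mult.commute)
qed

lemmas alt_form_expand = multi_form_expand[OF alt_form_multi]

lemma alt_form_zero_iff:
  assumes "alt_form k \<alpha>" "on_frame B e" "\<And>I. I \<in> {..<k} \<rightarrow>\<^sub>E {..<2 * CARD('n)} \<Longrightarrow> \<alpha> (e \<circ> I) = 0"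
  shows "\<alpha> w = 0"
  by (subst alt_form_expand[OF assms(1,2)]) (simp add: assms(3))

lemma on_frame_orthogonal:
  assumes e: "on_frame B e" and f: "on_frame B f" and "i < 2 * CARD('n)" "i' < 2 * CARD('n)"
  shows "(\<Sum>m<2 * CARD('n). B (e m) (f i) * B (e m) (f i')) = (if i = i' then 1 else 0)"
proof -
  have "(\<Sum>m<2 * CARD('n). B (f i) (e m) * B (f i') (e m)) = B (f i) (f i')"
    using onfam_parseval[of e "f i" "f i'"] e by (simp add: onframe_onfam mult.commute[of 2])
  moreover have "B (f i) (f i') = (if i = i' then 1 else 0)" using f assms by (simp add: on_frame_def)
  moreover have "B (f a) (e m) = B (e m) (f a)" for a m by (rule sym)
  ultimately show ?thesis by simp
qed

text \<open>This makes the arbitrary choice of the frame in \<open>form_inner\<close> harmless.\<close>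

lemma frame_independent:
  assumes "multi_form k \<alpha>" "multi_form k \<beta>" "on_frame B e" "on_frame B f"
  shows "(\<Sum>I\<in>{..<k} \<rightarrow>\<^sub>E {..<2 * CARD('n)}. \<alpha> (e \<circ> I) * cnj (\<beta> (e \<circ> I)))
       = (\<Sum>I\<in>{..<k} \<rightarrow>\<^sub>E {..<2 * CARD('n)}. \<alpha> (f \<circ> I) * cnj (\<beta> (f \<circ> I)))"
proof -
  define U where "U m i = (of_real (B (e m) (f i)) :: complex)" for m i
  have U: "(\<Sum>m<2 * CARD('n). U m i * cnj (U m i')) = (if i = i' then 1 else 0)"
    if "i < 2 * CARD('n)" "i' < 2 * CARD('n)" for i i'
    using on_frame_orthogonal[OF assms(3,4) that] by (simp add: U_def flip: of_real_mult of_real_sum)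
  have a: "arr U k (2 * CARD('n)) (\<lambda>I. \<gamma> (f \<circ> I)) M = \<gamma> (e \<circ> M)" if "multi_form k \<gamma>" for \<gamma> M
    by (subst multi_form_expand[OF that assms(4), of "e \<circ> M"]) (simp add: arr_def U_def)
  show ?thesis
    using arr_inner[OF U, of k "\<lambda>I. \<alpha> (f \<circ> I)" "\<lambda>I. \<beta> (f \<circ> I)"] by (simp add: a assms)
qed

lemma form_inner_frame:
  assumes "alt_form k \<alpha>" "alt_form k \<beta>" "on_frame B e"
  shows "form_inner B k \<alpha> \<beta> = (\<Sum>I\<in>{..<k} \<rightarrow>\<^sub>E {..<2 * CARD('n)}. \<alpha> (e \<circ> I) * cnj (\<beta> (e \<circ> I))) / fact k"
  unfolding form_inner_def
  by (subst frame_independent[OF assms(1,2)[THEN alt_form_multi] on_frame_of assms(3)]) rule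

lemma form_norm_frame:
  assumes "alt_form k \<alpha>" "on_frame B e"
  shows "(form_norm B k \<alpha>)\<^sup>2 = (\<Sum>I\<in>{..<k} \<rightarrow>\<^sub>E {..<2 * CARD('n)}. (norm (\<alpha> (e \<circ> I)))\<^sup>2) / fact k"
proof -
  have "form_inner B k \<alpha> \<alpha> = (\<Sum>I\<in>{..<k} \<rightarrow>\<^sub>E {..<2 * CARD('n)}. of_real ((norm (\<alpha> (e \<circ> I)))\<^sup>2)) / fact k"
    by (simp only: form_inner_frame[OF assms(1,1,2)] complex_norm_square)
  also have "\<dots> = of_real ((\<Sum>I\<in>{..<k} \<rightarrow>\<^sub>E {..<2 * CARD('n)}. (norm (\<alpha> (e \<circ> I)))\<^sup>2) / fact k)"
    by simp
  finally show ?thesis unfolding form_norm_def by (simp only: Re_complex_of_real) (simp add: sum_nonneg)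
qed

text \<open>Multiplying all arguments by a phase c multiplies \<alpha> by
  \<open>c ^ p * cnj c ^ q\<close>, while row by row it multiplies the component at \<open>M\<close>
  by c for every holomorphic index and by \<open>cnj c\<close> for every other one. A nonzero
  component forces the two factors to agree for all c.\<close>

lemma arr_type:
  assumes \<alpha>: "alt_form (p + q) \<alpha>" "pq_rot p q \<alpha>" and e: "on_frame B e"
    and M: "M \<in> {..<p + q} \<rightarrow>\<^sub>E {..<2 * CARD('n)}"
    and nz: "arr (umat \<epsilon> e) (p + q) (2 * CARD('n)) (\<lambda>I. \<alpha> (e \<circ> I)) M \<noteq> 0"
  shows "card {j. j < p + q \<and> M j < CARD('n)} = p"
proof (rule unit_phase_power_eq)
  let ?k = "p + q" and ?N = "2 * CARD('n)" and ?U = "umat \<epsilon> e"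
  let ?X = "{..<?k} \<rightarrow>\<^sub>E {..<?N}" and ?J = "{j. j < ?k \<and> M j < CARD('n)}"
  have J: "?J \<subseteq> {..<?k}" "finite ?J" by auto
  show "card ?J \<le> p + q" using card_mono[OF _ J(1)] by simp
  fix c :: complex assume c: "norm c = 1"
  let ?F = "arr ?U ?k ?N (\<lambda>I. \<alpha> (e \<circ> I)) M"
  have "c ^ p * cnj c ^ q * ?F = (\<Sum>I\<in>?X. (\<Prod>j<?k. ?U (M j) (I j)) * \<alpha> (\<lambda>j. c *s (e \<circ> I) j))"
    using \<alpha>(2) c by (simp add: arr_def sum_distrib_left pq_rot_def mult_ac o_def)
  also have "\<dots> = (\<Sum>I\<in>?X. \<Sum>L\<in>?X. (\<Prod>j<?k. ?U (M j) (I j) * of_real (B (c *s e (I j)) (e (L j)))) * \<alpha> (e \<circ> L))"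
    by (subst alt_form_expand[OF \<alpha>(1) e]) (simp add: sum_distrib_left prod.distrib mult_ac)
  also have "\<dots> = (\<Sum>L\<in>?X. (\<Sum>I\<in>?X. \<Prod>j<?k. ?U (M j) (I j) * of_real (B (c *s e (I j)) (e (L j)))) * \<alpha> (e \<circ> L))"
    by (subst sum.swap) (simp add: sum_distrib_right)
  also have "\<dots> = (\<Sum>L\<in>?X. (\<Prod>j<?k. (if M j < CARD('n) then c else cnj c) * ?U (M j) (L j)) * \<alpha> (e \<circ> L))"
  proof (rule sum.cong[OF refl])
    fix L assume L: "L \<in> ?X"
    have "(\<Sum>I\<in>?X. \<Prod>j<?k. ?U (M j) (I j) * of_real (B (c *s e (I j)) (e (L j))))
      = (\<Prod>j<?k. \<Sum>i<?N. ?U (M j) i * of_real (B (c *s e i) (e (L j))))"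
      by (rule sum_prod_PiE[of "\<lambda>j i. ?U (M j) i * of_real (B (c *s e i) (e (L j)))"])
    also have "\<dots> = (\<Prod>j<?k. (if M j < CARD('n) then c else cnj c) * ?U (M j) (L j))"
      by (intro prod.cong refl umat_rotate[OF e]) (use L M in \<open>auto simp: PiE_iff\<close>)
    finally show "(\<Sum>I\<in>?X. \<Prod>j<?k. ?U (M j) (I j) * of_real (B (c *s e (I j)) (e (L j)))) * \<alpha> (e \<circ> L)
      = (\<Prod>j<?k. (if M j < CARD('n) then c else cnj c) * ?U (M j) (L j)) * \<alpha> (e \<circ> L)" by simp
  qed
  also have "\<dots> = (\<Prod>j<?k. if M j < CARD('n) then c else cnj c) * ?F"
    by (simp add: arr_def prod.distrib sum_distrib_left mult.assoc)
  also have "(\<Prod>j<?k. if M j < CARD('n) then c else cnj c) = c ^ card ?J * cnj c ^ (?k - card ?J)"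
  proof -
    have "{..<?k} \<inter> {j. M j < CARD('n)} = ?J" by auto
    moreover have "{..<?k} \<inter> - {j. M j < CARD('n)} = {..<?k} - ?J" by auto
    moreover have "card ({..<?k} - ?J) = ?k - card ?J" using card_Diff_subset[OF J(2,1)] by simp
    ultimately show ?thesis by (simp add: prod.If_cases)
  qed
  finally show "c ^ card ?J * cnj c ^ (?k - card ?J) = c ^ p * cnj c ^ q" using nz by (auto simp: o_def)
qed

lemma pq_rot_sum:
  "(\<And>i. i \<in> A \<Longrightarrow> pq_rot p q (\<alpha> i)) \<Longrightarrow> pq_rot p q (\<lambda>v. \<Sum>i\<in>A. c i * \<alpha> i v)"
  unfolding pq_rot_def by (auto simp: sum_distrib_left mult_ac intro!: sum.cong)

theorem kato_pointwise:
  fixes T :: "complex^'n \<Rightarrow> 'n cform"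
  assumes k: "k = p + q" and pq: "p \<le> CARD('n)" "q \<le> CARD('n)"
    and W: "alt_form k W" "pq_rot p q W"
    and T: "\<And>x. alt_form k (T x)" "\<And>x. pq_rot p q (T x)" and T_lin: "\<And>v. linear (\<lambda>x. T x v)"
    and closed: "\<And>x v. T x v = (\<Sum>j<k. T (v j) (v(j := x)))"
    and coclosed: "\<And>j v. j < k \<Longrightarrow> (\<Sum>i<2 * CARD('n). T (fr i) (v(j := fr i))) = 0"
    and u: "B u u = 1"
  shows "(norm (\<Sum>I\<in>{..<k} \<rightarrow>\<^sub>E {..<2 * CARD('n)}. T u (fr \<circ> I) * cnj (W (fr \<circ> I))))\<^sup>2
    \<le> min (kato_const CARD('n) p) (kato_const CARD('n) q)
      * (\<Sum>i<2 * CARD('n). \<Sum>I\<in>{..<k} \<rightarrow>\<^sub>E {..<2 * CARD('n)}. (norm (T (fr i) (fr \<circ> I)))\<^sup>2)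
      * (\<Sum>I\<in>{..<k} \<rightarrow>\<^sub>E {..<2 * CARD('n)}. (norm (W (fr \<circ> I)))\<^sup>2)"
proof -
  let ?n = "CARD('n)" and ?N = "2 * CARD('n)"
  let ?X = "{..<k} \<rightarrow>\<^sub>E {..<?N}"
  obtain \<epsilon> where \<epsilon>: "\<epsilon> 0 = u" "unitary_frame ?n \<epsilon>" using unitary_frame_exists[OF u] by blast
  let ?U = "umat \<epsilon> fr"
  note U = umat_unitary[OF \<epsilon>(2) on_frame_of]
  define A where "A = arr ?U k ?N"
  define W' where "W' = A (\<lambda>I. W (fr \<circ> I))"
  define T' where "T' m M = (\<Sum>i<?N. ?U m i * A (\<lambda>I. T (fr i) (fr \<circ> I)) M)" for m M
  \<comment> \<open>\<open>T'\<close> transforms all slots at once, \<open>T2 m\<close> only the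
    derivative slot. The latter is again an alternating form of type (p, q), so the statements on
    types and repeated indices apply to it.\<close>
  define T2 where "T2 m v = (\<Sum>i<?N. ?U m i * T (fr i) v)" for m v
  have T'_eq: "T' m M = A (\<lambda>I. T2 m (fr \<circ> I)) M" for m M
    unfolding T'_def T2_def A_def by (rule arr_sum[symmetric])
  have T2: "alt_form k (T2 m)" "pq_rot p q (T2 m)" for m
    unfolding T2_def using T by (auto intro!: alt_form_sum alt_form_scale pq_rot_sum)
  have inj: "inj_on M {..<k}" if "A (\<lambda>I. \<gamma> (fr \<circ> I)) M \<noteq> 0" "alt_form k \<gamma>" for \<gamma> M
  proof (rule inj_onI, rule ccontr)
    fix a b assume ab: "a \<in> {..<k}" "b \<in> {..<k}" "M a = M b" "a \<noteq> b"
    have "\<gamma> (fr \<circ> (I \<circ> Transposition.transpose a b)) = - \<gamma> (fr \<circ> I)" for I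
      using alt_form_transpose[OF that(2), of a b "fr \<circ> I"] ab by (simp add: o_assoc)
    then have "A (\<lambda>I. \<gamma> (fr \<circ> I)) M = 0" unfolding A_def
      by (intro arr_alternating[where a=a and b=b]) (use ab in simp_all)
    then show False using that by simp
  qed
  have type: "card {j. j < k \<and> M j < ?n} = p" if "M \<in> ?X" "A (\<lambda>I. \<gamma> (fr \<circ> I)) M \<noteq> 0" "alt_form k \<gamma>" "pq_rot p q \<gamma>" for \<gamma> M
    using arr_type[OF _ that(4) on_frame_of, of M \<epsilon>] that by (simp add: A_def k)
  have type': "card {j. j < k \<and> M j \<in> {?n..<?N}} = q" if "M \<in> ?X" "card {j. j < k \<and> M j < ?n} = p" for M
  proof -
    have "{j. j < k \<and> M j \<in> {?n..<?N}} = {..<k} - {j. j < k \<and> M j < ?n}"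
      using that(1) by (auto simp: PiE_iff)
    moreover have "card ({..<k} - {j. j < k \<and> M j < ?n}) = k - p"
      using that(2) card_Diff_subset[of "{j. j < k \<and> M j < ?n}" "{..<k}"] by auto
    ultimately show ?thesis using k by simp
  qed
  have closed': "T' m M = (\<Sum>j<k. T' (M j) (M(j := m)))" for m M
    unfolding T'_def A_def
  proof (rule arr_closed)
    fix I i assume "I \<in> ?X" "i < ?N"
    show "T (fr i) (fr \<circ> I) = (\<Sum>j<k. T (fr (I j)) (fr \<circ> I(j := i)))"
      using closed[of "fr i" "fr \<circ> I"] by (simp add: fun_upd_comp)
  qed
  have coclosed': "(\<Sum>m<?N. T' (cbar m) (M(j := m))) = 0" if "j < k" for M j
  proof -
    have "(\<Sum>m<?N. T' (cbar m) (M(j := m)))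
      = (\<Sum>m<?N. \<Sum>i<?N. cnj (?U m i) * arr ?U k ?N (\<lambda>I. T (fr i) (fr \<circ> I)) (M(j := m)))"
      unfolding T'_def A_def by (intro sum.cong refl) (simp add: umat_cbar)
    also have "\<dots> = 0"
    proof (rule arr_coclosed[OF U _ that])
      fix I
      show "(\<Sum>i<?N. T (fr i) (fr \<circ> I(j := i))) = 0"
        using coclosed[OF that, of "fr \<circ> I"] by (simp add: fun_upd_comp)
    qed
    finally show ?thesis .
  qed
  have cbar_lt: "cbar m < ?N" if "m < ?N" for m using that by (auto simp: cbar_def)
  \<comment> \<open>Coclosedness gives the trace over all 2n indices, the array inequality asks for
    the part over \<open>H\<close>. Putting an index of \<open>H\<close> or one outside it into slot
    j yields counts that differ by one, so at most one of the two parts has nonzero terms, and each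
    part vanishes.\<close>
  have coclosed_H: "(\<Sum>m\<in>H. T' (cbar m) (M(j := m))) = 0"
    if M: "M \<in> ?X" and j: "j < k" and H: "H \<subseteq> {..<?N}"
      and ty: "\<And>m M. M \<in> ?X \<Longrightarrow> m < ?N \<Longrightarrow> T' m M \<noteq> 0 \<Longrightarrow> card {j. j < k \<and> M j \<in> H} = r" for M j H r
  proof -
    define c where "c = card {l. l < k \<and> l \<noteq> j \<and> M l \<in> H}"
    have inH: "card {l. l < k \<and> (M(j := m)) l \<in> H} = Suc c" if "m \<in> H" for m
    proof -
      have "{l. l < k \<and> (M(j := m)) l \<in> H} = insert j {l. l < k \<and> l \<noteq> j \<and> M l \<in> H}" using that j by auto
      then show ?thesis by (simp add: c_def)
    qed
    have notinH: "card {l. l < k \<and> (M(j := m)) l \<in> H} = c" if "m \<notin> H" for m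
    proof -
      have "{l. l < k \<and> (M(j := m)) l \<in> H} = {l. l < k \<and> l \<noteq> j \<and> M l \<in> H}" using that j by auto
      then show ?thesis by (simp add: c_def)
    qed
    have upd: "M(j := m) \<in> ?X" if "m < ?N" for m using M j that by (auto simp: PiE_iff extensional_def)
    show ?thesis
    proof (cases "Suc c = r")
      case True
      have "(\<Sum>m\<in>H. T' (cbar m) (M(j := m))) = (\<Sum>m<?N. T' (cbar m) (M(j := m)))"
      proof (rule sum.mono_neutral_left)
        show "\<forall>m\<in>{..<?N} - H. T' (cbar m) (M(j := m)) = 0"
          using ty[OF upd cbar_lt] notinH True by fastforce
      qed (use H in auto)
      then show ?thesis using coclosed'[OF j] by simp
    next
      case False
      have "T' (cbar m) (M(j := m)) = 0" if "m \<in> H" for m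
        using ty[OF upd[of m] cbar_lt[of m]] inH[OF that] False that H by auto
      then show ?thesis by simp
    qed
  qed
  let ?S = "\<Sum>I\<in>?X. T u (fr \<circ> I) * cnj (W (fr \<circ> I))"
  let ?TT = "\<Sum>i<?N. \<Sum>I\<in>?X. (norm (T (fr i) (fr \<circ> I)))\<^sup>2" and ?WW = "\<Sum>I\<in>?X. (norm (W (fr \<circ> I)))\<^sup>2"
  have TT: "(\<Sum>m<?N. \<Sum>I\<in>?X. (norm (T' m I))\<^sup>2) = ?TT"
    unfolding T'_def A_def by (rule arr_T_norm[OF U])
  have WW: "(\<Sum>I\<in>?X. (norm (W' I))\<^sup>2) = ?WW"
    unfolding W'_def A_def by (rule arr_norm[OF U])
  have S: "(\<Sum>I\<in>?X. T' 0 I * cnj (W' I)) + (\<Sum>I\<in>?X. T' (cbar 0) I * cnj (W' I)) = of_real (sqrt 2) * ?S"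
  proof -
    have Tu: "T2 0 v + T2 (cbar 0) v = of_real (sqrt 2) * T u v" for v
    proof -
      have "T2 0 v + T2 (cbar 0) v = (\<Sum>i<?N. (?U 0 i + ?U (cbar 0) i) * T (fr i) v)"
        by (simp add: T2_def sum.distrib algebra_simps)
      also have "\<dots> = of_real (sqrt 2) * (\<Sum>i<?N. B u (fr i) *\<^sub>R T (fr i) v)"
        unfolding umat_real_part \<epsilon>(1) sum_distrib_left
        by (intro sum.cong refl) (simp add: scaleR_conv_of_real)
      also have "(\<Sum>i<?N. B u (fr i) *\<^sub>R T (fr i) v) = T u v"
        using onfam_expand_linear[OF fr_onfam T_lin, of u v] by (simp add: mult.commute)
      finally show ?thesis .
    qed
    have "(\<Sum>I\<in>?X. T' 0 I * cnj (W' I)) + (\<Sum>I\<in>?X. T' (cbar 0) I * cnj (W' I))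
      = (\<Sum>I\<in>?X. T2 0 (fr \<circ> I) * cnj (W (fr \<circ> I))) + (\<Sum>I\<in>?X. T2 (cbar 0) (fr \<circ> I) * cnj (W (fr \<circ> I)))"
      unfolding T'_eq W'_def A_def by (simp only: arr_inner[OF U])
    also have "\<dots> = (\<Sum>I\<in>?X. (T2 0 (fr \<circ> I) + T2 (cbar 0) (fr \<circ> I)) * cnj (W (fr \<circ> I)))"
      by (simp add: sum.distrib algebra_simps)
    finally show ?thesis by (simp only: Tu sum_distrib_left mult.assoc)
  qed
  have S2: "(norm (of_real (sqrt 2) * ?S))\<^sup>2 = 2 * (norm ?S)\<^sup>2"
    by (simp add: norm_mult power_mult_distrib)
  have T'_inj: "inj_on M {..<k}" if "T' m M \<noteq> 0" for m M using inj[OF _ T2(1)] that T'_eq by metis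
  have T'_type: "card {j. j < k \<and> M j < ?n} = p" if "M \<in> ?X" "T' m M \<noteq> 0" for m M
    using type[OF that(1) _ T2] that(2) T'_eq by metis
  have W'_inj: "inj_on M {..<k}" if "W' M \<noteq> 0" for M using inj[OF _ W(1)] that W'_def by metis
  have W'_type: "card {j. j < k \<and> M j < ?n} = p" if "M \<in> ?X" "W' M \<noteq> 0" for M
    using type[OF that(1) _ W] that(2) W'_def by metis
  interpret a: kato_array "{..<?N}" "{..<?n}" cbar k p W' T' 0
  proof
    show "bij_betw cbar {..<?n} ({..<?N} - {..<?n})"
      by (rule bij_betw_byWitness[where f'=cbar]) (auto simp: cbar_def)
    show "(\<Sum>m\<in>{..<?n}. T' (cbar m) (I(j := m))) = 0" if "I \<in> ?X" "j < k" for I j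
      by (rule coclosed_H[OF that, where r=p]) (use T'_type in auto)
    show "T' m I = (\<Sum>j<k. T' (I j) (I(j := m)))" for m I by (rule closed')
  qed (use pq W'_inj W'_type T'_inj T'_type in auto)
  \<comment> \<open>The conjugate indices now act as the holomorphic ones and q as p. The
    distinguished index is n, the conjugate of 0, so the left side is the same pairing.\<close>
  interpret b: kato_array "{..<?N}" "{?n..<?N}" cbar k q W' T' ?n
  proof
    show "bij_betw cbar {?n..<?N} ({..<?N} - {?n..<?N})"
      by (rule bij_betw_byWitness[where f'=cbar]) (auto simp: cbar_def)
    show "(\<Sum>m\<in>{?n..<?N}. T' (cbar m) (I(j := m))) = 0" if "I \<in> ?X" "j < k" for I j
      by (rule coclosed_H[OF that, where r=q]) (use T'_type type' in auto)
    show "T' m I = (\<Sum>j<k. T' (I j) (I(j := m)))" for m I by (rule closed')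
  qed (use pq W'_inj W'_type T'_inj T'_type type' in auto)
  have c0: "cbar 0 = ?n" "cbar ?n = 0" by (auto simp: cbar_def)
  have "2 * (norm ?S)\<^sup>2 \<le> 2 * kato_const ?n p * ?TT * ?WW"
    using a.kato_array_inequality by (simp only: S S2 TT WW card_lessThan)
  moreover have "2 * (norm ?S)\<^sup>2 \<le> 2 * kato_const ?n q * ?TT * ?WW"
    using b.kato_array_inequality unfolding c0
    by (simp only: S[unfolded c0, symmetric] add.commute flip: S2 TT WW) simp
  ultimately show ?thesis by (simp add: min_def mult.assoc)
qed

end

section \<open>Forms of bidegree \<open>(p, q)\<close>\<close>

lemma complex_linear_imp_linear:
  assumes "Vector_Spaces.linear (*s) (*) (f :: complex^'n \<Rightarrow> complex)"
  shows "linear f"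
proof -
  interpret Vector_Spaces.linear "(*s)" "(*)" f by (rule assms)
  show ?thesis
  proof (rule linearI)
    fix r and x :: "complex^'n"
    have "r *\<^sub>R x = of_real r *s x" by (simp add: vec_eq_iff scaleR_conv_of_real[symmetric])
    then show "f (r *\<^sub>R x) = r *\<^sub>R f x" by (simp add: scale scaleR_conv_of_real)
  qed (rule add)
qed

lemma cnj_complex_linear_imp_linear:
  assumes "Vector_Spaces.linear (*s) (*) (cnj \<circ> f :: complex^'n \<Rightarrow> complex)"
  shows "linear f"
  using linear_compose[OF complex_linear_imp_linear[OF assms] bounded_linear.linear[OF bounded_linear_cnj]]
  by (simp add: o_def)

lemma alt_form_wedge:
  fixes l :: "nat \<Rightarrow> complex^'n::finite \<Rightarrow> complex"
  assumes l: "\<And>i. i < k \<Longrightarrow> linear (l i)"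
  shows "alt_form k (wedge k l)"
  unfolding alt_form_def
proof (intro conjI allI impI)
  fix v w :: "nat \<Rightarrow> complex^'n" assume vw: "\<forall>i<k. v i = w i"
  have "(\<Prod>i<k. l i (v (\<sigma> i))) = (\<Prod>i<k. l i (w (\<sigma> i)))" if "\<sigma> permutes {..<k}" for \<sigma>
    using vw permutes_in_image[OF that] by (intro prod.cong refl) auto
  then show "wedge k l v = wedge k l w"
    unfolding wedge_def by (intro sum.cong refl) simp
next
  fix j and v :: "nat \<Rightarrow> complex^'n" assume j: "j < k"
  have "linear (\<lambda>x. of_int (sign \<sigma>) * (\<Prod>i<k. l i ((v(j := x)) (\<sigma> i))))" if \<sigma>: "\<sigma> permutes {..<k}" for \<sigma>
  proof -
    \<comment> \<open>The factor that sees slot j is the one at \<open>i0\<close>; linearity is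
      inherited from it.\<close>
    define i0 where "i0 = inv \<sigma> j"
    have i0: "i0 < k" "\<sigma> i0 = j" using \<sigma> j permutes_in_image[OF permutes_inv[OF \<sigma>]] permutes_inverses[OF \<sigma>]
      by (auto simp: i0_def)
    have ne: "\<sigma> i \<noteq> j" if "i \<noteq> i0" for i using that i0 permutes_inj[OF \<sigma>] by (auto dest: injD)
    have "(\<Prod>i<k. l i ((v(j := x)) (\<sigma> i))) = l i0 x * (\<Prod>i\<in>{..<k} - {i0}. l i (v (\<sigma> i)))" for x
      using i0 by (subst prod.remove[of _ i0]) (auto simp: ne intro!: prod.cong)
    then have "(\<lambda>x. of_int (sign \<sigma>) * (\<Prod>i<k. l i ((v(j := x)) (\<sigma> i))))
      = (\<lambda>x. (of_int (sign \<sigma>) * (\<Prod>i\<in>{..<k} - {i0}. l i (v (\<sigma> i)))) * l i0 x)"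
      by (simp add: mult_ac)
    then show ?thesis
      using linear_compose[OF l[OF i0(1)] bounded_linear.linear[OF bounded_linear_mult_right]] by (simp add: o_def)
  qed
  then show "linear (\<lambda>x. wedge k l (v(j := x)))"
    unfolding wedge_def by (intro linear_compose_sum) auto
next
  fix \<tau> and v :: "nat \<Rightarrow> complex^'n" assume \<tau>: "\<tau> permutes {..<k}"
  have "of_int (sign \<tau>) * wedge k l v
      = of_int (sign \<tau>) * (\<Sum>\<sigma> | \<sigma> permutes {..<k}. of_int (sign (\<tau> \<circ> \<sigma>)) * (\<Prod>i<k. l i (v ((\<tau> \<circ> \<sigma>) i))))"
    unfolding wedge_def by (subst setum_permutations_compose_left[OF \<tau>]) (simp add: o_def)
  also have "\<dots> = (\<Sum>\<sigma> | \<sigma> permutes {..<k}. of_int (sign \<sigma>) * (\<Prod>i<k. l i ((v \<circ> \<tau>) (\<sigma> i))))"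
    unfolding sum_distrib_left
  proof (rule sum.cong[OF refl])
    fix \<sigma> assume \<sigma>: "\<sigma> \<in> {\<sigma>. \<sigma> permutes {..<k}}"
    have pe: "permutation \<tau>" "permutation \<sigma>" using \<sigma> \<tau> by (auto simp: permutation_permutes)
    have "of_int (sign \<tau>) * of_int (sign (\<tau> \<circ> \<sigma>)) = (of_int (sign \<sigma>) :: complex)"
      by (simp add: sign_compose[OF pe] mult.assoc[symmetric] flip: of_int_mult)
    then show "of_int (sign \<tau>) * (of_int (sign (\<tau> \<circ> \<sigma>)) * (\<Prod>i<k. l i (v ((\<tau> \<circ> \<sigma>) i))))
      = of_int (sign \<sigma>) * (\<Prod>i<k. l i ((v \<circ> \<tau>) (\<sigma> i)))"
      by (simp add: mult.assoc[symmetric])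
  qed
  finally show "wedge k l (v \<circ> \<tau>) = of_int (sign \<tau>) * wedge k l v" by (simp add: wedge_def)
qed

lemma pq_rot_wedge:
  fixes l :: "nat \<Rightarrow> complex^'n::finite \<Rightarrow> complex"
  assumes l1: "\<And>i. i < p \<Longrightarrow> Vector_Spaces.linear (*s) (*) (l i)"
    and l2: "\<And>i. i \<in> {p..<p + q} \<Longrightarrow> Vector_Spaces.linear (*s) (*) (cnj \<circ> l i)"
  shows "pq_rot p q (wedge (p + q) l)"
  unfolding pq_rot_def
proof (intro allI impI)
  fix c :: complex and v :: "nat \<Rightarrow> complex^'n"
  have "(\<Prod>i<p + q. l i (c *s v (\<sigma> i))) = c ^ p * cnj c ^ q * (\<Prod>i<p + q. l i (v (\<sigma> i)))" for \<sigma>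
  proof -
    have 1: "l i (c *s x) = c * l i x" if "i < p" for i x
    proof -
      interpret Vector_Spaces.linear "(*s)" "(*)" "l i" by (rule l1[OF that])
      show ?thesis by (rule scale)
    qed
    have 2: "l i (c *s x) = cnj c * l i x" if "i \<in> {p..<p + q}" for i x
    proof -
      interpret Vector_Spaces.linear "(*s)" "(*)" "cnj \<circ> l i" by (rule l2[OF that])
      show ?thesis using scale[of c x] by (metis complex_cnj_cnj complex_cnj_mult o_apply)
    qed
    have sp: "(\<Prod>i<p + q. f i) = (\<Prod>i<p. f i) * (\<Prod>i\<in>{p..<p + q}. f i)" for f :: "nat \<Rightarrow> complex"
      by (metis le_add1 lessThan_atLeast0 prod.atLeastLessThan_concat zero_le)
    show ?thesis unfolding sp by (simp add: 1 2 prod.distrib)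
  qed
  then show "wedge (p + q) l (\<lambda>j. c *s v j) = c ^ p * cnj c ^ q * wedge (p + q) l v"
    by (simp add: wedge_def sum_distrib_left mult_ac)
qed

lemma pq_form_alt_form: assumes "pq_form p q \<alpha>" shows "alt_form (p + q) \<alpha>"
proof -
  obtain N c l where l1: "\<forall>j<(N::nat). (\<forall>i<p. Vector_Spaces.linear (*s) (*) (l j i)) \<and>
      (\<forall>i\<in>{p..<p+q}. Vector_Spaces.linear (*s) (*) (cnj \<circ> l j i))"
    and \<alpha>: "\<alpha> = (\<lambda>v. \<Sum>j<N. c j * wedge (p + q) (l j) v)"
    using assms unfolding pq_form_def by blast
  have "linear (l j i)" if "j < N" "i < p + q" for j i
    using l1 that by (cases "i < p") (auto intro: complex_linear_imp_linear cnj_complex_linear_imp_linear)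
  then show ?thesis unfolding \<alpha> by (intro alt_form_sum alt_form_scale alt_form_wedge) auto
qed

lemma pq_form_pq_rot: assumes "pq_form p q \<alpha>" shows "pq_rot p q \<alpha>"
proof -
  obtain N c l where l1: "\<forall>j<(N::nat). (\<forall>i<p. Vector_Spaces.linear (*s) (*) (l j i)) \<and>
      (\<forall>i\<in>{p..<p+q}. Vector_Spaces.linear (*s) (*) (cnj \<circ> l j i))"
    and \<alpha>: "\<alpha> = (\<lambda>v. \<Sum>j<N. c j * wedge (p + q) (l j) v)"
    using assms unfolding pq_form_def by blast
  have "pq_rot p q (wedge (p + q) (l j))" if "j < N" for j
    using l1 that by (intro pq_rot_wedge) auto
  then show ?thesis unfolding \<alpha> pq_rot_def by (auto simp: sum_distrib_left mult_ac intro!: sum.cong)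
qed

text \<open>\<open>v \<circ> cyc j\<close> moves the \<open>j\<close>-th entry of \<open>v\<close> to the front.\<close>

definition cyc :: "nat \<Rightarrow> nat \<Rightarrow> nat" where
  "cyc j i = (if i = 0 then j else if i \<le> j then i - 1 else i)"

lemma cyc_Suc: "cyc (Suc j) = Transposition.transpose j (Suc j) \<circ> cyc j"
  by (rule ext) (auto simp: cyc_def Transposition.transpose_def)

lemma cyc_permutes: "j < k \<Longrightarrow> cyc j permutes {..<k}"
proof (induction j)
  case 0
  have "cyc 0 = id" by (auto simp: cyc_def)
  then show ?case by (simp add: permutes_def)
next
  case (Suc j)
  then show ?case unfolding cyc_Suc by (intro permutes_compose permutes_swap_id) auto
qed

lemma sign_cyc: "sign (cyc j) = (- 1) ^ j"
proof (induction j)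
  case 0
  have "cyc 0 = id" by (auto simp: cyc_def)
  then show ?case by simp
next
  case (Suc j)
  have "permutation (cyc j)" using cyc_permutes[of j "Suc j"] by (auto simp: permutation_permutes)
  then show ?case unfolding cyc_Suc using Suc
    by (subst sign_compose) (auto simp: permutation_swap_id sign_swap_id)
qed

lemma alt_form_cyc: "alt_form k \<alpha> \<Longrightarrow> j < k \<Longrightarrow> \<alpha> (v \<circ> cyc j) = (- 1) ^ j * \<alpha> v"
  using alt_form_permutes[OF _ cyc_permutes, of k \<alpha> j v] by (simp add: sign_cyc)

text \<open>The alternating sum defining d, at the sequence x, v 0, v 1, ..., starts with
  \<open>D x v\<close>. In every other term x stands in front and \<open>v j\<close> is the
  direction; moving x into the vacated slot j costs the sign of a cycle, which cancels the
  alternating sign up to a minus.\<close>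

lemma closed_slot_form:
  assumes D: "\<And>u. alt_form k (D u)"
    and d0: "\<And>v. (\<Sum>i\<le>k. (-1) ^ i * D (v i) (\<lambda>j. v (if j < i then j else Suc j))) = 0"
  shows "D x v = (\<Sum>j<k. D (v j) (v(j := x)))"
proof -
  let ?w = "case_nat x v"
  have "(\<lambda>s. ?w (if s < Suc j then s else Suc s)) = (v(j := x)) \<circ> cyc j" for j
    by (rule ext) (auto simp: cyc_def split: nat.split)
  then have "D (?w (Suc j)) (\<lambda>s. ?w (if s < Suc j then s else Suc s)) = (-1) ^ j * D (v j) (v(j := x))" if "j < k" for j
    using alt_form_cyc[OF D that] by simp
  moreover have "(\<Sum>i\<le>k. (-1) ^ i * D (?w i) (\<lambda>j. ?w (if j < i then j else Suc j)))
     = D x v + (\<Sum>j<k. (-1) ^ Suc j * D (?w (Suc j)) (\<lambda>s. ?w (if s < Suc j then s else Suc s)))"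
    by (subst sum.atMost_shift) simp
  ultimately have "D x v + (\<Sum>j<k. (-1) ^ Suc j * ((-1) ^ j * D (v j) (v(j := x)))) = 0"
    using d0[of ?w] by simp
  moreover have "(-1) ^ Suc j * ((-1) ^ j * y) = - y" for j and y :: complex
    by (simp add: mult.assoc[symmetric] flip: power_add)
  ultimately show ?thesis by (simp add: sum_negf)
qed

text \<open>The derivation on forms induced by the endomorphism \<open>A\<close>. With
  \<open>A = christoffel G z u\<close> it is, up to sign, the zeroth-order part of
  \<open>nabla_form\<close>.\<close>

definition slot_deriv :: "nat \<Rightarrow> 'n::finite cform \<Rightarrow> (complex^'n \<Rightarrow> complex^'n) \<Rightarrow> 'n cform" where
  "slot_deriv k \<alpha> A v = (\<Sum>i<k. \<alpha> (v(i := A (v i))))"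

lemma alt_form_slot_deriv:
  fixes A :: "complex^'n::finite \<Rightarrow> complex^'n"
  assumes \<alpha>: "alt_form k \<alpha>" and A: "linear A"
  shows "alt_form k (slot_deriv k \<alpha> A)"
  unfolding alt_form_def
proof (intro conjI allI impI)
  fix v w :: "nat \<Rightarrow> complex^'n" assume e: "\<forall>i<k. v i = w i"
  then show "slot_deriv k \<alpha> A v = slot_deriv k \<alpha> A w"
    unfolding slot_deriv_def by (intro sum.cong refl alt_form_cong[OF \<alpha>]) auto
next
  fix j and v :: "nat \<Rightarrow> complex^'n" assume j: "j < k"
  have "linear (\<lambda>x. \<alpha> ((v(j := x))(i := A ((v(j := x)) i))))" if "i < k" for i
  proof (cases "i = j")
    case True
    then show ?thesis using linear_compose[OF A alt_form_linear[OF \<alpha> j, of v]] by (simp add: o_def)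
  next
    case False
    then show ?thesis using alt_form_linear[OF \<alpha> j, of "v(i := A (v i))"] by (simp add: fun_upd_twist)
  qed
  then show "linear (\<lambda>x. slot_deriv k \<alpha> A (v(j := x)))"
    unfolding slot_deriv_def by (intro linear_compose_sum) auto
next
  fix \<sigma> and v :: "nat \<Rightarrow> complex^'n" assume \<sigma>: "\<sigma> permutes {..<k}"
  have "(v \<circ> \<sigma>)(i := A ((v \<circ> \<sigma>) i)) = v(\<sigma> i := A (v (\<sigma> i))) \<circ> \<sigma>" for i
    using permutes_inj[OF \<sigma>] by (auto simp: fun_eq_iff dest: injD)
  then have "slot_deriv k \<alpha> A (v \<circ> \<sigma>) = (\<Sum>i<k. of_int (sign \<sigma>) * \<alpha> (v(\<sigma> i := A (v (\<sigma> i)))))"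
    by (simp add: slot_deriv_def alt_form_permutes[OF \<alpha> \<sigma>])
  also have "\<dots> = of_int (sign \<sigma>) * slot_deriv k \<alpha> A v"
    using sum.permute[OF \<sigma>, of "\<lambda>i. \<alpha> (v(i := A (v i)))"] by (simp add: slot_deriv_def sum_distrib_left o_def)
  finally show "slot_deriv k \<alpha> A (v \<circ> \<sigma>) = of_int (sign \<sigma>) * slot_deriv k \<alpha> A v" .
qed

lemma pq_rot_slot_deriv:
  assumes "pq_rot p q \<alpha>" "\<And>c x. A (c *s x) = c *s A x"
  shows "pq_rot p q (slot_deriv k \<alpha> A)"
proof -
  have "(\<lambda>j. c *s v j)(i := A (c *s v i)) = (\<lambda>j. c *s (v(i := A (v i))) j)" for c v i
    by (auto simp: assms(2))
  then have "slot_deriv k \<alpha> A (\<lambda>j. c *s v j) = (\<Sum>i<k. \<alpha> (\<lambda>j. c *s (v(i := A (v i))) j))" for c v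
    unfolding slot_deriv_def by (intro sum.cong refl arg_cong[where f=\<alpha>])
  moreover have "\<alpha> (\<lambda>j. c *s (v(i := A (v i))) j) = c ^ p * cnj c ^ q * \<alpha> (v(i := A (v i)))" if "norm c = 1" for c v i
    using assms(1) that unfolding pq_rot_def by blast
  ultimately have "slot_deriv k \<alpha> A (\<lambda>j. c *s v j) = c ^ p * cnj c ^ q * slot_deriv k \<alpha> A v" if "norm c = 1" for c v
    using that by (simp only: slot_deriv_def[of _ _ _ v] sum_distrib_left)
  then show ?thesis unfolding pq_rot_def by blast
qed

text \<open>Symmetry of \<open>G\<close> makes the connection terms cancel in pairs.\<close>

lemma closed_covariant:
  assumes \<alpha>: "alt_form k \<alpha>" and sym: "\<And>u v. G u v = G v u"
    and D: "D x v = (\<Sum>j<k. D (v j) (v(j := x)))"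
  shows "D x v - slot_deriv k \<alpha> (G x) v
    = (\<Sum>j<k. D (v j) (v(j := x)) - slot_deriv k \<alpha> (G (v j)) (v(j := x)))"
proof -
  define a where "a j m = \<alpha> ((v(j := x))(m := G (v j) ((v(j := x)) m)))" for j m
  have off: "a j m = - a m j" if "j < k" "m < k" "j \<noteq> m" for j m
  proof -
    have "(v(m := x))(j := G (v m) ((v(m := x)) j))
      = ((v(j := x))(m := G (v j) ((v(j := x)) m))) \<circ> Transposition.transpose j m"
      using that sym by (auto simp: fun_eq_iff Transposition.transpose_def)
    then show ?thesis unfolding a_def using alt_form_transpose[OF \<alpha> that] by simp
  qed
  have "(\<Sum>j<k. \<Sum>m\<in>{..<k} - {j}. a j m) = (\<Sum>j<k. \<Sum>m<k. if j = m then 0 else a j m)"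
    by (intro sum.cong refl sum.mono_neutral_cong_left) auto
  also have "\<dots> = (\<Sum>m<k. \<Sum>j<k. - (if m = j then 0 else a m j))"
  proof (subst sum.swap, intro sum.cong refl)
    fix m j assume "m \<in> {..<k}" "j \<in> {..<k}"
    then show "(if j = m then 0 else a j m) = - (if m = j then 0 else a m j)"
      using off[of j m] by simp
  qed
  also have "\<dots> = - (\<Sum>j<k. \<Sum>m<k. if j = m then 0 else a j m)"
    by (simp add: sum_negf)
  also have "(\<Sum>j<k. \<Sum>m<k. if j = m then 0 else a j m) = (\<Sum>j<k. \<Sum>m\<in>{..<k} - {j}. a j m)"
    by (intro sum.cong refl sum.mono_neutral_cong_right) auto
  finally have z: "(\<Sum>j<k. \<Sum>m\<in>{..<k} - {j}. a j m) = 0" by simp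
  have "(\<Sum>j<k. slot_deriv k \<alpha> (G (v j)) (v(j := x))) = (\<Sum>j<k. a j j + (\<Sum>m\<in>{..<k} - {j}. a j m))"
    unfolding slot_deriv_def a_def[symmetric] by (intro sum.cong refl sum.remove) auto
  also have "\<dots> = (\<Sum>j<k. a j j)" using z by (simp add: sum.distrib)
  also have "\<dots> = slot_deriv k \<alpha> (G x) v" by (simp add: slot_deriv_def sym a_def)
  finally show ?thesis using D by (simp add: sum_subtractf)
qed

section \<open>The Levi-Civita connection of a Kaehler metric\<close>

lemma smooth_on_differentiable: "smooth_on S f \<Longrightarrow> z \<in> S \<Longrightarrow> f differentiable (at z)"
  unfolding smooth_on_def using Ck_on.simps(2) by blast

lemma smooth_on_has_derivative:
  "smooth_on S f \<Longrightarrow> z \<in> S \<Longrightarrow> (f has_derivative frechet_derivative f (at z)) (at z)"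
  using smooth_on_differentiable frechet_derivative_works by blast

lemma smooth_on_continuous: "smooth_on S f \<Longrightarrow> continuous_on S f"
  unfolding smooth_on_def using Ck_on.simps(1) by blast

text \<open>The device by which symmetry, bilinearity and type conditions, valid at every point of
  an open set, pass to derivatives.\<close>

lemma has_derivative_unique_on_open:
  assumes "(f has_derivative f') (at z)" "(g has_derivative g') (at z)"
    and "open S" "z \<in> S" "\<And>y. y \<in> S \<Longrightarrow> f y = g y"
  shows "f' = g'"
  using has_derivative_unique[OF has_derivative_transform_within_open[OF assms(1,3,4,5)] assms(2)] by simp

text \<open>Smoothness of the metric is given at constant vectors. The expansion reduces its values
  at moving vectors to those, times coordinate functions.\<close>

lemma bilinear_expand_Basis:
  fixes f :: "'v::euclidean_space \<Rightarrow> 'v \<Rightarrow> real"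
  assumes "bilinear f"
  shows "f x w = (\<Sum>s\<in>Basis. \<Sum>t\<in>Basis. (x \<bullet> s) * (w \<bullet> t) * f s t)"
proof -
  have l: "linear (\<lambda>x. f x w)" and r: "linear (f s)" for w s
    using assms by (auto simp: bilinear_def)
  have "f x w = f (\<Sum>s\<in>Basis. (x \<bullet> s) *\<^sub>R s) w" by (simp only: euclidean_representation)
  also have "\<dots> = (\<Sum>s\<in>Basis. (x \<bullet> s) * f s w)"
    by (simp add: linear_sum[OF l] linear_cmul[OF l])
  also have "\<dots> = (\<Sum>s\<in>Basis. (x \<bullet> s) * f s (\<Sum>t\<in>Basis. (w \<bullet> t) *\<^sub>R t))" by (simp only: euclidean_representation)
  also have "\<dots> = (\<Sum>s\<in>Basis. \<Sum>t\<in>Basis. (x \<bullet> s) * (w \<bullet> t) * f s t)"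
    by (simp add: linear_sum[OF r] linear_cmul[OF r] sum_distrib_left mult.assoc)
  finally show ?thesis .
qed

locale kaehler_chart =
  fixes S :: "(complex^'n::finite) set" and G :: "'n rmetric"
  assumes open_S: "open S" and herm: "hermitian_metric_on S G"
    and kaehler: "\<And>z v. z \<in> S \<Longrightarrow> ext_deriv 2 (kaehler_form G) z v = 0"
begin

lemma hermitian: "z \<in> S \<Longrightarrow> hermitian_form (G z)"
  using herm unfolding hermitian_metric_on_def by unfold_locales blast+

lemma G_bilinear: "z \<in> S \<Longrightarrow> bilinear (G z)"
  using herm unfolding hermitian_metric_on_def by blast

definition dG :: "complex^'n \<Rightarrow> complex^'n \<Rightarrow> complex^'n \<Rightarrow> complex^'n \<Rightarrow> real" where
  "dG z u v w = frechet_derivative (\<lambda>y. G y v w) (at z) u"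

lemma G_smooth: "smooth_on S (\<lambda>y. G y v w)"
  using herm unfolding hermitian_metric_on_def by blast

lemma dG: "z \<in> S \<Longrightarrow> ((\<lambda>y. G y v w) has_derivative (\<lambda>u. dG z u v w)) (at z)"
  using smooth_on_has_derivative[OF G_smooth] unfolding dG_def by simp

lemma dG_linear: "z \<in> S \<Longrightarrow> linear (\<lambda>u. dG z u v w)"
  using dG has_derivative_bounded_linear bounded_linear.linear by blast

lemma dG_eqI:
  assumes "z \<in> S" "(f has_derivative f') (at z)" "\<And>y. y \<in> S \<Longrightarrow> G y v w = f y"
  shows "dG z u v w = f' u"
  using has_derivative_unique_on_open[OF dG[OF assms(1)] assms(2) open_S assms(1)] assms(3) by metis

lemma dG_sym: assumes z: "z \<in> S" shows "dG z u v w = dG z u w v"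
  using hermitian by (intro dG_eqI[OF z dG[OF z]]) (simp add: hermitian_form.axioms(1) inner_form.sym)

lemma dG_bilinear: assumes z: "z \<in> S" shows "bilinear (dG z u)"
proof -
  have r: "linear (dG z u v)" for v
  proof (rule linearI)
    fix a b show "dG z u v (a + b) = dG z u v a + dG z u v b"
      by (intro dG_eqI[OF z has_derivative_add[OF dG[OF z, of v a] dG[OF z, of v b]]])
        (simp add: bilinear_radd[OF G_bilinear])
  next
    fix r b show "dG z u v (r *\<^sub>R b) = r *\<^sub>R dG z u v b"
      by (intro dG_eqI[OF z has_derivative_scaleR_right[OF dG[OF z, of v b]]])
        (simp add: bilinear_rmul[OF G_bilinear])
  qed
  moreover have "(\<lambda>v. dG z u v w) = dG z u w" for w using dG_sym[OF z] by blast
  ultimately have "linear (\<lambda>v. dG z u v w)" for w by simp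
  with r show ?thesis by (simp add: bilinear_def)
qed

lemma dG_J: assumes z: "z \<in> S"
  shows "dG z u (\<i> *s v) (\<i> *s w) = dG z u v w" "dG z u (\<i> *s v) w = - dG z u v (\<i> *s w)"
proof -
  show "dG z u (\<i> *s v) (\<i> *s w) = dG z u v w"
    using hermitian by (intro dG_eqI[OF z dG[OF z]]) (simp add: hermitian_form.J_inv)
  show "dG z u (\<i> *s v) w = - dG z u v (\<i> *s w)"
    using hermitian_form.J_skew[OF hermitian]
    by (intro dG_eqI[OF z has_derivative_minus[OF dG[OF z]]]) simp
qed

text \<open>The Koszul formula for constant vector fields, whose brackets vanish: the Christoffel
  symbol with its upper index lowered.\<close>

definition koszul :: "complex^'n \<Rightarrow> complex^'n \<Rightarrow> complex^'n \<Rightarrow> complex^'n \<Rightarrow> real" where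
  "koszul z u v w = (dG z u v w + dG z v u w - dG z w u v) / 2"

lemma koszul_linear:
  assumes z: "z \<in> S"
  shows "linear (\<lambda>u. koszul z u v w)" "linear (\<lambda>v. koszul z u v w)" "linear (\<lambda>w. koszul z u v w)"
proof -
  note b = dG_bilinear[OF z] and l = dG_linear[OF z]
  show "linear (\<lambda>u. koszul z u v w)" "linear (\<lambda>v. koszul z u v w)" "linear (\<lambda>w. koszul z u v w)"
    unfolding koszul_def
    by (rule linearI; simp add: linear_add[OF l] linear_cmul[OF l] bilinear_ladd[OF b] bilinear_radd[OF b]
        bilinear_lmul[OF b] bilinear_rmul[OF b] field_simps)+
qed

text \<open>\<open>christoffel\<close> is a definite description, so existence and uniqueness are
  both due. Permuting the three arguments of the metric condition forces the Koszul formula, and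
  raising its last index in an orthonormal frame produces a solution.\<close>

lemma christoffel_props:
  assumes z: "z \<in> S"
  shows "bilinear (christoffel G z)"
    and "christoffel G z u v = christoffel G z v u"
    and "dG z u v w = G z (christoffel G z u v) w + G z v (christoffel G z u w)"
    and "G z (christoffel G z u v) w = koszul z u v w"
proof -
  interpret hermitian_form "G z" by (rule hermitian[OF z])
  let ?P = "\<lambda>\<Gamma>. bilinear \<Gamma> \<and> (\<forall>u v. \<Gamma> u v = \<Gamma> v u) \<and>
        (\<forall>u v w. frechet_derivative (\<lambda>y. G y v w) (at z) u = G z (\<Gamma> u v) w + G z v (\<Gamma> u w))"
  have e: "onfam DIM(complex^'n) fr" by (rule fr_onfam)
  define \<Gamma> where "\<Gamma> u v = (\<Sum>i<DIM(complex^'n). koszul z u v (fr i) *\<^sub>R fr i)" for u v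
  have G\<Gamma>: "G z (\<Gamma> u v) w = koszul z u v w" for u v w
    unfolding \<Gamma>_def using onfam_expand_linear[OF e koszul_linear(3)[OF z, of u v], of w]
    by (simp add: B_simps sym[of _ w] mult.commute)
  have koszul_unique: "G z (\<Gamma>' u v) w = koszul z u v w" if "?P \<Gamma>'" for \<Gamma>' u v w
  proof -
    have m: "dG z u v w = G z (\<Gamma>' u v) w + G z v (\<Gamma>' u w)" for u v w using that unfolding dG_def by blast
    have s: "\<Gamma>' u v = \<Gamma>' v u" for u v using that by blast
    show ?thesis unfolding koszul_def using m[of u v w] m[of v u w] m[of w u v] s[of u v] s[of u w] s[of v w]
      sym[of v "\<Gamma>' u w"] sym[of "\<Gamma>' v w" u] sym[of "\<Gamma>' u v" w] by (simp add: sym)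
  qed
  have P: "?P \<Gamma>"
  proof (intro conjI allI)
    have ls: "linear (\<lambda>x. f x *\<^sub>R c)" if "linear f" for f :: "complex^'n \<Rightarrow> real" and c :: "complex^'n"
      using linear_compose[OF that bounded_linear.linear[OF bounded_linear_scaleR_left[of c]]] by (simp add: o_def)
    have "linear (\<lambda>u. \<Gamma> u v)" "linear (\<lambda>v. \<Gamma> u v)" for u v
      unfolding \<Gamma>_def by (intro linear_compose_sum ballI ls koszul_linear[OF z])+
    then show "bilinear \<Gamma>" by (simp add: bilinear_def)
    show "\<Gamma> u v = \<Gamma> v u" for u v
      unfolding \<Gamma>_def koszul_def using dG_sym[OF z, of _ u v] by (simp add: add.commute)
    show "frechet_derivative (\<lambda>y. G y v w) (at z) u = G z (\<Gamma> u v) w + G z v (\<Gamma> u w)" for u v w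
      unfolding dG_def[symmetric] sym[of v] G\<Gamma> koszul_def
      using dG_sym[OF z, of u v w] dG_sym[OF z, of v u w] dG_sym[OF z, of w u v] by (simp add: field_simps)
  qed
  have "christoffel G z = \<Gamma>"
    unfolding christoffel_def
  proof (rule the_equality)
    show "?P \<Gamma>" by (rule P)
    fix \<Gamma>' assume P': "?P \<Gamma>'"
    show "\<Gamma>' = \<Gamma>"
    proof (intro ext)
      fix u v show "\<Gamma>' u v = \<Gamma> u v"
        by (rule onfam_eqI[OF e]) (simp only: koszul_unique[OF P'] G\<Gamma>)
    qed
  qed
  then show "bilinear (christoffel G z)"
    and "christoffel G z u v = christoffel G z v u"
    and "dG z u v w = G z (christoffel G z u v) w + G z v (christoffel G z u w)"
    and "G z (christoffel G z u v) w = koszul z u v w"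
    using P G\<Gamma> unfolding dG_def by blast+
qed

lemma dOmega: assumes z: "z \<in> S"
  shows "dG z u (\<i> *s v) w - dG z v (\<i> *s u) w + dG z w (\<i> *s u) v = 0"
proof -
  let ?v = "\<lambda>i::nat. if i = 0 then u else if i = 1 then v else w"
  have c: "frechet_derivative (\<lambda>y. complex_of_real (G y a b)) (at z) = (\<lambda>u. complex_of_real (dG z u a b))" for a b
    by (rule frechet_derivative_at[symmetric]) (rule has_derivative_of_real[OF dG[OF z]])
  have "ext_deriv 2 (kaehler_form G) z ?v = complex_of_real
    (dG z u (\<i> *s v) w - dG z v (\<i> *s u) w + dG z w (\<i> *s u) v)"
    unfolding ext_deriv_def kaehler_form_def by (simp add: numeral_2_eq_2 c)
  from this[symmetric] kaehler[OF z, of ?v]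
  have "complex_of_real (dG z u (\<i> *s v) w - dG z v (\<i> *s u) w + dG z w (\<i> *s u) v) = 0"
    by (rule trans)
  then show ?thesis by (simp only: of_real_eq_0_iff)
qed

text \<open>This is where the Kaehler condition enters: the complex structure is parallel. It is
  constant in a holomorphic chart, so its covariant derivative consists of Christoffel terms, and by
  the Koszul formula these reduce to the exterior derivative of the Kaehler form at (u, v, w) and at
  (u, \<open>\<i> *s v\<close>, \<open>\<i> *s w\<close>).\<close>

lemma christoffel_J:
  assumes z: "z \<in> S"
  shows "christoffel G z u (\<i> *s v) = \<i> *s christoffel G z u v"
proof -
  interpret hermitian_form "G z" by (rule hermitian[OF z])
  have JJ: "\<i> *s (\<i> *s x) = - x" for x :: "complex^'n" by (simp add: vec_eq_iff)
  note b = dG_bilinear[OF z] and l = dG_linear[OF z]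
  have "G z (christoffel G z u (\<i> *s v)) w = G z (\<i> *s christoffel G z u v) w" for w
  proof -
    have "G z (\<i> *s christoffel G z u v) w = - G z (christoffel G z u v) (\<i> *s w)"
      using J_skew[of "christoffel G z u v" w] by simp
    then have "2 * (G z (christoffel G z u (\<i> *s v)) w - G z (\<i> *s christoffel G z u v) w)
       = 2 * koszul z u (\<i> *s v) w + 2 * koszul z u v (\<i> *s w)"
      using christoffel_props(4)[OF z] by simp
    also have "\<dots> = dG z (\<i> *s v) u w - dG z w u (\<i> *s v) + dG z v u (\<i> *s w) - dG z (\<i> *s w) u v"
      unfolding koszul_def using dG_J(2)[OF z, of u v w] by (simp add: field_simps)
    also have "\<dots> = 0"
      using dOmega[OF z, of u v w] dOmega[OF z, of u "\<i> *s v" "\<i> *s w"]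
        dG_J(2)[OF z, of v u w] dG_J(2)[OF z, of w u v] dG_J(2)[OF z, of u v w] dG_J(1)[OF z, of "\<i> *s v" u w]
        dG_J(1)[OF z, of "\<i> *s w" u v]
        bilinear_lneg[OF b] bilinear_rneg[OF b]
      by (simp add: JJ bilinear_lneg[OF b] bilinear_rneg[OF b])
    finally show ?thesis by simp
  qed
  then show ?thesis by (intro onfam_eqI[OF fr_onfam]) simp
qed

lemma christoffel_linear:
  assumes z: "z \<in> S" shows "linear (christoffel G z u)" "linear (\<lambda>u. christoffel G z u v)"
  using christoffel_props(1)[OF z] by (auto simp: bilinear_def)

lemma christoffel_complex_linear:
  assumes z: "z \<in> S"
  shows "christoffel G z u (c *s v) = c *s christoffel G z u v"
proof -
  have d: "c *s x = Re c *\<^sub>R x + Im c *\<^sub>R (\<i> *s x)" for x :: "complex^'n"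
    by (simp add: vec_eq_iff complex_eq_iff)
  note l = christoffel_linear(1)[OF z, of u]
  show ?thesis unfolding d by (simp add: linear_add[OF l] linear_cmul[OF l] christoffel_J[OF z])
qed

end

section \<open>Orthonormal frames parallel at a point\<close>

context kaehler_chart
begin

lemma metric_has_derivative:
  assumes z: "z \<in> S" and a: "(a has_derivative a') (at z)" and b: "(b has_derivative b') (at z)"
  shows "((\<lambda>y. G y (a y) (b y)) has_derivative
    (\<lambda>u. dG z u (a z) (b z) + G z (a' u) (b z) + G z (a z) (b' u))) (at z)"
proof -
  have "((\<lambda>y. \<Sum>s\<in>Basis. \<Sum>t\<in>Basis. (a y \<bullet> s) * (b y \<bullet> t) * G y s t) has_derivative
    (\<lambda>u. \<Sum>s\<in>Basis. \<Sum>t\<in>Basis. ((a z \<bullet> s) * (b z \<bullet> t)) * dG z u s t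
       + ((a z \<bullet> s) * (b' u \<bullet> t) + (a' u \<bullet> s) * (b z \<bullet> t)) * G z s t)) (at z)"
    by (intro has_derivative_sum has_derivative_mult has_derivative_inner_left a b dG[OF z])
  also have "(\<lambda>u. \<Sum>s\<in>Basis. \<Sum>t\<in>Basis. ((a z \<bullet> s) * (b z \<bullet> t)) * dG z u s t
       + ((a z \<bullet> s) * (b' u \<bullet> t) + (a' u \<bullet> s) * (b z \<bullet> t)) * G z s t)
    = (\<lambda>u. dG z u (a z) (b z) + G z (a' u) (b z) + G z (a z) (b' u))"
    unfolding bilinear_expand_Basis[OF dG_bilinear[OF z], of _ "a z" "b z"]
      bilinear_expand_Basis[OF G_bilinear[OF z], of "a z"] bilinear_expand_Basis[OF G_bilinear[OF z], of _ "b z"]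
    by (simp add: sum.distrib algebra_simps)
  finally show ?thesis
    by (rule has_derivative_transform_within_open[OF _ open_S z])
      (rule bilinear_expand_Basis[OF G_bilinear, symmetric])
qed

lemma metric_continuous:
  assumes "U \<subseteq> S" "continuous_on U a" "continuous_on U b"
  shows "continuous_on U (\<lambda>y. G y (a y) (b y))"
proof -
  have "continuous_on U (\<lambda>y. \<Sum>s\<in>Basis. \<Sum>t\<in>Basis. (a y \<bullet> s) * (b y \<bullet> t) * G y s t)"
    using continuous_on_subset[OF smooth_on_continuous[OF G_smooth] assms(1)]
    by (intro continuous_intros assms(2,3))
  then show ?thesis
    by (rule continuous_on_eq) (use assms in \<open>auto intro: bilinear_expand_Basis[OF G_bilinear, symmetric]\<close>)
qed

text \<open>Metric compatibility as needed for frames: two fields with values v, w and derivatives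
  given by \<open>- christoffel\<close> have an inner product with derivative zero.\<close>

lemma dG_christoffel:
  "z \<in> S \<Longrightarrow> dG z u v w + G z (- christoffel G z u v) w + G z v (- christoffel G z u w) = 0"
  using christoffel_props(3)[of z u v w] by (simp add: bilinear_lneg[OF G_bilinear] bilinear_rneg[OF G_bilinear])

text \<open>
  Gram-Schmidt applied to \<open>e i - \<Gamma>(y - z, e i)\<close>.  These fields are orthonormal to first order at \<open>z\<close>,
  so the resulting orthonormal frame is covariantly constant at \<open>z\<close>.
\<close>

lemma local_frame:
  assumes z: "z \<in> S" and e: "on_frame (G z) e"
  obtains U E where "open U" "z \<in> U" "U \<subseteq> S"
    "\<And>i. i < 2 * CARD('n) \<Longrightarrow> continuous_on U (E i)"
    "\<And>i. E i z = e i"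
    "\<And>i. i < 2 * CARD('n) \<Longrightarrow> (E i has_derivative (\<lambda>u. - christoffel G z u (e i))) (at z)"
    "\<And>y. y \<in> U \<Longrightarrow> on_frame (G y) (\<lambda>i. E i y)"
proof -
  let ?P = "\<lambda>m U E. open U \<and> z \<in> U \<and> U \<subseteq> S \<and> (\<forall>i<m. continuous_on U (E i) \<and> E i z = e i \<and>
     (E i has_derivative (\<lambda>u. - christoffel G z u (e i))) (at z)) \<and>
     (\<forall>y\<in>U. \<forall>i<m. \<forall>j<m. G y (E i y) (E j y) = (if i = j then 1 else 0))"
  have ee: "G z (e i) (e j) = (if i = j then 1 else 0)" if "i < 2 * CARD('n)" "j < 2 * CARD('n)" for i j
    using e that by (simp add: on_frame_def)
  have "\<exists>U E. ?P m U E" if "m \<le> 2 * CARD('n)" for m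
    using that
  proof (induction m)
    case 0
    have "?P 0 S E" for E using open_S z by simp
    then show ?case by blast
  next
    case (Suc m)
    then obtain U E where UE: "?P m U E" by auto
    have U: "open U" "z \<in> U" "U \<subseteq> S" using UE by auto
    have E: "continuous_on U (E i)" "E i z = e i" "(E i has_derivative (\<lambda>u. - christoffel G z u (e i))) (at z)"
      if "i < m" for i using UE that by auto
    have on: "G y (E i y) (E j y) = (if i = j then 1 else 0)" if "y \<in> U" "i < m" "j < m" for y i j
      using UE that by auto
    have m: "m < 2 * CARD('n)" using Suc by simp
    let ?\<Gamma> = "\<lambda>u. - christoffel G z u (e m)"
    define w0 where "w0 y = e m - christoffel G z (y - z) (e m)" for y
    define w where "w y = w0 y - (\<Sum>i<m. G y (w0 y) (E i y) *\<^sub>R E i y)" for y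
    define N where "N y = G y (w y) (w y)" for y
    have bl: "bounded_linear (\<lambda>u. christoffel G z u (e m))"
      using christoffel_linear(2)[OF z] linear_conv_bounded_linear by blast
    have "((\<lambda>y. y - z) has_derivative (\<lambda>u. u)) (at z)" by (auto intro!: derivative_eq_intros)
    from bounded_linear.has_derivative[OF bl this]
    have w0': "(w0 has_derivative ?\<Gamma>) (at z)"
      unfolding w0_def by (auto intro!: derivative_eq_intros)
    have w0z: "w0 z = e m" using linear_0[OF christoffel_linear(2)[OF z]] by (simp add: w0_def)
    have w0c: "continuous_on U w0" unfolding w0_def
      by (intro continuous_intros bounded_linear.continuous_on[OF bl])
    \<comment> \<open>The Gram-Schmidt coefficients vanish at z together with their derivatives, so
      the correction leaves value and derivative at z unchanged.\<close>
    have c': "((\<lambda>y. G y (w0 y) (E i y) *\<^sub>R E i y) has_derivative (\<lambda>u. 0)) (at z)" if i: "i < m" for i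
    proof -
      have "((\<lambda>y. G y (w0 y) (E i y)) has_derivative (\<lambda>u. 0)) (at z)"
        using metric_has_derivative[OF z w0' E(3)[OF i]] dG_christoffel[OF z] by (simp add: w0z E(2)[OF i])
      from has_derivative_scaleR[OF this E(3)[OF i]] show ?thesis
        using ee[of m i] m i by (simp add: w0z E(2)[OF i])
    qed
    have w': "(w has_derivative ?\<Gamma>) (at z)"
    proof -
      have "((\<lambda>y. \<Sum>i<m. G y (w0 y) (E i y) *\<^sub>R E i y) has_derivative (\<lambda>u. \<Sum>i<m. 0)) (at z)"
        by (intro has_derivative_sum c') auto
      from has_derivative_diff[OF w0' this] show ?thesis by (simp add: w_def[abs_def])
    qed
    have wz: "w z = e m"
      using ee[of m] m by (simp add: w_def w0z E(2))
    have wc: "continuous_on U w" unfolding w_def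
      by (intro continuous_intros w0c metric_continuous U E) auto
    have N': "(N has_derivative (\<lambda>u. 0)) (at z)"
      using metric_has_derivative[OF z w' w'] dG_christoffel[OF z] by (simp add: wz N_def[abs_def])
    have Nz: "N z = 1" using ee[of m m] m by (simp add: N_def wz)
    have Nc: "continuous_on U N" unfolding N_def by (intro metric_continuous U wc)
    \<comment> \<open>Normalisation needs the squared length to stay positive, so the neighbourhood
      shrinks with each vector.\<close>
    define V where "V = U \<inter> N -` {0<..}"
    have V: "open V" "z \<in> V" "V \<subseteq> U" "\<And>y. y \<in> V \<Longrightarrow> N y > 0"
      using continuous_open_preimage[OF Nc U(1), of "{0<..}"] U Nz by (auto simp: V_def)
    define F where "F y = inverse (sqrt (N y)) *\<^sub>R w y" for y
    have "((\<lambda>y. inverse (sqrt (N y))) has_derivative (\<lambda>u. 0)) (at z)"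
      using N' Nz by (auto intro!: derivative_eq_intros)
    from has_derivative_scaleR[OF this w'] have F': "(F has_derivative ?\<Gamma>) (at z)"
      by (simp add: Nz F_def[abs_def])
    have Fc: "continuous_on V F" unfolding F_def
      using V by (intro continuous_intros continuous_on_subset[OF Nc] continuous_on_subset[OF wc]) fastforce+
    have wE: "G y (w y) (E j y) = 0" "G y (E j y) (w y) = 0" if y: "y \<in> U" and j: "j < m" for y j
    proof -
      interpret hermitian_form "G y" using y U hermitian by blast
      have "G y (w y) (E j y) = G y (w0 y) (E j y) - (\<Sum>i<m. G y (w0 y) (E i y) * (if i = j then 1 else 0))"
        using y j by (simp add: w_def B_simps on)
      then show "G y (w y) (E j y) = 0" by (simp only: sum_mult_delta[OF j])
      then show "G y (E j y) (w y) = 0" using sym[of "E j y" "w y"] by simp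
    qed
    have FF: "G y (F y) (F y) = 1" if y: "y \<in> V" for y
    proof -
      interpret hermitian_form "G y" using y V U hermitian by blast
      show ?thesis using V(4)[OF y] by (simp add: F_def B_simps N_def[symmetric] field_simps)
    qed
    have FE: "G y (F y) (E j y) = 0" "G y (E j y) (F y) = 0" if y: "y \<in> V" and j: "j < m" for y j
    proof -
      have yU: "y \<in> U" using y V by auto
      interpret hermitian_form "G y" using yU U hermitian by blast
      show "G y (F y) (E j y) = 0" "G y (E j y) (F y) = 0" using wE[OF yU j] by (simp_all add: F_def B_simps)
    qed
    have "F z = e m" by (simp add: F_def Nz wz)
    then have "\<forall>i<Suc m. continuous_on V ((E(m := F)) i) \<and> (E(m := F)) i z = e i \<and>
       ((E(m := F)) i has_derivative (\<lambda>u. - christoffel G z u (e i))) (at z)"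
    proof -
      have "continuous_on V (E i)" if "i < m" for i by (rule continuous_on_subset[OF E(1)[OF that] V(3)])
      then show ?thesis using Fc F' E(2,3) \<open>F z = e m\<close> by (simp add: less_Suc_eq)
    qed
    moreover have "\<forall>y\<in>V. \<forall>i<Suc m. \<forall>j<Suc m. G y ((E(m := F)) i y) ((E(m := F)) j y) = (if i = j then 1 else 0)"
      using FF FE on V(3) by (auto simp: less_Suc_eq)
    ultimately have "?P (Suc m) V (E(m := F))" using V U by blast
    then show ?case by blast
  qed
  from this[of "2 * CARD('n)"] obtain U E where "?P (2 * CARD('n)) U E" by auto
  \<comment> \<open>Indices outside the frame get constant fields, so that
    \<open>E i z = e i\<close> holds for all i.\<close>
  then show ?thesis
    by (intro that[of U "\<lambda>i. if i < 2 * CARD('n) then E i else (\<lambda>_. e i)"]) (auto simp: on_frame_def)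
qed

end

section \<open>Differentiating forms along a frame\<close>

lemma alt_form_has_derivative:
  fixes \<omega> :: "complex^'n::finite \<Rightarrow> 'n cform"
  assumes S: "open S" "z \<in> S" and \<omega>: "\<And>y. y \<in> S \<Longrightarrow> alt_form k (\<omega> y)"
    and D: "\<And>v. ((\<lambda>y. \<omega> y v) has_derivative (\<lambda>u. D u v)) (at z)"
  shows "alt_form k (D u)"
proof -
  have eq: "D u v = f' u" if "(f has_derivative f') (at z)" "\<And>y. y \<in> S \<Longrightarrow> \<omega> y v = f y" for v f f'
    using has_derivative_unique_on_open[OF D that(1) S] that(2) by metis
  show ?thesis
    unfolding alt_form_def
  proof (intro conjI allI impI)
    fix v w :: "nat \<Rightarrow> complex^'n" assume "\<forall>i<k. v i = w i"
    then show "D u v = D u w" by (intro eq[OF D] alt_form_cong[OF \<omega>]) auto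
  next
    fix i v assume i: "i < k"
    note l = alt_form_linear[OF \<omega> i, of _ v]
    show "linear (\<lambda>x. D u (v(i := x)))"
    proof (rule linearI)
      fix a b show "D u (v(i := a + b)) = D u (v(i := a)) + D u (v(i := b))"
        by (rule eq[OF has_derivative_add[OF D D]]) (rule linear_add[OF l])
      fix r show "D u (v(i := r *\<^sub>R a)) = r *\<^sub>R D u (v(i := a))"
        by (rule eq[OF has_derivative_scaleR_right[OF D]]) (rule linear_cmul[OF l])
    qed
  next
    fix \<sigma> v assume \<sigma>: "\<sigma> permutes {..<k}"
    show "D u (v \<circ> \<sigma>) = of_int (sign \<sigma>) * D u v"
      by (rule eq[OF has_derivative_mult_right[OF D]]) (rule alt_form_permutes[OF \<omega> \<sigma>])
  qed
qed

lemma pq_rot_has_derivative: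
  fixes \<omega> :: "complex^'n::finite \<Rightarrow> 'n cform"
  assumes S: "open S" "z \<in> S" and \<omega>: "\<And>y. y \<in> S \<Longrightarrow> pq_rot p q (\<omega> y)"
    and D: "\<And>v. ((\<lambda>y. \<omega> y v) has_derivative (\<lambda>u. D u v)) (at z)"
  shows "pq_rot p q (D u)"
  unfolding pq_rot_def
proof (intro allI impI)
  fix c :: complex and v :: "nat \<Rightarrow> complex^'n" assume c: "norm c = 1"
  have "\<omega> y (\<lambda>j. c *s v j) = c ^ p * cnj c ^ q * \<omega> y v" if "y \<in> S" for y
    using \<omega>[OF that] c unfolding pq_rot_def by blast
  from has_derivative_unique_on_open[OF D has_derivative_mult_right[OF D] S this]
  show "D u (\<lambda>j. c *s v j) = c ^ p * cnj c ^ q * D u v" by (rule fun_cong)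
qed

lemma alt_form_expand_Basis:
  fixes \<alpha> :: "'n::finite cform"
  assumes "alt_form k \<alpha>"
  shows "\<alpha> w = (\<Sum>I\<in>{..<k} \<rightarrow>\<^sub>E Basis. (\<Prod>j<k. of_real (w j \<bullet> I j)) * \<alpha> I)"
  using multilinear_expand[OF alt_form_multi[OF assms], where w=w and D=Basis and r="\<lambda>j i. w j \<bullet> i" and e="\<lambda>i. i"]
  by (simp add: euclidean_representation o_def)

text \<open>Differentiability of \<omega> is given at constant vectors. In the standard basis the
  value on moving vectors is a sum of products of coordinates with such components, and the product
  rule applies.\<close>

lemma form_eval_has_derivative:
  fixes \<omega> :: "complex^'n::finite \<Rightarrow> 'n cform"
  assumes S: "open S" "z \<in> S" and \<omega>: "\<And>y. y \<in> S \<Longrightarrow> alt_form k (\<omega> y)"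
    and D: "\<And>v. ((\<lambda>y. \<omega> y v) has_derivative (\<lambda>u. D u v)) (at z)"
    and X: "\<And>j. j < k \<Longrightarrow> (X j has_derivative X' j) (at z)"
  shows "((\<lambda>y. \<omega> y (\<lambda>j. X j y)) has_derivative
    (\<lambda>u. D u (\<lambda>j. X j z) + (\<Sum>j<k. \<omega> z ((\<lambda>j. X j z)(j := X' j u))))) (at z)"
proof -
  let ?A = "{..<k} \<rightarrow>\<^sub>E (Basis :: (complex^'n) set)"
  let ?x = "\<lambda>j. X j z"
  have "((\<lambda>y. \<Sum>I\<in>?A. (\<Prod>j<k. of_real (X j y \<bullet> I j)) * \<omega> y I) has_derivative
    (\<lambda>u. \<Sum>I\<in>?A. (\<Prod>j<k. of_real (X j z \<bullet> I j)) * D u I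
       + (\<Sum>j<k. of_real (X' j u \<bullet> I j) * (\<Prod>l\<in>{..<k} - {j}. of_real (X l z \<bullet> I l))) * \<omega> z I)) (at z)"
    by (intro has_derivative_sum has_derivative_mult D has_derivative_prod has_derivative_of_real
        has_derivative_inner_left) (auto intro: X)
  also have "(\<lambda>u. \<Sum>I\<in>?A. (\<Prod>j<k. of_real (X j z \<bullet> I j)) * D u I
       + (\<Sum>j<k. of_real (X' j u \<bullet> I j) * (\<Prod>l\<in>{..<k} - {j}. of_real (X l z \<bullet> I l))) * \<omega> z I)
    = (\<lambda>u. D u ?x + (\<Sum>j<k. \<omega> z (?x(j := X' j u))))"
  proof
    fix u
    have 1: "D u ?x = (\<Sum>I\<in>?A. (\<Prod>j<k. of_real (X j z \<bullet> I j)) * D u I)"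
      by (rule alt_form_expand_Basis[OF alt_form_has_derivative[OF S \<omega> D]])
    have 2: "\<omega> z (?x(j := X' j u)) =
      (\<Sum>I\<in>?A. of_real (X' j u \<bullet> I j) * (\<Prod>l\<in>{..<k} - {j}. of_real (X l z \<bullet> I l)) * \<omega> z I)" if "j < k" for j
    proof -
      have "(\<Prod>l<k. of_real ((?x(j := X' j u)) l \<bullet> I l)) =
        (of_real (X' j u \<bullet> I j) * (\<Prod>l\<in>{..<k} - {j}. of_real (X l z \<bullet> I l)) :: complex)" for I
        using that by (subst prod.remove[of _ j]) (auto intro!: prod.cong)
      then show ?thesis by (subst alt_form_expand_Basis[OF \<omega>[OF S(2)]]) simp
    qed
    show "(\<Sum>I\<in>?A. (\<Prod>j<k. of_real (X j z \<bullet> I j)) * D u I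
       + (\<Sum>j<k. of_real (X' j u \<bullet> I j) * (\<Prod>l\<in>{..<k} - {j}. of_real (X l z \<bullet> I l))) * \<omega> z I)
      = D u ?x + (\<Sum>j<k. \<omega> z (?x(j := X' j u)))"
      unfolding 1 by (simp add: 2 sum.distrib sum_distrib_right sum.swap[of _ ?A])
  qed
  finally show ?thesis
    by (rule has_derivative_transform_within_open[OF _ S]) (rule alt_form_expand_Basis[OF \<omega>, symmetric])
qed

lemma form_eval_continuous:
  fixes \<omega> :: "complex^'n::finite \<Rightarrow> 'n cform"
  assumes \<omega>: "\<And>y. y \<in> U \<Longrightarrow> alt_form k (\<omega> y)" "\<And>v. continuous_on U (\<lambda>y. \<omega> y v)"
    and X: "\<And>j. j < k \<Longrightarrow> continuous_on U (X j)"
  shows "continuous_on U (\<lambda>y. \<omega> y (\<lambda>j. X j y))"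
proof -
  have "continuous_on U (\<lambda>y. \<Sum>I\<in>{..<k} \<rightarrow>\<^sub>E Basis. (\<Prod>j<k. complex_of_real (X j y \<bullet> I j)) * \<omega> y I)"
    by (intro continuous_intros \<omega>(2)) (auto intro: X)
  then show ?thesis
    by (rule continuous_on_eq) (rule alt_form_expand_Basis[OF \<omega>(1), symmetric])
qed

section \<open>Bump functions\<close>

text \<open>\<open>flat 0\<close> is the classical smooth function with all derivatives zero at 0.
  The powers of \<open>inverse t\<close> enlarge it to a family closed under differentiation up to
  linear combinations.\<close>

definition flat :: "nat \<Rightarrow> real \<Rightarrow> real" where
  "flat m t = (if t > 0 then exp (- inverse t) * inverse t ^ m else 0)"

lemma flat_nonneg: "flat m t \<ge> 0"
  by (simp add: flat_def)

lemma exp_neg_power_le: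
  fixes x :: real
  assumes "x > 0" "N > 0"
  shows "exp (- x) * x ^ N \<le> real N ^ N"
proof -
  have "(1 + x / real N) ^ N \<le> exp x"
    by (rule exp_ge_one_plus_x_over_n_power_n) (use assms in auto)
  moreover have "(x / real N) ^ N \<le> (1 + x / real N) ^ N"
    using assms by (intro power_mono) auto
  ultimately have "x ^ N / real N ^ N \<le> exp x" by (simp only: power_divide)
  then have "x ^ N \<le> exp x * real N ^ N" using assms by (simp add: pos_divide_le_eq)
  then have "exp (- x) * x ^ N \<le> exp (- x) * (exp x * real N ^ N)" by (intro mult_left_mono) auto
  also have "\<dots> = real N ^ N" by (simp add: exp_minus)
  finally show ?thesis .
qed

text \<open>A quadratic bound gives differentiability at 0 with derivative 0. It comes from the
  boundedness of \<open>exp (- x) * x ^ (m + 2)\<close>, at \<open>x = inverse t\<close>.\<close>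

lemma flat_bound: "flat m t \<le> real (m + 2) ^ (m + 2) * t\<^sup>2"
proof (cases "t > 0")
  case True
  then have "flat m t = (exp (- inverse t) * inverse t ^ (m + 2)) * t\<^sup>2"
    by (simp add: flat_def power_add field_simps power2_eq_square)
  also have "\<dots> \<le> real (m + 2) ^ (m + 2) * t\<^sup>2"
    using True by (intro mult_right_mono exp_neg_power_le) auto
  finally show ?thesis .
qed (simp add: flat_def)

lemma flat_2_le: "flat 2 t \<le> 4"
  using exp_neg_power_le[of "inverse t" 2] by (simp add: flat_def)

lemma flat_deriv: "(flat m has_real_derivative (flat (m + 2) t - real m * flat (m + 1) t)) (at t)"
proof -
  consider "t > 0" | "t < 0" | "t = 0" by linarith
  then show ?thesis
  proof cases
    case 1
    have i: "(inverse has_real_derivative - (inverse t ^ 2)) (at t)"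
      using DERIV_inverse[of t] 1 by (simp add: numeral_2_eq_2)
    have "((\<lambda>t. inverse t ^ m) has_real_derivative - (real m * inverse t ^ (m + 1))) (at t)"
      using DERIV_power[OF i, of m] by (cases m) (simp_all add: power2_eq_square mult_ac)
    from DERIV_mult[OF DERIV_fun_exp[OF DERIV_minus[OF i]] this]
    have "((\<lambda>t. exp (- inverse t) * inverse t ^ m) has_real_derivative (flat (m + 2) t - real m * flat (m + 1) t)) (at t)"
      using 1 by (simp add: flat_def power2_eq_square mult_ac)
    then show ?thesis
      by (rule has_field_derivative_transform_within_open[of _ _ _ "{0<..}"]) (use 1 in \<open>auto simp: flat_def\<close>)
  next
    case 2
    have "((\<lambda>t. 0) has_real_derivative (flat (m + 2) t - real m * flat (m + 1) t)) (at t)"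
      using 2 by (simp add: flat_def)
    then show ?thesis
      by (rule has_field_derivative_transform_within_open[of _ _ _ "{..<0}"]) (use 2 in \<open>auto simp: flat_def\<close>)
  next
    case 3
    define C where "C = real (m + 2) ^ (m + 2)"
    have "((\<lambda>s. (flat m s - flat m 0) / (s - 0)) \<longlongrightarrow> 0) (at 0)"
    proof (rule tendsto_0_le[where K=C])
      show "((\<lambda>s::real. s) \<longlongrightarrow> 0) (at 0)" by (rule tendsto_ident_at)
      have "norm ((flat m s - flat m 0) / (s - 0)) \<le> norm s * C" if "s \<noteq> 0" for s
      proof -
        have "flat m 0 = 0" by (simp add: flat_def)
        then have "norm ((flat m s - flat m 0) / (s - 0)) = flat m s / \<bar>s\<bar>" using flat_nonneg[of m s] by simp
        also have "\<dots> \<le> C * s\<^sup>2 / \<bar>s\<bar>" using flat_bound[of m s] unfolding C_def by (intro divide_right_mono) auto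
        also have "\<dots> = norm s * C" using that by (simp add: power2_eq_square abs_if)
        finally show ?thesis .
      qed
      then show "\<forall>\<^sub>F s in at 0. norm ((flat m s - flat m 0) / (s - 0)) \<le> norm s * C"
        by (auto simp: eventually_at_filter)
    qed
    then show ?thesis unfolding 3 by (simp add: has_field_derivative_iff flat_def)
  qed
qed

section \<open>Smoothness and size of bump functions\<close>

lemma real_polynomial_has_derivative:
  fixes P :: "'v::euclidean_space \<Rightarrow> real"
  assumes "real_polynomial_function P"
  shows "\<exists>P'. \<forall>y. (P has_derivative P' y) (at y) \<and> (\<forall>v. real_polynomial_function (\<lambda>y. P' y v))"
  using assms
proof induction
  case (linear f)
  then show ?case by (intro exI[of _ "\<lambda>_. f"]) (auto intro: bounded_linear_imp_has_derivative real_polynomial_function.intros(2))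
next
  case (const c)
  then show ?case by (intro exI[of _ "\<lambda>_ _. 0"]) (auto intro: real_polynomial_function.intros(2))
next
  case (add f g)
  then obtain f' g' where "\<forall>y. (f has_derivative f' y) (at y) \<and> (\<forall>v. real_polynomial_function (\<lambda>y. f' y v))"
    "\<forall>y. (g has_derivative g' y) (at y) \<and> (\<forall>v. real_polynomial_function (\<lambda>y. g' y v))" by blast
  then show ?case
    by (intro exI[of _ "\<lambda>y v. f' y v + g' y v"]) (auto intro: has_derivative_add real_polynomial_function.intros(3))
next
  case (mult f g)
  then obtain f' g' where "\<forall>y. (f has_derivative f' y) (at y) \<and> (\<forall>v. real_polynomial_function (\<lambda>y. f' y v))"
    "\<forall>y. (g has_derivative g' y) (at y) \<and> (\<forall>v. real_polynomial_function (\<lambda>y. g' y v))" by blast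
  then show ?case using mult.hyps
    by (intro exI[of _ "\<lambda>y v. f y * g' y v + f' y v * g y"])
      (auto intro!: has_derivative_mult real_polynomial_function.intros(3) real_polynomial_function.intros(4))
qed

text \<open>A class of functions containing the bump functions and closed under directional derivatives.\<close>

inductive flat_poly :: "('v::euclidean_space \<Rightarrow> real) \<Rightarrow> ('v \<Rightarrow> real) \<Rightarrow> bool" for r where
  mult: "real_polynomial_function P \<Longrightarrow> flat_poly r (\<lambda>y. P y * flat m (r y))"
| add: "flat_poly r f \<Longrightarrow> flat_poly r g \<Longrightarrow> flat_poly r (\<lambda>y. f y + g y)"

lemma flat_poly_has_derivative:
  assumes r: "real_polynomial_function r" and "flat_poly r f"
  shows "\<exists>f'. \<forall>y. (f has_derivative f' y) (at y) \<and> (\<forall>v. flat_poly r (\<lambda>y. f' y v))"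
  using assms(2)
proof induction
  case (mult P m)
  obtain r' where r': "\<And>y. (r has_derivative r' y) (at y)" "\<And>v. real_polynomial_function (\<lambda>y. r' y v)"
    using real_polynomial_has_derivative[OF r] by blast
  obtain P' where P': "\<And>y. (P has_derivative P' y) (at y)" "\<And>v. real_polynomial_function (\<lambda>y. P' y v)"
    using real_polynomial_has_derivative[OF mult] by blast
  define D where "D y v = P y * ((flat (m + 2) (r y) - real m * flat (m + 1) (r y)) * r' y v) + P' y v * flat m (r y)" for y v
  have "((\<lambda>y. flat m (r y)) has_derivative (\<lambda>v. (flat (m + 2) (r y) - real m * flat (m + 1) (r y)) * r' y v)) (at y)" for y
    using has_derivative_compose[OF r'(1) flat_deriv[unfolded has_field_derivative_def]] by simp
  from has_derivative_mult[OF P'(1) this]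
  have "((\<lambda>y. P y * flat m (r y)) has_derivative D y) (at y)" for y
    unfolding D_def .
  moreover have "flat_poly r (\<lambda>y. D y v)" for v
  proof -
    have pr: "real_polynomial_function (\<lambda>y. P y * r' y v)"
      by (intro real_polynomial_function.intros(4) mult r')
    have e: "(\<lambda>y. D y v) = (\<lambda>y. ((P y * r' y v) * flat (m + 2) (r y) + ((- real m) * (P y * r' y v)) * flat (m + 1) (r y))
       + P' y v * flat m (r y))"
      by (auto simp: D_def algebra_simps)
    show ?thesis unfolding e
      by (intro flat_poly.intros pr real_polynomial_function.intros(4)[OF real_polynomial_function.intros(2) pr] P')
  qed
  ultimately show ?case by blast
next
  case (add f g)
  then obtain f' g' where "\<forall>y. (f has_derivative f' y) (at y) \<and> (\<forall>v. flat_poly r (\<lambda>y. f' y v))"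
    "\<forall>y. (g has_derivative g' y) (at y) \<and> (\<forall>v. flat_poly r (\<lambda>y. g' y v))" by blast
  then show ?case
    by (intro exI[of _ "\<lambda>y v. f' y v + g' y v"]) (auto intro: has_derivative_add flat_poly.add)
qed

text \<open>Induction on k for all f at once, since directional derivatives stay in the class. The
  map \<open>L\<close> carries the real result to other codomains, in the application to complex
  multiples of a fixed form value.\<close>

lemma flat_poly_Ck_on:
  fixes L :: "real \<Rightarrow> 'w::real_normed_vector"
  assumes r: "real_polynomial_function r" and "flat_poly r f" and L: "bounded_linear L"
  shows "Ck_on k S (\<lambda>y. L (f y))"
  using assms(2)
proof (induction k arbitrary: f)
  case 0
  obtain f' where "\<And>y. (f has_derivative f' y) (at y)"
    using flat_poly_has_derivative[OF r 0] by blast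
  then have "continuous_on S f"
    by (meson continuous_at_imp_continuous_on has_derivative_continuous)
  then show ?case by (simp add: bounded_linear.continuous_on[OF L])
next
  case (Suc k)
  obtain f' where f': "\<And>y. (f has_derivative f' y) (at y)" "\<And>v. flat_poly r (\<lambda>y. f' y v)"
    using flat_poly_has_derivative[OF r Suc.prems] by blast
  have d: "((\<lambda>y. L (f y)) has_derivative (\<lambda>v. L (f' y v))) (at y)" for y
    by (rule bounded_linear.has_derivative[OF L f'(1)])
  have "frechet_derivative (\<lambda>y. L (f y)) (at y) = (\<lambda>v. L (f' y v))" for y
    by (rule frechet_derivative_at[OF d, symmetric])
  then show ?case using d Suc.IH[OF f'(2)] by (auto simp: differentiable_def)
qed

text \<open>Supported in the ball of radius \<epsilon> and not normalised; what counts is its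
  integral in comparison with the size of its derivative.\<close>

definition bump :: "'v::euclidean_space \<Rightarrow> real \<Rightarrow> 'v \<Rightarrow> real" where
  "bump z \<epsilon> y = flat 0 (1 - ((y - z) \<bullet> (y - z)) / \<epsilon>\<^sup>2)"

definition bump_deriv :: "'v::euclidean_space \<Rightarrow> real \<Rightarrow> 'v \<Rightarrow> 'v \<Rightarrow> real" where
  "bump_deriv z \<epsilon> y v = flat 2 (1 - ((y - z) \<bullet> (y - z)) / \<epsilon>\<^sup>2) * (- (2 * ((y - z) \<bullet> v) / \<epsilon>\<^sup>2))"

lemma bump_has_derivative: "(bump z \<epsilon> has_derivative bump_deriv z \<epsilon> y) (at y)"
proof -
  have "((\<lambda>y. 1 - ((y - z) \<bullet> (y - z)) / \<epsilon>\<^sup>2) has_derivative (\<lambda>v. - (2 * ((y - z) \<bullet> v) / \<epsilon>\<^sup>2))) (at y)"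
  proof -
    have "((\<lambda>y. (y - z) \<bullet> (y - z)) has_derivative (\<lambda>v. 2 * ((y - z) \<bullet> v))) (at y)"
      by (auto intro!: derivative_eq_intros simp: inner_commute)
    from has_derivative_diff[OF has_derivative_const bounded_linear.has_derivative[OF bounded_linear_divide this]]
    show ?thesis by simp
  qed
  from has_derivative_compose[OF this flat_deriv[unfolded has_field_derivative_def, of 0]]
  show ?thesis by (simp add: bump_def[abs_def] bump_deriv_def[abs_def] numeral_2_eq_2)
qed

lemma linear_bump_deriv: "linear (bump_deriv z \<epsilon> y)"
  using bump_has_derivative has_derivative_linear by blast

lemma bump_deriv_expand: "bump_deriv z \<epsilon> y x = (\<Sum>b\<in>Basis. (x \<bullet> b) * bump_deriv z \<epsilon> y b)"
proof -
  have "bump_deriv z \<epsilon> y x = bump_deriv z \<epsilon> y (\<Sum>b\<in>Basis. (x \<bullet> b) *\<^sub>R b)" by (simp only: euclidean_representation)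
  then show ?thesis by (simp add: linear_sum[OF linear_bump_deriv] linear_cmul[OF linear_bump_deriv])
qed

lemma bump_smooth:
  fixes L :: "real \<Rightarrow> 'w::real_normed_vector"
  assumes "bounded_linear L"
  shows "smooth_on S (\<lambda>y. L (bump z \<epsilon> y))"
proof -
  let ?r = "\<lambda>y. 1 - ((y - z) \<bullet> (y - z)) / \<epsilon>\<^sup>2"
  have "real_polynomial_function (\<lambda>y. (y - z) \<bullet> b)" for b
    unfolding inner_diff_left
    by (rule real_polynomial_function_diff[OF real_polynomial_function.intros(1)[OF bounded_linear_inner_left]
        real_polynomial_function.intros(2)])
  then have s: "real_polynomial_function (\<lambda>y. \<Sum>b\<in>Basis. ((y - z) \<bullet> b) * ((y - z) \<bullet> b))"
    by (intro real_polynomial_function_sum real_polynomial_function.intros(4)) auto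
  have r: "real_polynomial_function ?r"
  proof -
    have "(\<lambda>y. (y - z) \<bullet> (y - z)) = (\<lambda>y. \<Sum>b\<in>Basis. ((y - z) \<bullet> b) * ((y - z) \<bullet> b))"
      by (rule ext) (rule euclidean_inner)
    then have "real_polynomial_function (\<lambda>y. (y - z) \<bullet> (y - z))"
      using s by (simp only:)
    then show ?thesis
      by (intro real_polynomial_function_diff real_polynomial_function_divide real_polynomial_function.intros(2))
  qed
  have "flat_poly ?r (\<lambda>y. 1 * flat 0 (?r y))" by (intro flat_poly.mult real_polynomial_function.intros(2))
  from flat_poly_Ck_on[OF r this assms] show ?thesis by (simp add: smooth_on_def bump_def)
qed

lemma flat_continuous: "continuous_on UNIV (flat m)"
  using flat_deriv by (meson DERIV_isCont continuous_at_imp_continuous_on)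

lemma bump_continuous: "continuous_on UNIV (bump z \<epsilon>)" "continuous_on UNIV (\<lambda>y. bump_deriv z \<epsilon> y v)"
  unfolding bump_def bump_deriv_def
  by (cases "\<epsilon> = 0"; force intro!: continuous_intros continuous_on_compose2[OF flat_continuous])+

lemma bump_nonneg: "bump z \<epsilon> y \<ge> 0"
  by (simp add: bump_def flat_nonneg)

lemma outside_ball_radius: "\<epsilon> > 0 \<Longrightarrow> y \<notin> ball z \<epsilon> \<Longrightarrow> 1 - ((y - z) \<bullet> (y - z)) / \<epsilon>\<^sup>2 \<le> 0"
  by (simp add: dist_norm norm_minus_commute dot_square_norm power_mono)

lemma bump_outside:
  assumes "\<epsilon> > 0" "y \<notin> ball z \<epsilon>" shows "bump z \<epsilon> y = 0" "bump_deriv z \<epsilon> y v = 0"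
  using outside_ball_radius[OF assms] by (auto simp: bump_def bump_deriv_def flat_def)

text \<open>The factor \<open>flat 2\<close> is at most 4 and the inner derivative at most
  \<open>2 * norm v / \<epsilon>\<close>. The rate 1 / \<epsilon> offsets an error of order
  \<epsilon> in the field to which the derivative is applied.\<close>

lemma bump_deriv_bound: assumes "\<epsilon> > 0" shows "\<bar>bump_deriv z \<epsilon> y v\<bar> \<le> 8 * norm v / \<epsilon>"
proof (cases "y \<in> ball z \<epsilon>")
  case False then show ?thesis using assms by (simp add: bump_outside)
next
  case True
  then have n: "norm (y - z) \<le> \<epsilon>" by (simp add: dist_norm norm_minus_commute)
  have "\<bar>bump_deriv z \<epsilon> y v\<bar> = flat 2 (1 - ((y - z) \<bullet> (y - z)) / \<epsilon>\<^sup>2) * (2 * \<bar>(y - z) \<bullet> v\<bar> / \<epsilon>\<^sup>2)"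
    unfolding bump_deriv_def abs_mult using flat_nonneg by (simp add: abs_mult)
  also have "\<dots> \<le> 4 * (2 * (\<epsilon> * norm v) / \<epsilon>\<^sup>2)"
  proof (intro mult_mono flat_2_le divide_right_mono mult_left_mono)
    have "\<bar>(y - z) \<bullet> v\<bar> \<le> norm (y - z) * norm v" by (rule Cauchy_Schwarz_ineq2)
    also have "\<dots> \<le> \<epsilon> * norm v" using n by (intro mult_right_mono) auto
    finally show "\<bar>(y - z) \<bullet> v\<bar> \<le> \<epsilon> * norm v" .
  qed auto
  also have "\<dots> = 8 * norm v / \<epsilon>" using assms by (simp add: power2_eq_square)
  finally show ?thesis .
qed

lemma bump_lower: assumes "\<epsilon> > 0" "y \<in> cball z (\<epsilon> / 2)" shows "bump z \<epsilon> y \<ge> exp (- 2)"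
proof -
  have "norm (y - z) \<le> \<epsilon> / 2" using assms by (simp add: dist_norm norm_minus_commute)
  then have "(norm (y - z))\<^sup>2 \<le> (\<epsilon> / 2)\<^sup>2" by (intro power_mono) auto
  then have "((y - z) \<bullet> (y - z)) / \<epsilon>\<^sup>2 \<le> 1 / 4"
    using assms by (simp add: dot_square_norm field_simps power2_eq_square)
  then have t: "1 - ((y - z) \<bullet> (y - z)) / \<epsilon>\<^sup>2 \<ge> 1 / 2" by linarith
  then have "inverse (1 - ((y - z) \<bullet> (y - z)) / \<epsilon>\<^sup>2) \<le> inverse (1 / 2)" by (intro le_imp_inverse_le) auto
  moreover have "1 - ((y - z) \<bullet> (y - z)) / \<epsilon>\<^sup>2 > 0" using t by linarith
  ultimately show ?thesis by (simp only: bump_def flat_def if_True power_0 mult_1_right exp_le_cancel_iff) simp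
qed

section \<open>Weakly divergence-free vector fields\<close>

text \<open>Difference quotients of a function supported in a ball have integral 0 by translation
  invariance, and they converge dominatedly to the directional derivative.\<close>

lemma integral_directional_derivative_eq_0:
  fixes f :: "'v::euclidean_space \<Rightarrow> real"
  assumes f: "\<And>y. (f has_derivative f' y) (at y)" and c: "continuous_on UNIV (\<lambda>y. f' y v)"
    and out: "\<And>y. y \<notin> ball z R \<Longrightarrow> f y = 0" "\<And>y. y \<notin> ball z R \<Longrightarrow> f' y v = 0"
  shows "(\<integral>y. f' y v \<partial>lborel) = 0"
proof -
  have fc: "continuous_on UNIV f"
    using f by (meson continuous_at_imp_continuous_on has_derivative_continuous)
  have [measurable]: "f \<in> borel_measurable borel" "(\<lambda>y. f' y v) \<in> borel_measurable borel"
    using fc c by (auto intro: borel_measurable_continuous_onI)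
  obtain M where M: "\<And>y. y \<in> cball z R \<Longrightarrow> \<bar>f' y v\<bar> \<le> M"
  proof -
    have "compact ((\<lambda>y. f' y v) ` cball z R)"
      by (intro compact_continuous_image continuous_on_subset[OF c]) auto
    then obtain a where "\<forall>x\<in>(\<lambda>y. f' y v) ` cball z R. norm x \<le> a"
      unfolding compact_eq_bounded_closed bounded_iff by blast
    then show ?thesis by (intro that[of a]) auto
  qed
  have M': "\<bar>f' y v\<bar> \<le> \<bar>M\<bar>" for y
    using M[of y] out(2)[of y] by (cases "y \<in> ball z R") auto
  define s where "s n y = real (Suc n) * (f (y + v /\<^sub>R real (Suc n)) - f y)" for n y
  \<comment> \<open>Shifts by at most \<open>norm v\<close> enlarge the support by at most that
    much, which gives one compact dominating set for all n.\<close>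
  define R' where "R' = R + norm v"
  have mv: "\<bar>s n y\<bar> \<le> \<bar>M\<bar>" for n y
  proof -
    have "DERIV (\<lambda>t. f (y + t *\<^sub>R v)) t :> f' (y + t *\<^sub>R v) v" for t
    proof -
      have "((\<lambda>t. y + t *\<^sub>R v) has_derivative (\<lambda>h. h *\<^sub>R v)) (at t)"
        by (auto intro!: derivative_eq_intros)
      from has_derivative_compose[OF this f]
      have "((\<lambda>t. f (y + t *\<^sub>R v)) has_derivative (\<lambda>h. f' (y + t *\<^sub>R v) (h *\<^sub>R v))) (at t)" .
      moreover have "f' (y + t *\<^sub>R v) (h *\<^sub>R v) = f' (y + t *\<^sub>R v) v * h" for h
        using linear_cmul[OF has_derivative_linear[OF f]] by simp
      ultimately show ?thesis by (simp add: has_field_derivative_def)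
    qed
    then obtain t where "f (y + (1 / real (Suc n)) *\<^sub>R v) - f (y + 0 *\<^sub>R v) = (1 / real (Suc n) - 0) * f' (y + t *\<^sub>R v) v"
      using MVT2[of 0 "1 / real (Suc n)" "\<lambda>t. f (y + t *\<^sub>R v)" "\<lambda>t. f' (y + t *\<^sub>R v) v"] by auto
    then have "s n y = f' (y + t *\<^sub>R v) v"
      unfolding s_def by (simp add: divide_inverse del: of_nat_Suc)
    then show ?thesis using M' by simp
  qed
  have s0: "s n y = 0" if "y \<notin> cball z R'" for n y
  proof -
    have "norm (v /\<^sub>R real (Suc n)) \<le> norm v" by (simp add: field_simps)
    then have "dist z y \<le> dist z (y + v /\<^sub>R real (Suc n)) + norm v"
      using dist_triangle[of z y "y + v /\<^sub>R real (Suc n)"] by (simp add: dist_norm)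
    then have "y + v /\<^sub>R real (Suc n) \<notin> ball z R" "y \<notin> ball z R" using that norm_ge_zero[of v]
      unfolding R'_def mem_cball mem_ball by linarith+
    then show ?thesis by (simp add: s_def out(1))
  qed
  have "(\<lambda>n. \<integral>y. s n y \<partial>lborel) \<longlonglongrightarrow> (\<integral>y. f' y v \<partial>lborel)"
  proof (rule integral_dominated_convergence[where w="\<lambda>y. indicator (cball z R') y *\<^sub>R \<bar>M\<bar>"])
    show "integrable lborel (\<lambda>y. indicator (cball z R') y *\<^sub>R \<bar>M\<bar>)"
      by (rule borel_integrable_compact) auto
    show "AE y in lborel. norm (s n y) \<le> indicator (cball z R') y *\<^sub>R \<bar>M\<bar>" for n
      using mv[of n] s0[of _ n] by (intro AE_I2) (auto simp: indicator_def)
    show "AE y in lborel. (\<lambda>n. s n y) \<longlonglongrightarrow> f' y v"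
    proof (intro AE_I2)
      fix y
      have "((\<lambda>t. y + t *\<^sub>R v) has_derivative (\<lambda>h. h *\<^sub>R v)) (at 0)"
        by (auto intro!: derivative_eq_intros)
      moreover have "(f has_derivative f' y) (at (y + 0 *\<^sub>R v))" using f by simp
      ultimately have "((\<lambda>t. f (y + t *\<^sub>R v)) has_derivative (\<lambda>h. f' y (h *\<^sub>R v))) (at 0)"
        by (rule has_derivative_compose)
      moreover have "f' y (h *\<^sub>R v) = f' y v * h" for h
        using linear_cmul[OF has_derivative_linear[OF f]] by simp
      ultimately have "DERIV (\<lambda>t. f (y + t *\<^sub>R v)) 0 :> f' y v"
        by (simp add: has_field_derivative_def)
      then have "((\<lambda>h. (f (y + h *\<^sub>R v) - f y) / h) \<longlongrightarrow> f' y v) (at 0)"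
        by (simp add: DERIV_def)
      moreover have "filterlim (\<lambda>n. inverse (real (Suc n))) (at 0) sequentially"
        using LIMSEQ_inverse_real_of_nat by (auto simp: filterlim_at)
      ultimately have "(\<lambda>n. (f (y + inverse (real (Suc n)) *\<^sub>R v) - f y) / inverse (real (Suc n))) \<longlonglongrightarrow> f' y v"
        by (rule filterlim_compose)
      then show "(\<lambda>n. s n y) \<longlonglongrightarrow> f' y v"
        by (simp add: s_def divide_inverse mult.commute)
    qed
  qed (auto simp: s_def)
  moreover have "(\<integral>y. s n y \<partial>lborel) = 0" for n
  proof -
    let ?c = "v /\<^sub>R real (Suc n)"
    have int: "integrable lborel f"
    proof -
      have "integrable lborel (\<lambda>y. indicator (cball z R) y *\<^sub>R f y)"
        by (rule borel_integrable_compact) (use continuous_on_subset[OF fc] in auto)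
      moreover have "(\<lambda>y. indicator (cball z R) y *\<^sub>R f y) = f"
        using out(1) by (auto simp: indicator_def fun_eq_iff)
      ultimately show ?thesis by simp
    qed
    have d: "distr lborel borel ((+) ?c) = lborel" by (rule lborel_distr_plus)
    have "integrable lborel (\<lambda>y. f (?c + y))"
      using int by (subst (asm) d[symmetric]) (simp add: integrable_distr_eq)
    moreover have "(\<integral>y. f (?c + y) \<partial>lborel) = (\<integral>y. f y \<partial>lborel)"
      by (subst (2) d[symmetric]) (simp add: integral_distr)
    ultimately show ?thesis using int by (simp add: s_def add.commute)
  qed
  ultimately show ?thesis by (simp add: LIMSEQ_const_iff)
qed

text \<open>\<open>X\<close> is assumed differentiable at z alone, so integration by parts is done
  for its affine approximation \<open>A\<close>, whose divergence is the constant \<tau>. The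
  integral of the bump has at least the order of the volume of the \<epsilon>-ball; replacing
  \<open>X\<close> by \<open>A\<close> costs at most \<delta> times that order, with \<delta> at
  choice. So a nonzero \<tau> contradicts the hypothesis on a small ball.\<close>

lemma weak_divergence_zero:
  fixes X :: "'v::euclidean_space \<Rightarrow> 'v"
  assumes r: "r > 0" and Xc: "continuous_on (cball z r) X" and X': "(X has_derivative X') (at z)"
    and weak: "\<And>\<epsilon>. 0 < \<epsilon> \<Longrightarrow> \<epsilon> \<le> r \<Longrightarrow> (\<integral>y. bump_deriv z \<epsilon> y (X y) \<partial>lborel) = 0"
  shows "(\<Sum>b\<in>Basis. X' b \<bullet> b) = 0"
proof (rule ccontr)
  define \<tau> where "\<tau> = (\<Sum>b\<in>Basis. X' b \<bullet> b)"
  assume "(\<Sum>b\<in>Basis. X' b \<bullet> b) \<noteq> 0"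
  then have \<tau>: "\<bar>\<tau>\<bar> > 0" by (simp add: \<tau>_def)
  let ?N = "DIM('v)"
  \<comment> \<open>Then 8 * \<delta>, the error per volume of the \<epsilon>-ball, is half of the
    lower bound obtained on the half ball, which carries the factors \<open>exp (- 2)\<close> and
    \<open>1 / 2 ^ ?N\<close>.\<close>
  define \<delta> where "\<delta> = \<bar>\<tau>\<bar> * exp (- 2) / (16 * 2 ^ ?N)"
  have \<delta>: "\<delta> > 0" using \<tau> by (simp add: \<delta>_def)
  define A where "A y = X z + X' (y - z)" for y
  have lin: "linear X'" and bl: "bounded_linear X'"
    using X' has_derivative_linear has_derivative_bounded_linear by blast+
  obtain d where d: "d > 0" "\<And>y. norm (y - z) < d \<Longrightarrow> norm (X y - X z - X' (y - z)) \<le> \<delta> * norm (y - z)"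
    using X' \<delta> unfolding has_derivative_at_alt by blast
  define \<epsilon> where "\<epsilon> = min r (d / 2)"
  have \<epsilon>: "\<epsilon> > 0" "\<epsilon> \<le> r" "\<epsilon> < d" using r d by (auto simp: \<epsilon>_def)
  have A_err: "norm (X y - A y) \<le> \<delta> * \<epsilon>" if "y \<in> cball z \<epsilon>" for y
  proof -
    have n: "norm (y - z) \<le> \<epsilon>" using that by (simp add: dist_norm norm_minus_commute)
    have "norm (X y - A y) \<le> \<delta> * norm (y - z)" using d(2)[of y] n \<epsilon> by (simp add: A_def algebra_simps)
    also have "\<dots> \<le> \<delta> * \<epsilon>" using n \<delta> by simp
    finally show ?thesis .
  qed
  note expand = bump_deriv_expand[of z \<epsilon>]
  have Ac: "continuous_on UNIV A" unfolding A_def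
    by (intro continuous_intros bounded_linear.continuous_on[OF bl])
  have int_c: "integrable lborel f" if "continuous_on (cball z \<epsilon>) f" "\<And>y. y \<notin> ball z \<epsilon> \<Longrightarrow> f y = 0"
    for f :: "'v \<Rightarrow> real"
  proof -
    have "integrable lborel (\<lambda>y. indicator (cball z \<epsilon>) y *\<^sub>R f y)"
      by (rule borel_integrable_compact) (use that in auto)
    moreover have "(\<lambda>y. indicator (cball z \<epsilon>) y *\<^sub>R f y) = f"
      using that(2) by (auto simp: indicator_def fun_eq_iff)
    ultimately show ?thesis by simp
  qed
  have bc: "continuous_on T (bump z \<epsilon>)" "continuous_on T (\<lambda>y. bump_deriv z \<epsilon> y v)" for T v
    using bump_continuous continuous_on_subset by blast+
  have int_b: "integrable lborel (bump z \<epsilon>)"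
    by (rule int_c) (auto intro: bc simp: bump_outside \<epsilon>)
  have int_A: "integrable lborel (\<lambda>y. bump_deriv z \<epsilon> y b * (A y \<bullet> b))" for b
    by (rule int_c) (auto intro!: continuous_intros bc continuous_on_subset[OF Ac] simp: bump_outside \<epsilon>)
  have int_X: "integrable lborel (\<lambda>y. bump_deriv z \<epsilon> y (X y))"
  proof (rule int_c)
    have "continuous_on (cball z \<epsilon>) X" by (rule continuous_on_subset[OF Xc]) (use \<epsilon> in auto)
    then show "continuous_on (cball z \<epsilon>) (\<lambda>y. bump_deriv z \<epsilon> y (X y))"
      by (subst expand) (intro continuous_intros bc)
  qed (simp add: bump_outside \<epsilon>)
  have parts: "(\<integral>y. bump_deriv z \<epsilon> y b * (A y \<bullet> b) \<partial>lborel) = - ((X' b \<bullet> b) * (\<integral>y. bump z \<epsilon> y \<partial>lborel))" for b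
  proof -
    define F where "F y v = bump z \<epsilon> y * (X' v \<bullet> b) + bump_deriv z \<epsilon> y v * (A y \<bullet> b)" for y v
    have A': "(A has_derivative X') (at y)" for y
    proof -
      have "((\<lambda>y. y - z) has_derivative (\<lambda>h. h)) (at y)" by (auto intro!: derivative_eq_intros)
      from bounded_linear.has_derivative[OF bl this] show ?thesis
        unfolding A_def by (auto intro!: derivative_eq_intros)
    qed
    have "((\<lambda>y. bump z \<epsilon> y * (A y \<bullet> b)) has_derivative F y) (at y)" for y
      unfolding F_def by (intro has_derivative_mult bump_has_derivative has_derivative_inner_left A')
    moreover have "continuous_on UNIV (\<lambda>y. F y b)"
      unfolding F_def by (intro continuous_intros bc Ac)
    ultimately have "(\<integral>y. F y b \<partial>lborel) = 0"
      by (rule integral_directional_derivative_eq_0[where z=z and R=\<epsilon>]) (simp_all add: F_def bump_outside \<epsilon>)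
    then show ?thesis unfolding F_def using int_b int_A by (simp add: mult.commute)
  qed
  have IA: "(\<integral>y. bump_deriv z \<epsilon> y (A y) \<partial>lborel) = - (\<tau> * (\<integral>y. bump z \<epsilon> y \<partial>lborel))"
    by (subst expand) (simp add: mult.commute[of "A _ \<bullet> _"] int_A parts \<tau>_def sum_negf sum_distrib_right)
  have int_A2: "integrable lborel (\<lambda>y. bump_deriv z \<epsilon> y (A y))"
    by (subst expand) (simp add: mult.commute[of "A _ \<bullet> _"] int_A)
  define V where "V = unit_ball_vol (real ?N)"
  have V: "V > 0" by (simp add: V_def)
  have low: "(\<integral>y. bump z \<epsilon> y \<partial>lborel) \<ge> exp (- 2) * (V * (\<epsilon> / 2) ^ ?N)"
  proof -
    have i: "integrable lborel (\<lambda>y. indicator (cball z (\<epsilon> / 2)) y *\<^sub>R exp (- 2 :: real))"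
      by (rule borel_integrable_compact) auto
    have "(\<integral>y. indicator (cball z (\<epsilon> / 2)) y *\<^sub>R exp (- 2 :: real) \<partial>lborel) \<le> (\<integral>y. bump z \<epsilon> y \<partial>lborel)"
      by (rule integral_mono[OF i int_b]) (auto simp: indicator_def bump_nonneg bump_lower \<epsilon>)
    moreover have "(\<integral>y. indicator (cball z (\<epsilon> / 2)) y *\<^sub>R exp (- 2 :: real) \<partial>lborel) = exp (- 2) * (V * (\<epsilon> / 2) ^ ?N)"
      using \<epsilon> content_cball[of "\<epsilon> / 2" z] by (simp add: V_def mult.commute)
    ultimately show ?thesis by (simp only:)
  qed
  have up: "\<bar>(\<integral>y. bump_deriv z \<epsilon> y (X y) \<partial>lborel) - (\<integral>y. bump_deriv z \<epsilon> y (A y) \<partial>lborel)\<bar> \<le> 8 * \<delta> * (V * \<epsilon> ^ ?N)"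
  proof -
    have i: "integrable lborel (\<lambda>y. indicator (cball z \<epsilon>) y *\<^sub>R (8 * \<delta>))"
      by (rule borel_integrable_compact) auto
    have "\<bar>(\<integral>y. bump_deriv z \<epsilon> y (X y) \<partial>lborel) - (\<integral>y. bump_deriv z \<epsilon> y (A y) \<partial>lborel)\<bar>
       = norm (\<integral>y. bump_deriv z \<epsilon> y (X y) - bump_deriv z \<epsilon> y (A y) \<partial>lborel)"
      by (simp add: int_X int_A2)
    also have "\<dots> \<le> (\<integral>y. indicator (cball z \<epsilon>) y *\<^sub>R (8 * \<delta>) \<partial>lborel)"
    proof (rule Bochner_Integration.integral_norm_bound_integral)
      fix y
      show "norm (bump_deriv z \<epsilon> y (X y) - bump_deriv z \<epsilon> y (A y)) \<le> indicator (cball z \<epsilon>) y *\<^sub>R (8 * \<delta>)"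
      proof (cases "y \<in> cball z \<epsilon>")
        case True
        have "norm (bump_deriv z \<epsilon> y (X y) - bump_deriv z \<epsilon> y (A y)) = \<bar>bump_deriv z \<epsilon> y (X y - A y)\<bar>"
          by (simp add: linear_diff[OF linear_bump_deriv])
        also have "\<dots> \<le> 8 * norm (X y - A y) / \<epsilon>" by (rule bump_deriv_bound[OF \<epsilon>(1)])
        also have "\<dots> \<le> 8 * (\<delta> * \<epsilon>) / \<epsilon>"
          using A_err[OF True] \<epsilon> by (intro divide_right_mono mult_left_mono) auto
        finally show ?thesis using True \<epsilon> by simp
      next
        case False
        then have "y \<notin> ball z \<epsilon>" by auto
        then show ?thesis using False by (simp add: bump_outside \<epsilon>)
      qed
    qed (use i int_X int_A2 in auto)
    also have "\<dots> = 8 * \<delta> * (V * \<epsilon> ^ ?N)"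
      using \<epsilon> content_cball[of \<epsilon> z] by (simp add: V_def mult.commute)
    finally show ?thesis .
  qed
  have "\<bar>\<tau>\<bar> * (exp (- 2) * (V * (\<epsilon> / 2) ^ ?N)) \<le> \<bar>\<tau> * (\<integral>y. bump z \<epsilon> y \<partial>lborel)\<bar>"
    unfolding abs_mult using low by (intro mult_left_mono) auto
  also have "\<dots> \<le> 8 * \<delta> * (V * \<epsilon> ^ ?N)"
    using up weak[OF \<epsilon>(1,2)] IA by simp
  finally have "\<bar>\<tau>\<bar> * exp (- 2) / 2 ^ ?N * (V * \<epsilon> ^ ?N) \<le> 8 * \<delta> * (V * \<epsilon> ^ ?N)"
    by (simp add: power_divide field_simps)
  moreover have "V * \<epsilon> ^ ?N > 0" using V \<epsilon> by simp
  ultimately have "\<bar>\<tau>\<bar> * exp (- 2) / 2 ^ ?N \<le> 8 * \<delta>" by (rule mult_right_le_imp_le)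
  moreover have "8 * \<delta> = (\<bar>\<tau>\<bar> * exp (- 2) / 2 ^ ?N) / 2" by (simp add: \<delta>_def)
  moreover have "\<bar>\<tau>\<bar> * exp (- 2) / 2 ^ ?N > 0" using \<tau> by simp
  moreover have "\<not> (c \<le> x \<and> x = c / 2 \<and> 0 < c)" for c x :: real by auto
  ultimately show False by blast
qed

section \<open>The volume density\<close>

text \<open>A permutation other than the identity moves at least two points, so after one factor is
  differentiated an off-diagonal entry of the identity matrix is left and kills the term.\<close>

lemma has_derivative_det_at_id:
  fixes A :: "'v::real_normed_vector \<Rightarrow> real^'m^'m::finite"
  assumes A: "\<And>i j. ((\<lambda>y. A y $ i $ j) has_derivative A' i j) (at z)" and id: "A z = mat 1"
  shows "((\<lambda>y. det (A y)) has_derivative (\<lambda>u. \<Sum>i\<in>UNIV. A' i i u)) (at z)"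
proof -
  let ?P = "{p. p permutes (UNIV :: 'm set)}"
  have "((\<lambda>y. det (A y)) has_derivative
    (\<lambda>u. \<Sum>p\<in>?P. of_int (sign p) * (\<Sum>i\<in>UNIV. A' i (p i) u * (\<Prod>j\<in>UNIV - {i}. A z $ j $ p j)))) (at z)"
    unfolding det_def by (intro has_derivative_sum has_derivative_mult_right has_derivative_prod A)
  also have "(\<lambda>u. \<Sum>p\<in>?P. of_int (sign p) * (\<Sum>i\<in>UNIV. A' i (p i) u * (\<Prod>j\<in>UNIV - {i}. A z $ j $ p j)))
    = (\<lambda>u. \<Sum>i\<in>UNIV. A' i i u)"
  proof
    fix u
    let ?f = "\<lambda>p. of_int (sign p) * (\<Sum>i\<in>UNIV. A' i (p i) u * (\<Prod>j\<in>UNIV - {i}. A z $ j $ p j))"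
    have z: "?f p = 0" if p: "p \<in> ?P" "p \<noteq> id" for p
    proof -
      have "(\<Prod>j\<in>UNIV - {i}. A z $ j $ p j) = 0" for i
      proof -
        obtain j0 where j0: "p j0 \<noteq> j0" using p(2) by (auto simp: fun_eq_iff)
        have "\<exists>j. j \<noteq> i \<and> p j \<noteq> j"
        proof (cases "j0 = i")
          case True
          have "p (p i) \<noteq> p i" using j0 True permutes_inj[of p UNIV] p(1) by (auto dest: injD)
          then show ?thesis using j0 True by auto
        qed (use j0 in auto)
        then obtain j where "j \<noteq> i" "p j \<noteq> j" by blast
        then have "j \<in> UNIV - {i}" "A z $ j $ p j = 0" by (auto simp: id mat_def)
        then show ?thesis by (intro prod_zero) auto
      qed
      then show ?thesis by (simp only: mult_zero_right sum.neutral_const)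
    qed
    have "sum ?f ?P = ?f id"
    proof -
      have "sum ?f ?P = sum ?f {id}"
        by (rule sum.mono_neutral_right) (use z in \<open>auto simp: permutes_id finite_permutations\<close>)
      then show ?thesis by simp
    qed
    also have "\<dots> = (\<Sum>i\<in>UNIV. A' i i u)" by (simp add: id mat_def)
    finally show "sum ?f ?P = (\<Sum>i\<in>UNIV. A' i i u)" .
  qed
  finally show ?thesis .
qed

definition tr :: "('v::euclidean_space \<Rightarrow> 'v) \<Rightarrow> real" where
  "tr L = (\<Sum>b\<in>Basis. L b \<bullet> b)"

lemma tr_rank_one: "linear f \<Longrightarrow> tr (\<lambda>u. f u *\<^sub>R x) = f x"
proof -
  assume f: "linear f"
  have "f x = f (\<Sum>b\<in>Basis. (x \<bullet> b) *\<^sub>R b)" by (simp only: euclidean_representation)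
  then show ?thesis by (simp add: tr_def linear_sum[OF f] linear_cmul[OF f] mult.commute)
qed

lemma tr_sum: "tr (\<lambda>u. \<Sum>i\<in>A. L i u) = (\<Sum>i\<in>A. tr (L i))"
  unfolding tr_def inner_sum_left by (rule sum.swap)

lemma tr_add: "tr (\<lambda>u. L u + M u) = tr L + tr M"
  by (simp add: tr_def inner_add_left sum.distrib)

lemma tr_scaleR: "tr (\<lambda>u. c *\<^sub>R L u) = c * tr L"
  by (simp add: tr_def sum_distrib_left)

lemma tr_minus: "tr (\<lambda>u. - L u) = - tr L"
  by (simp add: tr_def sum_negf)

text \<open>The divergence uses the trace in standard coordinates, the metric computations use a
  frame; this joins the two.\<close>

lemma (in inner_form) tr_onfam:
  assumes e: "onfam DIM('v) e" and L: "linear L"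
  shows "tr L = (\<Sum>i<DIM('v). B (L (e i)) (e i))"
proof -
  have "tr L = (\<Sum>b\<in>Basis. \<Sum>i<DIM('v). B b (e i) * (L (e i) \<bullet> b))"
    unfolding tr_def
  proof (rule sum.cong[OF refl])
    fix b :: 'v
    have l: "linear (\<lambda>x. L x \<bullet> b)"
      using linear_compose[OF L bounded_linear.linear[OF bounded_linear_inner_left]] by (simp add: o_def)
    show "L b \<bullet> b = (\<Sum>i<DIM('v). B b (e i) * (L (e i) \<bullet> b))"
      using onfam_expand_linear[OF e l, of b] by simp
  qed
  also have "\<dots> = (\<Sum>i<DIM('v). B (\<Sum>b\<in>Basis. (L (e i) \<bullet> b) *\<^sub>R b) (e i))"
    by (subst sum.swap) (simp add: B_simps mult.commute)
  finally show ?thesis by (simp only: euclidean_representation)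
qed

lemma real_coord_vec_expand:
  fixes v :: "complex^'n::finite"
  shows "v = (\<Sum>s\<in>UNIV. (case s of Inl i \<Rightarrow> Re (v $ i) | Inr i \<Rightarrow> Im (v $ i)) *\<^sub>R real_coord_vec s)"
proof -
  have "(\<Sum>s\<in>UNIV. (case s of Inl i \<Rightarrow> Re (v $ i) | Inr i \<Rightarrow> Im (v $ i)) *\<^sub>R real_coord_vec s)
    = (\<Sum>i\<in>UNIV. Re (v $ i) *\<^sub>R axis i (1::complex)) + (\<Sum>i\<in>UNIV. Im (v $ i) *\<^sub>R axis i \<i>)"
    unfolding UNIV_sum by (subst sum.union_disjoint) (auto simp: sum.reindex real_coord_vec_def)
  also have "\<dots> = v"
  proof (rule vec_eq_iff[THEN iffD2], rule allI)
    fix j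
    have "(\<Sum>i\<in>UNIV. Re (v $ i) *\<^sub>R axis i (1::complex) $ j) = of_real (Re (v $ j))"
      "(\<Sum>i\<in>UNIV. Im (v $ i) *\<^sub>R axis i \<i> $ j) = of_real (Im (v $ j)) * \<i>"
      by (simp_all add: axis_def scaleR_conv_of_real if_distrib[of "(*) _"] cong: if_cong)
    then show "((\<Sum>i\<in>UNIV. Re (v $ i) *\<^sub>R axis i (1::complex)) + (\<Sum>i\<in>UNIV. Im (v $ i) *\<^sub>R axis i \<i>)) $ j = v $ j"
      by (simp add: complex_eq_iff)
  qed
  finally show ?thesis by simp
qed

context kaehler_chart
begin

lemma vol_density_continuous: "continuous_on S (\<lambda>y. vol_density (G y))"
  unfolding vol_density_def det_def
  by (intro continuous_intros) (auto intro!: continuous_intros smooth_on_continuous[OF G_smooth])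

text \<open>The Gram matrix in real coordinates is congruent, through a matrix \<open>P\<close>
  independent of y, to the Gram matrix \<open>N y\<close> of a fixed frame orthonormal at z. At z
  the latter is the identity, where the determinant has the trace as derivative; metric
  compatibility makes this twice the trace of the connection, and the square root removes the factor
  2.\<close>

lemma vol_density_has_derivative:
  assumes z: "z \<in> S"
  shows "vol_density (G z) > 0"
    and "((\<lambda>y. vol_density (G y)) has_derivative (\<lambda>u. vol_density (G z) * tr (christoffel G z u))) (at z)"
proof -
  interpret hermitian_form "G z" by (rule hermitian[OF z])
  have "card (UNIV :: ('n + 'n) set) = card {..<2 * CARD('n)}" by simp
  then obtain h where h: "bij_betw h (UNIV :: ('n + 'n) set) {..<2 * CARD('n)}"
    using finite_same_card_bij by (metis finite_lessThan finite)
  have hlt: "h a < 2 * CARD('n)" for a using h by (auto simp: bij_betw_def)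
  have hinj: "h a = h b \<longleftrightarrow> a = b" for a b using h by (auto simp: bij_betw_def inj_on_def)
  have sumh: "(\<Sum>i<2 * CARD('n). f i) = (\<Sum>a\<in>UNIV. f (h a))" for f :: "nat \<Rightarrow> 'b::comm_monoid_add"
    using sum.reindex_bij_betw[OF h] by metis
  have e: "onfam DIM(complex^'n) fr" by (rule fr_onfam)
  have ff: "G z (fr i) (fr j) = (if i = j then 1 else 0)" if "i < 2 * CARD('n)" "j < 2 * CARD('n)" for i j
    using onfamD[OF e, of i j] that by simp
  have expand: "x = (\<Sum>a\<in>UNIV. G z x (fr (h a)) *\<^sub>R fr (h a))" for x
    using onfam_expand[OF e, of x] sumh[of "\<lambda>i. G z x (fr i) *\<^sub>R fr i"] by (simp add: mult.commute)
  define P :: "real^('n + 'n)^('n + 'n)" where "P = (\<chi> s a. G z (real_coord_vec s) (fr (h a)))"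
  define N :: "complex^'n \<Rightarrow> real^('n + 'n)^('n + 'n)" where "N y = (\<chi> a b. G y (fr (h a)) (fr (h b)))" for y
  \<comment> \<open>Real coordinates of the frame vectors; being inverse to \<open>P\<close>, this
    matrix shows that \<open>det P\<close> is nonzero.\<close>
  define Q :: "real^('n + 'n)^('n + 'n)" where
    "Q = (\<chi> a s. case s of Inl i \<Rightarrow> Re (fr (h a) $ i) | Inr i \<Rightarrow> Im (fr (h a) $ i))"
  have "Q ** P = mat 1"
  proof -
    have "(\<Sum>s\<in>UNIV. Q $ a $ s * P $ s $ b) = (if a = b then 1 else 0)" for a b
    proof -
      have "(\<Sum>s\<in>UNIV. Q $ a $ s * P $ s $ b)
        = G z (\<Sum>s\<in>UNIV. (case s of Inl i \<Rightarrow> Re (fr (h a) $ i) | Inr i \<Rightarrow> Im (fr (h a) $ i)) *\<^sub>R real_coord_vec s) (fr (h b))"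
        by (simp add: Q_def P_def B_simps)
      also have "\<dots> = G z (fr (h a)) (fr (h b))" by (simp only: real_coord_vec_expand[symmetric])
      finally show ?thesis using ff[OF hlt hlt] by (simp add: hinj)
    qed
    then show ?thesis by (simp add: matrix_matrix_mult_def mat_def vec_eq_iff)
  qed
  then have "det Q * det P = 1" by (metis det_mul det_I)
  then have P0: "det P \<noteq> 0" by auto
  have gram: "det (\<chi> s t. G y (real_coord_vec s) (real_coord_vec t) :: real^('n + 'n)^('n + 'n)) = (det P)\<^sup>2 * det (N y)"
    if "y \<in> S" for y
  proof -
    interpret y: hermitian_form "G y" by (rule hermitian[OF that])
    have "(\<chi> s t. G y (real_coord_vec s) (real_coord_vec t) :: real^('n + 'n)^('n + 'n)) = P ** N y ** Finite_Cartesian_Product.transpose P"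
    proof -
      have "G y x w = (\<Sum>b\<in>UNIV. (\<Sum>a\<in>UNIV. G z x (fr (h a)) * G y (fr (h a)) (fr (h b))) * G z w (fr (h b)))" for x w
      proof -
        have "G y x w = G y (\<Sum>a\<in>UNIV. G z x (fr (h a)) *\<^sub>R fr (h a)) (\<Sum>a\<in>UNIV. G z w (fr (h a)) *\<^sub>R fr (h a))"
          by (rule arg_cong2[OF expand expand])
        also have "\<dots> = (\<Sum>b\<in>UNIV. G z w (fr (h b)) * (\<Sum>a\<in>UNIV. G z x (fr (h a)) * G y (fr (h a)) (fr (h b))))"
          by (simp only: y.B_simps real_scaleR_def)
        finally show ?thesis by (simp only: mult.commute)
      qed
      note key = this
      show ?thesis
        unfolding matrix_matrix_mult_def Finite_Cartesian_Product.transpose_def P_def N_def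
        by (simp only: vec_eq_iff vec_lambda_beta) (intro allI key)
    qed
    then show ?thesis by (simp add: det_mul det_transpose power2_eq_square mult_ac)
  qed
  have N': "((\<lambda>y. det (N y)) has_derivative (\<lambda>u. \<Sum>a\<in>UNIV. dG z u (fr (h a)) (fr (h a)))) (at z)"
  proof (rule has_derivative_det_at_id[where A'="\<lambda>i j u. dG z u (fr (h i)) (fr (h j))"])
    show "((\<lambda>y. N y $ i $ j) has_derivative (\<lambda>u. dG z u (fr (h i)) (fr (h j)))) (at z)" for i j
      unfolding N_def using dG[OF z] by simp
    show "N z = mat 1" using ff[OF hlt hlt] by (simp add: N_def mat_def vec_eq_iff hinj)
  qed
  have Nz: "det (N z) = 1"
  proof -
    have "N z = mat 1" using ff[OF hlt hlt] by (simp add: N_def mat_def vec_eq_iff hinj)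
    then show ?thesis by simp
  qed
  have vz: "vol_density (G z) = \<bar>det P\<bar>" using gram[OF z] Nz by (simp add: vol_density_def)
  then show "vol_density (G z) > 0" using P0 by simp
  have t: "(\<Sum>a\<in>UNIV. dG z u (fr (h a)) (fr (h a))) = 2 * tr (christoffel G z u)" for u
  proof -
    have "dG z u x x = 2 * G z (christoffel G z u x) x" for x
      using christoffel_props(3)[OF z, of u x x] sym[of x "christoffel G z u x"] by simp
    then have "(\<Sum>a\<in>UNIV. dG z u (fr (h a)) (fr (h a))) = 2 * (\<Sum>i<2 * CARD('n). G z (christoffel G z u (fr i)) (fr i))"
      unfolding sumh by (simp add: sum_distrib_left)
    then show ?thesis using tr_onfam[OF e christoffel_linear(1)[OF z], of u] by (simp add: mult.commute)
  qed
  have "((\<lambda>y. sqrt ((det P)\<^sup>2 * det (N y))) has_derivative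
      (\<lambda>u. ((det P)\<^sup>2 * (2 * tr (christoffel G z u))) * (inverse (sqrt ((det P)\<^sup>2 * det (N z))) / 2))) (at z)"
    using N' P0 Nz by (intro has_derivative_real_sqrt has_derivative_mult_right) (auto simp: t)
  also have "(\<lambda>u. ((det P)\<^sup>2 * (2 * tr (christoffel G z u))) * (inverse (sqrt ((det P)\<^sup>2 * det (N z))) / 2))
    = (\<lambda>u. vol_density (G z) * tr (christoffel G z u))"
    using P0 by (auto simp: fun_eq_iff vz Nz power2_eq_square abs_if field_simps)
  finally show "((\<lambda>y. vol_density (G y)) has_derivative (\<lambda>u. vol_density (G z) * tr (christoffel G z u))) (at z)"
    by (rule has_derivative_transform_within_open[OF _ open_S z]) (simp add: vol_density_def gram)
qed

end

section \<open>The codifferential\<close>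

text \<open>The exterior product of the covector \<open>l\<close> with \<beta>, in the normalisation
  of \<open>ext_deriv\<close>: with \<open>l\<close> the differential of a function, it is the
  exterior derivative of that function times the constant form \<beta>.\<close>

definition cov_wedge :: "nat \<Rightarrow> (complex^'n::finite \<Rightarrow> complex) \<Rightarrow> 'n cform \<Rightarrow> 'n cform" where
  "cov_wedge m l \<beta> v = (\<Sum>i\<le>m. (-1) ^ i * (l (v i) * \<beta> (\<lambda>j. v (if j < i then j else Suc j))))"

text \<open>All \<open>Suc m\<close> terms of the product contribute equally: moving the i-th index
  to the front is a cycle whose sign is the one in \<open>cov_wedge\<close>, and \<open>w\<close>
  absorbs it.\<close>

lemma sum_cov_wedge:
  fixes \<beta> w :: "'n::finite cform"
  assumes \<beta>: "alt_form m \<beta>" and w: "alt_form (Suc m) w"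
  shows "(\<Sum>I\<in>{..<Suc m} \<rightarrow>\<^sub>E D. cov_wedge m l \<beta> (e \<circ> I) * cnj (w (e \<circ> I)))
    = of_nat (Suc m) * (\<Sum>I\<in>{..<Suc m} \<rightarrow>\<^sub>E D. l (e (I 0)) * \<beta> (\<lambda>s. e (I (Suc s))) * cnj (w (e \<circ> I)))"
proof -
  define g where "g I = l (e (I 0)) * \<beta> (\<lambda>s. e (I (Suc s))) * cnj (w (e \<circ> I))" for I
  have "(-1) ^ i * (l ((e \<circ> I) i) * \<beta> (\<lambda>j. (e \<circ> I) (if j < i then j else Suc j))) * cnj (w (e \<circ> I)) = g (I \<circ> cyc i)"
    if "i \<le> m" for i I
  proof -
    have "w (e \<circ> (I \<circ> cyc i)) = (-1) ^ i * w (e \<circ> I)"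
      using alt_form_cyc[OF w, of i "e \<circ> I"] that by (simp add: o_assoc)
    moreover have "(\<lambda>s. e ((I \<circ> cyc i) (Suc s))) = (\<lambda>j. (e \<circ> I) (if j < i then j else Suc j))"
      by (auto simp: cyc_def)
    moreover have "(I \<circ> cyc i) 0 = I i" by (simp add: cyc_def)
    ultimately show ?thesis by (simp add: g_def)
  qed
  note h = this
  have "(\<Sum>I\<in>{..<Suc m} \<rightarrow>\<^sub>E D. cov_wedge m l \<beta> (e \<circ> I) * cnj (w (e \<circ> I)))
    = (\<Sum>I\<in>{..<Suc m} \<rightarrow>\<^sub>E D. \<Sum>i\<le>m. g (I \<circ> cyc i))"
    unfolding cov_wedge_def sum_distrib_right by (rule sum.cong[OF refl], rule sum.cong[OF refl], rule h) simp
  also have "\<dots> = (\<Sum>i\<le>m. \<Sum>I\<in>{..<Suc m} \<rightarrow>\<^sub>E D. g (I \<circ> cyc i))" by (rule sum.swap)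
  also have "\<dots> = (\<Sum>i\<le>m. \<Sum>I\<in>{..<Suc m} \<rightarrow>\<^sub>E D. g I)"
    by (rule sum.cong[OF refl], rule sum_PiE_permutes, rule cyc_permutes) simp
  finally show ?thesis by (simp add: g_def)
qed

lemma multi_form_tensor:
  fixes \<beta> :: "'n::finite cform"
  assumes \<beta>: "alt_form m \<beta>" and l: "linear l"
  shows "multi_form (Suc m) (\<lambda>v. l (v 0) * \<beta> (\<lambda>s. v (Suc s)))"
  unfolding multi_form_def
proof (intro conjI allI impI)
  fix v w :: "nat \<Rightarrow> complex^'n" assume "\<forall>i<Suc m. v i = w i"
  then show "l (v 0) * \<beta> (\<lambda>s. v (Suc s)) = l (w 0) * \<beta> (\<lambda>s. w (Suc s))"
    using alt_form_cong[OF \<beta>, of "\<lambda>s. v (Suc s)" "\<lambda>s. w (Suc s)"] by auto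
next
  fix i and v :: "nat \<Rightarrow> complex^'n" assume i: "i < Suc m"
  show "linear (\<lambda>x. l ((v(i := x)) 0) * \<beta> (\<lambda>s. (v(i := x)) (Suc s)))"
  proof (cases i)
    case 0
    show ?thesis
      using linear_compose[OF l bounded_linear.linear[OF bounded_linear_mult_left]] by (simp add: 0 o_def)
  next
    case (Suc j)
    have "(\<lambda>s. (v(i := x)) (Suc s)) = (\<lambda>s. v (Suc s))(j := x)" for x by (auto simp: Suc)
    then show ?thesis
      using linear_compose[OF alt_form_linear[OF \<beta>] bounded_linear.linear[OF bounded_linear_mult_right]] i Suc
      by (simp add: o_def del: fun_upd_apply) simp
  qed
qed

text \<open>The factor \<open>Suc m\<close> turns the \<open>1 / fact (Suc m)\<close> of the inner
  product into \<open>1 / fact m\<close>. The frame on the right is free, which lets the integrand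
  be written in a frame of fields.\<close>

lemma (in hermitian_form) form_inner_cov_wedge:
  assumes \<beta>: "alt_form m \<beta>" and w: "alt_form (Suc m) w" and l: "linear l" and e: "on_frame B e"
  shows "form_inner B (Suc m) (cov_wedge m l \<beta>) w = (\<Sum>I\<in>{..<Suc m} \<rightarrow>\<^sub>E {..<2 * CARD('n)}.
      l (e (I 0)) * \<beta> (\<lambda>s. e (I (Suc s))) * cnj (w (e \<circ> I))) / fact m"
proof -
  have "of_nat (Suc m) / fact (Suc m) = (1 / fact m :: complex)" by (simp add: field_simps del: of_nat_Suc)
  then have "of_nat (Suc m) * x / fact (Suc m) = x / fact m" for x :: complex
    by (metis (no_types, lifting) mult.commute times_divide_eq_right mult.right_neutral)
  then show ?thesis
    unfolding form_inner_def sum_cov_wedge[OF \<beta> w]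
    using frame_independent[OF multi_form_tensor[OF \<beta> l] alt_form_multi[OF w] on_frame_of e] by simp
qed

lemma ext_deriv_bump:
  "ext_deriv m (\<lambda>y v. of_real (bump z \<epsilon> y) * \<beta> v) y = cov_wedge m (\<lambda>u. of_real (bump_deriv z \<epsilon> y u)) \<beta>"
proof -
  have "frechet_derivative (\<lambda>y. of_real (bump z \<epsilon> y) * c) (at y) = (\<lambda>u. of_real (bump_deriv z \<epsilon> y u) * c)" for c :: complex
    by (rule frechet_derivative_at[symmetric]) (intro has_derivative_mult_left has_derivative_of_real bump_has_derivative)
  then show ?thesis by (simp add: ext_deriv_def cov_wedge_def fun_eq_iff)
qed

lemma test_form_bump:
  assumes "\<epsilon> > 0" "cball z \<epsilon> \<subseteq> S" "alt_form m \<beta>"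
  shows "test_form_on S m (\<lambda>y v. of_real (bump z \<epsilon> y) * \<beta> v)"
  unfolding test_form_on_def smooth_form_on_def
proof (intro conjI allI ballI)
  show "smooth_on S (\<lambda>y. of_real (bump z \<epsilon> y) * \<beta> v)" for v
    by (rule bump_smooth[of "\<lambda>t. of_real t * \<beta> v"])
      (intro bounded_linear_intros bounded_linear_of_real bounded_linear_mult_const)
  show "alt_form m (\<lambda>v. of_real (bump z \<epsilon> y) * \<beta> v)" for y by (rule alt_form_scale[OF assms(3)])
  show "\<exists>K. compact K \<and> K \<subseteq> S \<and> (\<forall>y. y \<notin> K \<longrightarrow> (\<lambda>v. of_real (bump z \<epsilon> y) * \<beta> v) = (\<lambda>v. 0))"
    using assms by (intro exI[of _ "cball z \<epsilon>"]) (auto simp: bump_outside)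
qed

section \<open>From the weak equation to the trace of the covariant derivative\<close>

context kaehler_chart
begin

text \<open>For frame fields with derivative \<open>- christoffel\<close>, differentiating the
  arguments yields exactly the connection terms, so the derivative of a component is a component of
  the covariant derivative.\<close>

lemma nabla_has_derivative:
  fixes \<omega> :: "complex^'n \<Rightarrow> 'n cform"
  assumes z: "z \<in> S" and \<omega>: "\<And>y. y \<in> S \<Longrightarrow> alt_form k (\<omega> y)" and sm: "smooth_form_on S \<omega>"
    and E: "\<And>j. j < k \<Longrightarrow> (E (I j) has_derivative (\<lambda>u. - christoffel G z u (e (I j)))) (at z)" "\<And>i. E i z = e i"
  shows "((\<lambda>y. \<omega> y (\<lambda>j. E (I j) y)) has_derivative (\<lambda>u. nabla_form G k \<omega> z u (e \<circ> I))) (at z)"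
proof -
  define D where "D u v = frechet_derivative (\<lambda>y. \<omega> y v) (at z) u" for u v
  have D: "((\<lambda>y. \<omega> y v) has_derivative (\<lambda>u. D u v)) (at z)" for v
    using smooth_on_has_derivative[OF _ z] sm unfolding D_def smooth_form_on_def by blast
  have "((\<lambda>y. \<omega> y (\<lambda>j. E (I j) y)) has_derivative
    (\<lambda>u. D u (\<lambda>j. E (I j) z) + (\<Sum>j<k. \<omega> z ((\<lambda>j. E (I j) z)(j := - christoffel G z u (e (I j))))))) (at z)"
    by (rule form_eval_has_derivative[OF open_S z \<omega> D E(1)])
  also have "(\<lambda>u. D u (\<lambda>j. E (I j) z) + (\<Sum>j<k. \<omega> z ((\<lambda>j. E (I j) z)(j := - christoffel G z u (e (I j))))))
    = (\<lambda>u. nabla_form G k \<omega> z u (e \<circ> I))"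
  proof
    fix u
    have "\<omega> z ((e \<circ> I)(j := - x)) = - \<omega> z ((e \<circ> I)(j := x))" if "j < k" for j x
      using linear_neg[OF alt_form_linear[OF \<omega>[OF z] that]] .
    moreover have "(\<lambda>j. E (I j) z) = e \<circ> I" by (auto simp: E(2))
    ultimately show "D u (\<lambda>j. E (I j) z) + (\<Sum>j<k. \<omega> z ((\<lambda>j. E (I j) z)(j := - christoffel G z u (e (I j)))))
      = nabla_form G k \<omega> z u (e \<circ> I)"
      by (simp add: nabla_form_def D_def sum_negf)
  qed
  finally show ?thesis .
qed

text \<open>In the application \<beta> is constant in the chart, not parallel, so differentiating
  its frame arguments leaves these terms. Exchanging the entries 0 and s + 1 fixes the Christoffel
  vector, by symmetry, and negates \<open>w\<close>.\<close>

lemma christoffel_terms_cancel: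
  assumes z: "z \<in> S" and w: "alt_form (Suc m) w"
  shows "(\<Sum>I\<in>{..<Suc m} \<rightarrow>\<^sub>E D. (\<Sum>s<m. \<beta> ((\<lambda>s. e (I (Suc s)))(s := - christoffel G z (e (I 0)) (e (I (Suc s))))))
     * cnj (w (e \<circ> I))) = 0"
proof -
  define a where "a s I = \<beta> ((\<lambda>s. e (I (Suc s)))(s := - christoffel G z (e (I 0)) (e (I (Suc s))))) * cnj (w (e \<circ> I))"
    for s I
  have "(\<Sum>I\<in>{..<Suc m} \<rightarrow>\<^sub>E D. a s I) = 0" if s: "s < m" for s
  proof -
    let ?\<tau> = "Transposition.transpose 0 (Suc s)"
    have p: "?\<tau> permutes {..<Suc m}" using s by (intro permutes_swap_id) auto
    have "a s (I \<circ> ?\<tau>) = - a s I" for I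
    proof -
      have "w (e \<circ> (I \<circ> ?\<tau>)) = - w (e \<circ> I)"
        using alt_form_transpose[OF w, of 0 "Suc s" "e \<circ> I"] s by (simp add: o_assoc)
      moreover have "(\<lambda>t. e ((I \<circ> ?\<tau>) (Suc t)))(s := - christoffel G z (e ((I \<circ> ?\<tau>) 0)) (e ((I \<circ> ?\<tau>) (Suc s))))
        = (\<lambda>t. e (I (Suc t)))(s := - christoffel G z (e (I 0)) (e (I (Suc s))))"
        using christoffel_props(2)[OF z, of "e (I (Suc s))" "e (I 0)"]
        by (auto simp: fun_eq_iff Transposition.transpose_def)
      ultimately show ?thesis by (simp only: a_def) simp
    qed
    then have "(\<Sum>I\<in>{..<Suc m} \<rightarrow>\<^sub>E D. a s I) = - (\<Sum>I\<in>{..<Suc m} \<rightarrow>\<^sub>E D. a s I)"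
      using sum_PiE_permutes[OF p, of "a s" D] by (simp add: sum_negf)
    then show ?thesis by simp
  qed
  then have "(\<Sum>s<m. \<Sum>I\<in>{..<Suc m} \<rightarrow>\<^sub>E D. a s I) = 0" by simp
  then show ?thesis unfolding a_def by (subst (asm) sum.swap) (simp only: sum_distrib_right)
qed

end

context kaehler_chart
begin

text \<open>For the test form bump times \<beta> the integrand is, up to a constant, the derivative
  of the bump along a field built from the frame, so this field has divergence zero at z. There the
  derivative of the volume density cancels the divergence of the frame fields, the terms from
  \<beta> cancel among themselves, and the pairing of \<beta> with the covariant derivative is
  left.\<close>

lemma weak_codifferential:
  fixes \<omega> :: "complex^'n \<Rightarrow> 'n cform"
  assumes z: "z \<in> S" and \<omega>: "\<And>y. y \<in> S \<Longrightarrow> alt_form (Suc m) (\<omega> y)" and sm: "smooth_form_on S \<omega>"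
    and weak: "\<And>\<eta>. test_form_on S m \<eta> \<Longrightarrow> l2_inner_on S G (Suc m) (ext_deriv m \<eta>) \<omega> = 0"
    and \<beta>: "alt_form m \<beta>" and e: "on_frame (G z) e"
  shows "(\<Sum>I\<in>{..<Suc m} \<rightarrow>\<^sub>E {..<2 * CARD('n)}.
    \<beta> (\<lambda>s. e (I (Suc s))) * cnj (nabla_form G (Suc m) \<omega> z (e (I 0)) (e \<circ> I))) = 0"
proof -
  let ?N = "2 * CARD('n)"
  let ?X = "{..<Suc m} \<rightarrow>\<^sub>E {..<?N}"
  obtain U E where U: "open U" "z \<in> U" "U \<subseteq> S"
    and Ec: "\<And>i. i < ?N \<Longrightarrow> continuous_on U (E i)" and Ez: "\<And>i. E i z = e i"
    and E': "\<And>i. i < ?N \<Longrightarrow> (E i has_derivative (\<lambda>u. - christoffel G z u (e i))) (at z)"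
    and Eo: "\<And>y. y \<in> U \<Longrightarrow> on_frame (G y) (\<lambda>i. E i y)"
    using local_frame[OF z e] by blast
  obtain r where r: "r > 0" "cball z r \<subseteq> U" using U open_contains_cball by blast
  define vol where "vol y = vol_density (G y)" for y
  define b where "b I y = \<beta> (\<lambda>s. E (I (Suc s)) y)" for I y
  define w where "w I y = \<omega> y (\<lambda>j. E (I j) y)" for I y
  define c where "c I y = vol y *\<^sub>R (b I y * cnj (w I y))" for I y
  define w' where "w' I u = nabla_form G (Suc m) \<omega> z u (e \<circ> I)" for I u
  define b' where "b' I u = (\<Sum>s<m. \<beta> ((\<lambda>s. e (I (Suc s)))(s := - christoffel G z u (e (I (Suc s))))))" for I u
  \<comment> \<open>By symmetry of the Christoffel symbol the frame field \<open>E i\<close> has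
    divergence \<open>- \<theta> (e i)\<close> at z; the logarithmic derivative of the volume
    density is \<theta>.\<close>
  define \<theta> where "\<theta> x = tr (christoffel G z x)" for x
  define c' where "c' I u = vol z *\<^sub>R (b I z * cnj (w' I u) + b' I u * cnj (w I z)) + (vol z * \<theta> u) *\<^sub>R (b I z * cnj (w I z))" for I u
  have I: "I j < ?N" if "I \<in> ?X" "j < Suc m" for I j using that by (auto simp: PiE_iff)
  have I0: "I 0 < ?N" if "I \<in> ?X" for I using I[OF that, of 0] by simp
  have vol: "vol z > 0" "(vol has_derivative (\<lambda>u. vol z * \<theta> u)) (at z)"
    using vol_density_has_derivative[OF z] unfolding vol_def[abs_def] \<theta>_def by auto
  have volc: "continuous_on U vol"
    unfolding vol_def[abs_def] by (rule continuous_on_subset[OF vol_density_continuous U(3)])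
  have bc: "continuous_on U (b I)" if "I \<in> ?X" for I
    unfolding b_def[abs_def] by (rule form_eval_continuous[OF \<beta>]) (auto intro: Ec I[OF that])
  have wc: "continuous_on U (w I)" if "I \<in> ?X" for I
    unfolding w_def[abs_def]
  proof (rule form_eval_continuous[where k="Suc m" and \<omega>=\<omega> and X="\<lambda>j. E (I j)"])
    show "continuous_on U (\<lambda>y. \<omega> y v)" for v
      using sm smooth_on_continuous continuous_on_subset[OF _ U(3)] unfolding smooth_form_on_def by blast
  qed (use \<omega> U in \<open>auto intro: Ec I[OF that]\<close>)
  have cc: "continuous_on U (c I)" if "I \<in> ?X" for I
    unfolding c_def[abs_def] by (intro continuous_intros volc bc wc that)
  have w'd: "(w I has_derivative w' I) (at z)" if "I \<in> ?X" for I
    unfolding w_def[abs_def] w'_def[abs_def]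
    by (rule nabla_has_derivative[OF z \<omega> sm]) (auto intro: E' I[OF that] Ez)
  have b'd: "(b I has_derivative b' I) (at z)" if "I \<in> ?X" for I
  proof -
    have "((\<lambda>y. \<beta> (\<lambda>s. E (I (Suc s)) y)) has_derivative (\<lambda>u. 0 + (\<Sum>s<m. \<beta> ((\<lambda>s. E (I (Suc s)) z)(s := - christoffel G z u (e (I (Suc s)))))))) (at z)"
      by (rule form_eval_has_derivative[OF open_S z \<beta>]) (auto intro: E' I[OF that])
    then show ?thesis by (simp add: b_def[abs_def] b'_def[abs_def] Ez)
  qed
  have c'd: "(c I has_derivative c' I) (at z)" if "I \<in> ?X" for I
    unfolding c_def[abs_def] c'_def[abs_def]
    by (rule has_derivative_scaleR[OF vol(2) has_derivative_mult[OF b'd[OF that] has_derivative_cnj[OF w'd[OF that]]]])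
  \<comment> \<open>The divergence lemma is about real fields; \<rho> will be the real and the
    imaginary part.\<close>
  have main: "\<rho> (\<Sum>I\<in>?X. b I z * cnj (w' I (e (I 0)))) = 0"
    if \<rho>: "bounded_linear \<rho>" for \<rho> :: "complex \<Rightarrow> real"
  proof -
    note \<rho>l = bounded_linear.linear[OF \<rho>]
    define XX where "XX y = (\<Sum>I\<in>?X. \<rho> (c I y) *\<^sub>R E (I 0) y)" for y
    define XX' where "XX' u = (\<Sum>I\<in>?X. \<rho> (c I z) *\<^sub>R (- christoffel G z u (e (I 0))) + \<rho> (c' I u) *\<^sub>R e (I 0))" for u
    have XXc: "continuous_on U XX" unfolding XX_def
      by (rule continuous_on_sum, rule continuous_on_scaleR[OF bounded_linear.continuous_on[OF \<rho> cc] Ec[OF I0]])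
    have XX'd: "(XX has_derivative XX') (at z)"
    proof -
      have "((\<lambda>y. \<Sum>I\<in>?X. \<rho> (c I y) *\<^sub>R E (I 0) y) has_derivative
        (\<lambda>u. \<Sum>I\<in>?X. \<rho> (c I z) *\<^sub>R (- christoffel G z u (e (I 0))) + \<rho> (c' I u) *\<^sub>R E (I 0) z)) (at z)"
        by (rule has_derivative_sum, rule has_derivative_scaleR[OF bounded_linear.has_derivative[OF \<rho> c'd] E'[OF I0]])
      then show ?thesis by (simp add: XX_def[abs_def] XX'_def[abs_def] Ez)
    qed
    have int0: "(\<integral>y. bump_deriv z \<epsilon> y (XX y) \<partial>lborel) = 0" if \<epsilon>: "0 < \<epsilon>" "\<epsilon> \<le> r" for \<epsilon>
    proof -
      define \<eta> where "\<eta> y v = of_real (bump z \<epsilon> y) * \<beta> v" for y v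
      have sub: "cball z \<epsilon> \<subseteq> U" using r \<epsilon> by auto
      have "test_form_on S m \<eta>"
        unfolding \<eta>_def[abs_def] by (rule test_form_bump) (use \<epsilon> sub U \<beta> in auto)
      from weak[OF this] have 0: "l2_inner_on S G (Suc m) (ext_deriv m \<eta>) \<omega> = 0" .
      \<comment> \<open>The integrand written in the frame \<open>E\<close>. Outside the ball both
        expressions vanish with the derivative of the bump, so orthonormality of \<open>E\<close> on
        \<open>U\<close> suffices.\<close>
      define F where "F y = (\<Sum>I\<in>?X. of_real (bump_deriv z \<epsilon> y (E (I 0) y)) * c I y) / fact m" for y
      note lin = linear_bump_deriv[of z \<epsilon>] and expB = bump_deriv_expand[of z \<epsilon>]
      have F_out: "F y = 0" if "y \<notin> ball z \<epsilon>" for y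
        using bump_outside(2)[OF \<epsilon>(1) that] by (simp add: F_def)
      have F_eq: "indicator S y *\<^sub>R (vol_density (G y) *\<^sub>R form_inner (G y) (Suc m) (ext_deriv m \<eta> y) (\<omega> y)) = F y" for y
      proof (cases "y \<in> ball z \<epsilon>")
        case True
        then have yU: "y \<in> U" using sub by auto
        then have yS: "y \<in> S" using U by auto
        interpret y: hermitian_form "G y" by (rule hermitian[OF yS])
        have l: "linear (\<lambda>u. complex_of_real (bump_deriv z \<epsilon> y u))"
          using linear_compose[OF lin bounded_linear.linear[OF bounded_linear_of_real]] by (simp add: o_def)
        show ?thesis
          unfolding \<eta>_def[abs_def] ext_deriv_bump y.form_inner_cov_wedge[OF \<beta> \<omega>[OF yS] l Eo[OF yU]]
          using yS by (simp add: F_def c_def b_def w_def vol_def sum_divide_distrib scaleR_sum_right o_def mult.assoc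
              scaleR_conv_of_real mult.left_commute sum_distrib_left)
      next
        case False
        have "ext_deriv m \<eta> y v = 0" for v
          unfolding \<eta>_def[abs_def] ext_deriv_bump by (simp add: cov_wedge_def bump_outside(2)[OF \<epsilon>(1) False])
        then show ?thesis by (simp add: form_inner_def F_out[OF False])
      qed
      have "integrable lborel (\<lambda>y. indicator (cball z \<epsilon>) y *\<^sub>R F y)"
      proof (rule borel_integrable_compact)
        have s: "continuous_on (cball z \<epsilon>) f" if "continuous_on U f" for f :: "complex^'n \<Rightarrow> 'b::topological_space"
          by (rule continuous_on_subset[OF that sub])
        have "continuous_on (cball z \<epsilon>) (\<lambda>y. bump_deriv z \<epsilon> y (E (I 0) y))" if "I \<in> ?X" for I
          by (subst expB) (intro continuous_intros continuous_on_subset[OF bump_continuous(2) subset_UNIV] s[OF Ec[OF I0[OF that]]])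
        then show "continuous_on (cball z \<epsilon>) F"
          unfolding F_def by (intro continuous_intros s[OF cc]) auto
      qed simp
      moreover have "(\<lambda>y. indicator (cball z \<epsilon>) y *\<^sub>R F y) = F"
        using F_out by (auto simp: indicator_def fun_eq_iff)
      ultimately have Fi: "integrable lborel F" by simp
      have "(\<integral>y. F y \<partial>lborel) = 0"
        using 0 unfolding l2_inner_on_def set_lebesgue_integral_def F_eq .
      then have "(\<integral>y. \<rho> (F y) \<partial>lborel) = 0"
        using integral_bounded_linear[OF \<rho> Fi] linear_0[OF \<rho>l] by simp
      moreover have "\<rho> (F y) = bump_deriv z \<epsilon> y (XX y) / fact m" for y
      proof -
        have "F y = (1 / fact m) *\<^sub>R (\<Sum>I\<in>?X. bump_deriv z \<epsilon> y (E (I 0) y) *\<^sub>R c I y)"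
          by (simp add: F_def scaleR_conv_of_real)
        then show ?thesis
          by (simp add: XX_def linear_sum[OF \<rho>l] linear_cmul[OF \<rho>l] linear_sum[OF lin] linear_cmul[OF lin] mult.commute)
      qed
      ultimately show ?thesis by simp
    qed
    have "tr XX' = 0"
      unfolding tr_def
      by (rule weak_divergence_zero[OF r(1) continuous_on_subset[OF XXc r(2)] XX'd int0])
    moreover have "tr XX' = vol z * \<rho> (\<Sum>I\<in>?X. b I z * cnj (w' I (e (I 0))) + b' I (e (I 0)) * cnj (w I z))"
    proof -
      have trG: "tr (\<lambda>u. christoffel G z u x) = \<theta> x" for x
        unfolding \<theta>_def by (simp only: christoffel_props(2)[OF z, of _ x])
      have c'l: "linear (\<lambda>u. \<rho> (c' I u))" if "I \<in> ?X" for I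
        using linear_compose[OF has_derivative_linear[OF c'd[OF that]] \<rho>l] by (simp add: o_def)
      have "tr XX' = (\<Sum>I\<in>?X. \<rho> (c I z) * (- \<theta> (e (I 0))) + \<rho> (c' I (e (I 0))))"
        unfolding XX'_def[abs_def] tr_sum tr_add tr_scaleR tr_minus trG by (simp add: tr_rank_one[OF c'l])
      also have "\<dots> = (\<Sum>I\<in>?X. vol z * \<rho> (b I z * cnj (w' I (e (I 0))) + b' I (e (I 0)) * cnj (w I z)))"
        by (simp add: c_def c'_def linear_add[OF \<rho>l] linear_cmul[OF \<rho>l] algebra_simps)
      finally show ?thesis by (simp add: linear_sum[OF \<rho>l] sum_distrib_left)
    qed
    moreover have "(\<Sum>I\<in>?X. b' I (e (I 0)) * cnj (w I z)) = 0"
    proof -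
      have "w I z = \<omega> z (e \<circ> I)" for I by (simp add: w_def Ez o_def)
      then show ?thesis using christoffel_terms_cancel[OF z \<omega>[OF z], of \<beta> e "{..<?N}"] by (simp add: b'_def)
    qed
    ultimately show ?thesis using vol by (simp add: sum.distrib)
  qed
  have "(\<Sum>I\<in>?X. b I z * cnj (w' I (e (I 0)))) = 0"
    using main[OF bounded_linear_Re] main[OF bounded_linear_Im] by (simp add: complex_eq_iff)
  then show ?thesis by (simp add: b_def w'_def Ez)
qed

lemma nabla_form_alt:
  fixes \<omega> :: "complex^'n \<Rightarrow> 'n cform"
  assumes z: "z \<in> S" and \<omega>: "\<And>y. y \<in> S \<Longrightarrow> alt_form k (\<omega> y)" and sm: "smooth_form_on S \<omega>"
  shows "alt_form k (nabla_form G k \<omega> z u)" "linear (\<lambda>u. nabla_form G k \<omega> z u v)"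
proof -
  define D where "D u v = frechet_derivative (\<lambda>y. \<omega> y v) (at z) u" for u v
  have D: "((\<lambda>y. \<omega> y v) has_derivative (\<lambda>u. D u v)) (at z)" for v
    using smooth_on_has_derivative[OF _ z] sm unfolding D_def smooth_form_on_def by blast
  have eq: "nabla_form G k \<omega> z u v = D u v + (-1) * slot_deriv k (\<omega> z) (christoffel G z u) v" for u v
    by (simp add: nabla_form_def D_def slot_deriv_def)
  \<comment> \<open>The difference is written as a sum over two elements to bring
    \<open>alt_form_sum\<close> into play.\<close>
  have "alt_form k (\<lambda>v. \<Sum>i\<in>{True, False}. (if i then D u v else (-1) * slot_deriv k (\<omega> z) (christoffel G z u) v))"
  proof (rule alt_form_sum)
    fix i
    show "alt_form k (\<lambda>v. if i then D u v else (-1) * slot_deriv k (\<omega> z) (christoffel G z u) v)"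
      using alt_form_has_derivative[OF open_S z \<omega> D, of u]
        alt_form_scale[OF alt_form_slot_deriv[OF \<omega>[OF z] christoffel_linear(1)[OF z]], of "-1" u]
      by (cases i) auto
  qed
  then show "alt_form k (nabla_form G k \<omega> z u)" by (simp add: eq[abs_def])
  have "linear (\<lambda>u. \<omega> z (v(i := christoffel G z u (v i))))" if "i < k" for i
    using linear_compose[OF christoffel_linear(2)[OF z] alt_form_linear[OF \<omega>[OF z] that]] by (simp add: o_def)
  then show "linear (\<lambda>u. nabla_form G k \<omega> z u v)"
    unfolding nabla_form_def using has_derivative_linear[OF D]
    by (intro linear_compose_sub linear_compose_sum) (auto simp: D_def)
qed

lemma nabla_form_pq_rot:
  fixes \<omega> :: "complex^'n \<Rightarrow> 'n cform"
  assumes z: "z \<in> S" and \<omega>: "\<And>y. y \<in> S \<Longrightarrow> pq_rot p q (\<omega> y)" and sm: "smooth_form_on S \<omega>"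
  shows "pq_rot p q (nabla_form G k \<omega> z u)"
proof -
  define D where "D u v = frechet_derivative (\<lambda>y. \<omega> y v) (at z) u" for u v
  have D: "((\<lambda>y. \<omega> y v) has_derivative (\<lambda>u. D u v)) (at z)" for v
    using smooth_on_has_derivative[OF _ z] sm unfolding D_def smooth_form_on_def by blast
  have eq: "nabla_form G k \<omega> z u v = D u v - slot_deriv k (\<omega> z) (christoffel G z u) v" for u v
    by (simp add: nabla_form_def D_def slot_deriv_def)
  have 1: "pq_rot p q (D u)" by (rule pq_rot_has_derivative[OF open_S z \<omega> D])
  have 2: "pq_rot p q (slot_deriv k (\<omega> z) (christoffel G z u))"
    by (rule pq_rot_slot_deriv[OF \<omega>[OF z] christoffel_complex_linear[OF z]])
  show ?thesis using 1 2 unfolding pq_rot_def eq by (auto simp: algebra_simps)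
qed

text \<open>The trace \<tau> of the covariant derivative is itself an m-form and may serve as
  \<beta> in the weak equation. The pairing is then, up to sign and a positive factor, the sum of
  the squares of its components.\<close>

lemma nabla_form_coclosed:
  fixes \<omega> :: "complex^'n \<Rightarrow> 'n cform"
  assumes z: "z \<in> S" and \<omega>: "\<And>y. y \<in> S \<Longrightarrow> alt_form (Suc m) (\<omega> y)" and sm: "smooth_form_on S \<omega>"
    and weak: "\<And>\<eta>. test_form_on S m \<eta> \<Longrightarrow> l2_inner_on S G (Suc m) (ext_deriv m \<eta>) \<omega> = 0"
    and e: "on_frame (G z) e" and j: "j < Suc m"
  shows "(\<Sum>i<2 * CARD('n). nabla_form G (Suc m) \<omega> z (e i) (v(j := e i))) = 0"
proof -
  interpret hermitian_form "G z" by (rule hermitian[OF z])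
  let ?N = "2 * CARD('n)"
  let ?X = "{..<Suc m} \<rightarrow>\<^sub>E {..<?N}"
  let ?T = "nabla_form G (Suc m) \<omega> z"
  have T: "alt_form (Suc m) (?T u)" for u by (rule nabla_form_alt[OF z \<omega> sm])
  \<comment> \<open>The contraction sits in the last slot m, so that the slots below m are those of
    an m-form without a shift; contraction in slot 0 differs by the sign of a cycle.\<close>
  define \<tau> where "\<tau> w = (\<Sum>i<?N. ?T (e i) (w(m := e i)))" for w
  have \<tau>_alt: "alt_form m \<tau>"
    unfolding \<tau>_def[abs_def]
  proof (rule alt_form_sum)
    fix i
    show "alt_form m (\<lambda>w. ?T (e i) (w(m := e i)))"
      unfolding alt_form_def
    proof (intro conjI allI impI)
      fix v w :: "nat \<Rightarrow> complex^'n" assume "\<forall>i<m. v i = w i"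
      then show "?T (e i) (v(m := e i)) = ?T (e i) (w(m := e i))"
        by (intro alt_form_cong[OF T]) (auto simp: less_Suc_eq)
    next
      fix s and v :: "nat \<Rightarrow> complex^'n" assume s: "s < m"
      then show "linear (\<lambda>x. ?T (e i) ((v(s := x))(m := e i)))"
        using alt_form_linear[OF T, of s "e i" "v(m := e i)"] by (simp add: fun_upd_twist)
    next
      fix \<sigma> and v :: "nat \<Rightarrow> complex^'n" assume \<sigma>: "\<sigma> permutes {..<m}"
      then have "\<sigma> permutes {..<Suc m}" by (rule permutes_subset) auto
      moreover have "(v \<circ> \<sigma>)(m := e i) = (v(m := e i)) \<circ> \<sigma>"
      proof
        fix t
        have "\<sigma> m = m" using permutes_not_in[OF \<sigma>, of m] by simp
        then have "\<sigma> t = m \<longleftrightarrow> t = m" using injD[OF permutes_inj[OF \<sigma>], of t m] by auto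
        then show "((v \<circ> \<sigma>)(m := e i)) t = (v(m := e i) \<circ> \<sigma>) t" by simp
      qed
      ultimately show "?T (e i) ((v \<circ> \<sigma>)(m := e i)) = of_int (sign \<sigma>) * ?T (e i) (v(m := e i))"
        using alt_form_permutes[OF T] by simp
    qed
  qed
  have first: "(\<Sum>i<?N. ?T (e i) (v(0 := e i))) = (-1) ^ m * \<tau> (\<lambda>s. v (Suc s))" for v
  proof -
    have "?T (e i) (v(0 := e i)) = (-1) ^ m * ?T (e i) ((\<lambda>s. v (Suc s))(m := e i))" for i
    proof -
      have "?T (e i) (v(0 := e i)) = ?T (e i) (((\<lambda>s. v (Suc s))(m := e i)) \<circ> cyc m)"
        by (rule alt_form_cong[OF T]) (auto simp: cyc_def)
      then show ?thesis using alt_form_cyc[OF T, of m] by simp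
    qed
    then show ?thesis by (simp add: \<tau>_def sum_distrib_left)
  qed
  \<comment> \<open>A dummy index, introduced at the cost of the factor 2n, is exchanged with
    \<open>I 0\<close>; the covariant derivative is then contracted and becomes \<tau> up to
    sign.\<close>
  have "of_nat ?N * (\<Sum>I\<in>?X. \<tau> (\<lambda>s. e (I (Suc s))) * cnj (?T (e (I 0)) (e \<circ> I)))
    = (\<Sum>I\<in>?X. \<Sum>i<?N. \<tau> (\<lambda>s. e (I (Suc s))) * cnj (?T (e (I 0)) (e \<circ> I)))"
    by (simp add: sum_distrib_left)
  also have "\<dots> = (\<Sum>I\<in>?X. \<Sum>i<?N. \<tau> (\<lambda>s. e (I (Suc s))) * cnj (?T (e i) ((e \<circ> I)(0 := e i))))"
    using sum_slot_swap[of 0 "Suc m" "\<lambda>I i. \<tau> (\<lambda>s. e (I (Suc s))) * cnj (?T (e (I 0)) (e \<circ> I))" "{..<?N}"]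
    by (simp add: fun_upd_comp)
  also have "\<dots> = (\<Sum>I\<in>?X. \<tau> (\<lambda>s. e (I (Suc s))) * cnj ((-1) ^ m * \<tau> (\<lambda>s. e (I (Suc s)))))"
    by (simp only: sum_distrib_left[symmetric] cnj_sum[symmetric] first o_apply)
  also have "\<dots> = (-1) ^ m * of_real (\<Sum>I\<in>?X. (norm (\<tau> (\<lambda>s. e (I (Suc s)))))\<^sup>2)"
    by (simp only: of_real_sum complex_norm_square sum_distrib_left) (simp add: mult_ac)
  finally have "(-1) ^ m * of_real (\<Sum>I\<in>?X. (norm (\<tau> (\<lambda>s. e (I (Suc s)))))\<^sup>2) = (0::complex)"
    using weak_codifferential[OF z \<omega> sm weak \<tau>_alt e] by simp
  then have "(\<Sum>I\<in>?X. (norm (\<tau> (\<lambda>s. e (I (Suc s)))))\<^sup>2) = 0"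
    by (simp only: mult_eq_0_iff of_real_eq_0_iff power_eq_0_iff) simp
  then have s0: "\<tau> (\<lambda>s. e (I (Suc s))) = 0" if "I \<in> ?X" for I
    using that by (subst (asm) sum_nonneg_eq_0_iff) (auto simp: finite_PiE)
  have \<tau>0: "\<tau> w = 0" for w
  proof (rule alt_form_zero_iff[OF \<tau>_alt e])
    fix L assume L: "L \<in> {..<m} \<rightarrow>\<^sub>E {..<?N}"
    \<comment> \<open>The vanishing is known along multi-indices of length \<open>Suc m\<close> with
      entry 0 ignored, so an arbitrary index, here 0, is put in front of \<open>L\<close>.\<close>
    define I where "I j = (if j = 0 then 0 else if j < Suc m then L (j - 1) else undefined)" for j
    have "I \<in> ?X" using L by (auto simp: I_def PiE_iff extensional_def)
    from s0[OF this] have "\<tau> (\<lambda>s. e (I (Suc s))) = 0" .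
    moreover have "\<tau> (\<lambda>s. e (I (Suc s))) = \<tau> (e \<circ> L)"
      by (rule alt_form_cong[OF \<tau>_alt]) (simp add: I_def)
    ultimately show "\<tau> (e \<circ> L) = 0" by simp
  qed
  show ?thesis
  proof (cases "j = 0")
    case True
    then show ?thesis using first[of v] \<tau>0 by simp
  next
    case False
    have "?T (e i) (v(j := e i)) = - ?T (e i) ((v(j := v 0))(0 := e i))" for i
    proof -
      have "v(j := e i) = ((v(j := v 0))(0 := e i)) \<circ> Transposition.transpose 0 j"
        using False by (auto simp: fun_eq_iff Transposition.transpose_def)
      then show ?thesis using alt_form_transpose[OF T, of 0 j] False j by simp
    qed
    then show ?thesis using first[of "v(j := v 0)"] \<tau>0 by (simp add: sum_negf)
  qed
qed

end

section \<open>The refined Kato inequality\<close>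

context kaehler_chart
begin

lemma nabla_form_closed:
  fixes \<omega> :: "complex^'n \<Rightarrow> 'n cform"
  assumes z: "z \<in> S" and \<omega>: "\<And>y. y \<in> S \<Longrightarrow> alt_form k (\<omega> y)" and sm: "smooth_form_on S \<omega>"
    and d: "ext_deriv k \<omega> z = (\<lambda>v. 0)"
  shows "nabla_form G k \<omega> z x v = (\<Sum>j<k. nabla_form G k \<omega> z (v j) (v(j := x)))"
proof -
  define D where "D u v = frechet_derivative (\<lambda>y. \<omega> y v) (at z) u" for u v
  have D: "((\<lambda>y. \<omega> y v) has_derivative (\<lambda>u. D u v)) (at z)" for v
    using smooth_on_has_derivative[OF _ z] sm unfolding D_def smooth_form_on_def by blast
  have "D x v = (\<Sum>j<k. D (v j) (v(j := x)))"
  proof (rule closed_slot_form)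
    show "alt_form k (D u)" for u by (rule alt_form_has_derivative[OF open_S z \<omega> D])
    show "(\<Sum>i\<le>k. (-1) ^ i * D (v i) (\<lambda>j. v (if j < i then j else Suc j))) = 0" for v
      using fun_cong[OF d, of v] by (simp add: ext_deriv_def D_def)
  qed
  from closed_covariant[OF \<omega>[OF z], where G="christoffel G z", OF christoffel_props(2)[OF z] this]
  show ?thesis by (simp only: nabla_form_def D_def slot_deriv_def)
qed

text \<open>\<open>form_norm\<close> chooses its frame separately at each point. By frame
  independence it equals the norm in the field frame \<open>E\<close>, whose square is a finite sum
  differentiable at z. The frame is parallel there, so only the covariant derivative of \<omega>
  appears, and positivity at z makes the square root differentiable.\<close>

lemma form_norm_has_derivative:
  fixes \<omega> :: "complex^'n \<Rightarrow> 'n cform"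
  assumes z: "z \<in> S" and \<omega>: "\<And>y. y \<in> S \<Longrightarrow> alt_form k (\<omega> y)" and sm: "smooth_form_on S \<omega>"
    and e: "on_frame (G z) e" and nz: "\<omega> z \<noteq> (\<lambda>v. 0)"
  shows "form_norm (G z) k (\<omega> z) > 0"
    and "((\<lambda>y. form_norm (G y) k (\<omega> y)) has_derivative
      (\<lambda>u. Re (\<Sum>I\<in>{..<k} \<rightarrow>\<^sub>E {..<2 * CARD('n)}. nabla_form G k \<omega> z u (e \<circ> I) * cnj (\<omega> z (e \<circ> I)))
        / (fact k * form_norm (G z) k (\<omega> z)))) (at z)"
proof -
  interpret hermitian_form "G z" by (rule hermitian[OF z])
  let ?N = "2 * CARD('n)"
  let ?X = "{..<k} \<rightarrow>\<^sub>E {..<?N}"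
  obtain U E where U: "open U" "z \<in> U" "U \<subseteq> S"
    and "\<And>i. i < ?N \<Longrightarrow> continuous_on U (E i)" and Ez: "\<And>i. E i z = e i"
    and E': "\<And>i. i < ?N \<Longrightarrow> (E i has_derivative (\<lambda>u. - christoffel G z u (e i))) (at z)"
    and Eo: "\<And>y. y \<in> U \<Longrightarrow> on_frame (G y) (\<lambda>i. E i y)"
    using local_frame[OF z e] by blast
  define w where "w I y = \<omega> y (\<lambda>j. E (I j) y)" for I y
  define w' where "w' I u = nabla_form G k \<omega> z u (e \<circ> I)" for I u
  define f where "f y = (\<Sum>I\<in>?X. w I y \<bullet> w I y) / fact k" for y
  have nonneg: "form_norm B' k \<alpha> \<ge> 0" for B' and \<alpha> :: "'n cform"
  proof -
    have "form_inner B' k \<alpha> \<alpha> = complex_of_real ((\<Sum>I\<in>?X. (norm (\<alpha> (frame_of B' \<circ> I)))\<^sup>2) / fact k)"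
      unfolding form_inner_def by (simp only: of_real_divide of_real_sum of_real_fact complex_norm_square)
    then show ?thesis unfolding form_norm_def by (simp only: Re_complex_of_real) (simp add: sum_nonneg)
  qed
  have fn: "form_norm (G y) k (\<omega> y) = sqrt (f y)" if y: "y \<in> U" for y
  proof -
    have yS: "y \<in> S" using y U by auto
    interpret y: hermitian_form "G y" by (rule hermitian[OF yS])
    have "(form_norm (G y) k (\<omega> y))\<^sup>2 = f y"
      by (simp add: y.form_norm_frame[OF \<omega>[OF yS] Eo[OF y]] f_def w_def dot_square_norm o_def)
    then show ?thesis using nonneg by (metis real_sqrt_unique)
  qed
  have wz: "w I z = \<omega> z (e \<circ> I)" for I by (simp add: w_def Ez o_def)
  have fz: "f z > 0"
  proof -
    have "\<exists>I\<in>?X. \<omega> z (e \<circ> I) \<noteq> 0"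
      using alt_form_zero_iff[OF \<omega>[OF z] e] nz by blast
    then have "(\<Sum>I\<in>?X. w I z \<bullet> w I z) > 0"
      by (auto simp: wz finite_PiE intro: sum_pos2)
    then show ?thesis by (simp add: f_def)
  qed
  then show pos: "form_norm (G z) k (\<omega> z) > 0" using fn[OF U(2)] by simp
  have w': "(w I has_derivative w' I) (at z)" if "I \<in> ?X" for I
    unfolding w_def[abs_def] w'_def[abs_def]
  proof (rule nabla_has_derivative[OF z \<omega> sm])
    fix j assume "j < k"
    then have "I j < ?N" using that by (auto simp: PiE_iff)
    then show "(E (I j) has_derivative (\<lambda>u. - christoffel G z u (e (I j)))) (at z)" by (rule E')
  qed (simp_all add: Ez)
  have "(f has_derivative (\<lambda>u. (\<Sum>I\<in>?X. w I z \<bullet> w' I u + w' I u \<bullet> w I z) / fact k)) (at z)"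
    unfolding f_def[abs_def]
    by (rule bounded_linear.has_derivative[OF bounded_linear_divide], rule has_derivative_sum,
        rule has_derivative_inner[OF w' w'])
  from has_derivative_real_sqrt[OF fz this]
  have "((\<lambda>y. sqrt (f y)) has_derivative
     (\<lambda>u. (\<Sum>I\<in>?X. w I z \<bullet> w' I u + w' I u \<bullet> w I z) / fact k * (inverse (sqrt (f z)) / 2))) (at z)" .
  also have "(\<lambda>u. (\<Sum>I\<in>?X. w I z \<bullet> w' I u + w' I u \<bullet> w I z) / fact k * (inverse (sqrt (f z)) / 2))
    = (\<lambda>u. Re (\<Sum>I\<in>?X. w' I u * cnj (\<omega> z (e \<circ> I))) / (fact k * form_norm (G z) k (\<omega> z)))"
  proof
    fix u
    have "w I z \<bullet> w' I u + w' I u \<bullet> w I z = 2 * Re (w' I u * cnj (\<omega> z (e \<circ> I)))" for I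
      by (simp add: wz inner_complex_def)
    then have eq: "(\<Sum>I\<in>?X. w I z \<bullet> w' I u + w' I u \<bullet> w I z) = 2 * Re (\<Sum>I\<in>?X. w' I u * cnj (\<omega> z (e \<circ> I)))"
      by (simp only: sum_distrib_left Re_sum)
    have half: "2 * R / a * (inverse r / 2) = R / (a * r)" for R a r :: real
      by (cases "a = 0"; cases "r = 0"; simp add: field_simps)
    show "(\<Sum>I\<in>?X. w I z \<bullet> w' I u + w' I u \<bullet> w I z) / fact k * (inverse (sqrt (f z)) / 2)
      = Re (\<Sum>I\<in>?X. w' I u * cnj (\<omega> z (e \<circ> I))) / (fact k * form_norm (G z) k (\<omega> z))"
      unfolding eq fn[OF U(2)] by (rule half)
  qed
  finally show "((\<lambda>y. form_norm (G y) k (\<omega> y)) has_derivative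
      (\<lambda>u. Re (\<Sum>I\<in>?X. nabla_form G k \<omega> z u (e \<circ> I) * cnj (\<omega> z (e \<circ> I)))
        / (fact k * form_norm (G z) k (\<omega> z)))) (at z)"
    unfolding w'_def by (rule has_derivative_transform_within_open[OF _ U(1,2)]) (simp add: fn)
qed

theorem refined_kato:
  fixes \<omega> :: "complex^'n \<Rightarrow> 'n cform"
  assumes z: "z \<in> S" and k: "k = p + q" and pq: "p \<le> CARD('n)" "q \<le> CARD('n)"
    and \<omega>: "\<And>y. y \<in> S \<Longrightarrow> pq_form p q (\<omega> y)" and sm: "smooth_form_on S \<omega>"
    and d: "ext_deriv k \<omega> z = (\<lambda>v. 0)"
    and weak: "\<And>m \<eta>. k = Suc m \<Longrightarrow> test_form_on S m \<eta> \<Longrightarrow> l2_inner_on S G (Suc m) (ext_deriv m \<eta>) \<omega> = 0"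
    and nz: "\<omega> z \<noteq> (\<lambda>v. 0)"
  shows "covector_norm (G z) (frechet_derivative (\<lambda>y. form_norm (G y) k (\<omega> y)) (at z))
    \<le> sqrt (min (kato_const CARD('n) p) (kato_const CARD('n) q)) * cotensor_norm (G z) k (nabla_form G k \<omega> z)"
proof -
  interpret hermitian_form "G z" by (rule hermitian[OF z])
  let ?N = "2 * CARD('n)"
  let ?X = "{..<k} \<rightarrow>\<^sub>E {..<?N}"
  let ?T = "nabla_form G k \<omega> z"
  define \<kappa> where "\<kappa> = min (kato_const CARD('n) p) (kato_const CARD('n) q)"
  have e: "on_frame (G z) fr" by (rule on_frame_of)
  have alt: "alt_form k (\<omega> y)" and rot: "pq_rot p q (\<omega> y)" if "y \<in> S" for y
    using pq_form_alt_form[OF \<omega>[OF that]] pq_form_pq_rot[OF \<omega>[OF that]] k by auto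
  have T: "alt_form k (?T u)" "linear (\<lambda>u. ?T u v)" "pq_rot p q (?T u)" for u v
    using nabla_form_alt[OF z alt sm] nabla_form_pq_rot[OF z rot sm] by auto
  have closed: "?T x v = (\<Sum>j<k. ?T (v j) (v(j := x)))" for x v
    by (rule nabla_form_closed[OF z alt sm d])
  have coclosed: "(\<Sum>i<?N. ?T (fr i) (v(j := fr i))) = 0" if j: "j < k" for j v
  proof -
    obtain m where m: "k = Suc m" using j by (cases k) auto
    show ?thesis unfolding m
      by (rule nabla_form_coclosed[OF z alt[unfolded m] sm weak[OF m] e j[unfolded m]])
  qed
  define n where "n = form_norm (G z) k (\<omega> z)"
  define \<rho> where "\<rho> u = Re (\<Sum>I\<in>?X. ?T u (fr \<circ> I) * cnj (\<omega> z (fr \<circ> I))) / (fact k * n)" for u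
  have n0: "n > 0" and der: "((\<lambda>y. form_norm (G y) k (\<omega> y)) has_derivative \<rho>) (at z)"
    using form_norm_has_derivative(1)[OF z alt sm e nz] form_norm_has_derivative(2)[OF z alt sm e nz]
    unfolding n_def \<rho>_def[abs_def] by blast+
  have fd: "frechet_derivative (\<lambda>y. form_norm (G y) k (\<omega> y)) (at z) = \<rho>"
    by (rule frechet_derivative_at[OF der, symmetric])
  have \<rho>_lin: "linear \<rho>" by (rule has_derivative_linear[OF der])
  define TT where "TT = (\<Sum>i<?N. \<Sum>I\<in>?X. (norm (?T (fr i) (fr \<circ> I)))\<^sup>2)"
  have ct: "cotensor_norm (G z) k ?T = sqrt (TT / fact k)"
    by (simp add: cotensor_norm_def form_norm_frame[OF T(1) e] TT_def sum_divide_distrib)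
  have nn: "(\<Sum>I\<in>?X. (norm (\<omega> z (fr \<circ> I)))\<^sup>2) = fact k * n\<^sup>2"
    using form_norm_frame[OF alt[OF z] e] by (simp add: n_def)
  have TT0: "TT \<ge> 0" unfolding TT_def by (intro sum_nonneg) auto
  have \<kappa>0: "\<kappa> \<ge> 0" using pq by (auto simp: \<kappa>_def kato_const_def le_max_iff_disj)
  have bound: "(\<rho> u)\<^sup>2 \<le> \<kappa> * (TT / fact k)" if u: "G z u u = 1" for u
  proof -
    let ?s = "\<Sum>I\<in>?X. ?T u (fr \<circ> I) * cnj (\<omega> z (fr \<circ> I))"
    have "(norm ?s)\<^sup>2 \<le> \<kappa> * TT * (fact k * n\<^sup>2)"
      using kato_pointwise[OF k pq alt[OF z] rot[OF z] T(1,3,2) closed coclosed u]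
      unfolding nn TT_def \<kappa>_def .
    moreover have "(Re ?s)\<^sup>2 \<le> (norm ?s)\<^sup>2"
      by (simp only: cmod_power2) simp
    ultimately have "(Re ?s)\<^sup>2 / (fact k * n)\<^sup>2 \<le> \<kappa> * TT * (fact k * n\<^sup>2) / (fact k * n)\<^sup>2"
      by (intro divide_right_mono) auto
    also have "\<dots> = \<kappa> * (TT / fact k)" using n0 by (simp add: power2_eq_square)
    finally show ?thesis by (simp add: \<rho>_def power_divide)
  qed
  define s where "s = covector_norm (G z) \<rho>"
  have s2: "s\<^sup>2 = (\<Sum>i<?N. (\<rho> (fr i))\<^sup>2)" and s0: "s \<ge> 0"
    unfolding s_def covector_norm_def by (simp_all add: sum_nonneg)
  have "s \<le> sqrt \<kappa> * sqrt (TT / fact k)"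
  proof (cases "s = 0")
    case True
    then show ?thesis using \<kappa>0 TT0 by simp
  next
    case False
    \<comment> \<open>The unit vector dual to \<rho>, on which \<rho> attains its norm s. The
      pointwise bound uses a unitary frame adapted to this vector.\<close>
    define u where "u = (\<Sum>i<?N. (\<rho> (fr i) / s) *\<^sub>R fr i)"
    have uf: "G z u (fr j) = \<rho> (fr j) / s" if "j < ?N" for j
    proof -
      have "G z u (fr j) = (\<Sum>i<?N. \<rho> (fr i) / s * (if i = j then 1 else 0))"
        unfolding u_def B_simps
        by (intro sum.cong refl) (use e that in \<open>auto simp: on_frame_def\<close>)
      then show ?thesis using that by (simp only: sum_mult_delta)
    qed
    have "G z u u = (\<Sum>i<?N. G z u (fr i) * G z u (fr i))"
      using onfam_parseval[OF fr_onfam, of u u] by (simp add: mult.commute[of 2])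
    also have "\<dots> = (\<Sum>i<?N. (\<rho> (fr i))\<^sup>2) / s\<^sup>2" unfolding sum_divide_distrib
      by (intro sum.cong refl) (simp add: uf power2_eq_square)
    also have "\<dots> = s\<^sup>2 / s\<^sup>2" by (simp only: s2)
    finally have "G z u u = 1" using False by simp
    from bound[OF this] have b: "(\<rho> u)\<^sup>2 \<le> \<kappa> * (TT / fact k)" .
    have "\<rho> u = (\<Sum>i<?N. \<rho> (fr i) / s * \<rho> (fr i))"
      by (simp add: u_def linear_sum[OF \<rho>_lin] linear_cmul[OF \<rho>_lin])
    also have "\<dots> = (\<Sum>i<?N. (\<rho> (fr i))\<^sup>2) / s" unfolding sum_divide_distrib
      by (intro sum.cong refl) (simp add: power2_eq_square)
    also have "\<dots> = s\<^sup>2 / s" by (simp only: s2)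
    also have "\<dots> = s" using False by (simp add: power2_eq_square)
    finally have "s\<^sup>2 \<le> \<kappa> * (TT / fact k)" using b by simp
    then have "s \<le> sqrt (\<kappa> * (TT / fact k))" by (rule real_le_rsqrt)
    then show ?thesis by (simp only: real_sqrt_mult)
  qed
  then show ?thesis unfolding fd ct s_def \<kappa>_def .
qed

end

theorem theorem4p1:
  fixes X :: "'a topology"
    and A :: "('a, 'n::finite) cchart set"
    and g :: "('a, 'n) cchart \<Rightarrow> 'n rmetric"
    and \<omega> :: "('a, 'n) cchart \<Rightarrow> complex^'n \<Rightarrow> 'n cform"
    and n p q :: nat
    and \<alpha> :: real
  assumes "kaehler_manifold X A g"
    and "n = CARD('n)" and "p \<le> n" and "q \<le> n"
    and "smooth_pq_form A p q \<omega>"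
    and d_zero: "\<forall>c\<in>A. \<forall>z\<in>chart_image c. ext_deriv (p + q) (\<omega> c) z = (\<lambda>v. 0)"
    and dstar_zero: "is_dstar A g (p + q) \<omega> (\<lambda>c z v. 0)"
    and "\<alpha> \<ge> 0"
    and "\<alpha>\<^sup>2 =
      (if p \<in> {0, n} \<or> q \<in> {0, n} then 1 / 2
       else min (max ((2 * real p + 1) / (2 * real p + 2))
                     ((2 * real n - 2 * real p + 1) / (2 * real n - 2 * real p + 2)))
                (max ((2 * real q + 1) / (2 * real q + 2))
                     ((2 * real n - 2 * real q + 1) / (2 * real n - 2 * real q + 2))))"
  shows "\<forall>c\<in>A. \<forall>x\<in>fst c. \<omega> c (snd c x) \<noteq> (\<lambda>v. 0) \<longrightarrow>
    covector_norm (g c (snd c x))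
      (frechet_derivative (\<lambda>y. form_norm (g c y) (p + q) (\<omega> c y)) (at (snd c x)))
    \<le> \<alpha> * cotensor_norm (g c (snd c x)) (p + q)
              (nabla_form (g c) (p + q) (\<omega> c) (snd c x))"
proof (intro ballI impI)
  fix c x assume c: "c \<in> A" and x: "x \<in> fst c" and nz: "\<omega> c (snd c x) \<noteq> (\<lambda>v. 0)"
  have z: "snd c x \<in> chart_image c" using x by (simp add: chart_image_def)
  interpret kaehler_chart "chart_image c" "g c"
    using assms(1) c unfolding kaehler_manifold_def complex_manifold_def by unfold_locales blast+
  have weak: "l2_inner_on (chart_image c) (g c) (Suc m) (ext_deriv m \<eta>) (\<omega> c) = 0"
    if "p + q = Suc m" "test_form_on (chart_image c) m \<eta>" for m \<eta>
  proof -
    have "l2_inner_on (chart_image c) (g c) (Suc m) (ext_deriv m \<eta>) (\<omega> c)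
      = l2_inner_on (chart_image c) (g c) m \<eta> (\<lambda>z v. 0)"
      using dstar_zero c that by (simp add: is_dstar_def)
    also have "\<dots> = 0" by (simp add: l2_inner_on_def form_inner_def set_lebesgue_integral_def)
    finally show ?thesis .
  qed
  have sm: "smooth_form_on (chart_image c) (\<omega> c)" "\<And>y. y \<in> chart_image c \<Longrightarrow> pq_form p q (\<omega> c y)"
    using assms(5) c unfolding smooth_pq_form_def by blast+
  \<comment> \<open>In the boundary case \<open>\<alpha>\<^sup>2\<close> is 1/2, the constant of
    whichever of p and q is at the boundary, and the minimum is no larger. Otherwise both sides
    agree.\<close>
  have "min (kato_const n p) (kato_const n q) \<le> \<alpha>\<^sup>2"
    using assms(9) by (auto simp: kato_const_def min_le_iff_disj split: if_splits)
  then have "sqrt (min (kato_const n p) (kato_const n q)) \<le> \<alpha>"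
    using assms(8) by (rule real_le_lsqrt[rotated])
  moreover have "cotensor_norm (g c (snd c x)) (p + q) (nabla_form (g c) (p + q) (\<omega> c) (snd c x)) \<ge> 0"
    unfolding cotensor_norm_def by (simp add: sum_nonneg)
  ultimately have "sqrt (min (kato_const n p) (kato_const n q)) * cotensor_norm (g c (snd c x)) (p + q) (nabla_form (g c) (p + q) (\<omega> c) (snd c x))
      \<le> \<alpha> * cotensor_norm (g c (snd c x)) (p + q) (nabla_form (g c) (p + q) (\<omega> c) (snd c x))"
    by (rule mult_right_mono)
  moreover have "covector_norm (g c (snd c x))
      (frechet_derivative (\<lambda>y. form_norm (g c y) (p + q) (\<omega> c y)) (at (snd c x)))
    \<le> sqrt (min (kato_const n p) (kato_const n q)) * cotensor_norm (g c (snd c x)) (p + q) (nabla_form (g c) (p + q) (\<omega> c) (snd c x))"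
    unfolding assms(2)
    by (rule refined_kato[OF z refl]) (use assms(2-4) sm nz weak d_zero c z in auto)
  ultimately show "covector_norm (g c (snd c x))
      (frechet_derivative (\<lambda>y. form_norm (g c y) (p + q) (\<omega> c y)) (at (snd c x)))
    \<le> \<alpha> * cotensor_norm (g c (snd c x)) (p + q) (nabla_form (g c) (p + q) (\<omega> c) (snd c x))"
    by (rule order_trans[rotated])
qed

end
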